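(* The category of trees $\Omega$ is aspherical, i.e. the unique functor from $\Omega$ to the terminal category is a weak equivalence (the nerve of $\Omega$ is weakly contractible).
   Context: A functor $u:A\to B$ between small categories is a weak equivalence if its nerve $N(u)$ is a weak homotopy equivalence of simplicial sets. **Trees.** A tree means a finite non-planar rooted tree (in the sense of dendroidal sets): it has a finite non-empty set of edges and a finite set of vertices; each vertex has exactly one output edge and a finite, possibly empty, set of input edges; every edge is the output of at most one vertex and an input of at most one vertex; exactly one edge, the root, is not an input of any vertex, and going downwards from any edge one reaches the root. Edges which are not the output of any vertex are called leaves. The tree $\eta$ with one edge and no vertex is allowed. **The category $\Omega$.** "Operad" means symmetric coloured operad (in sets). Each tree $T$ generates an operad $\Omega(T)$: its colours are the edges of $T$, and it is the free operad generated by the vertices of $T$, a vertex being regarded as an operation from its input edges (ordered by a chosen planar structure; the result does not depend on the choice) to its output edge. Thus $\Omega(T)(e_1,\dots,e_n;e)$ has one element if $e_1,\dots,e_n$ are distinct and are exactly the leaves of a subtree of $T$ with root $e$, and is empty otherwise. The objects of $\Omega$ are trees, and morphisms $S\to T$ are morphisms of operads $\Omega(S)\to\Omega(T)$. *)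

theory Defs
  imports
    "HOL-Homology.Homology"
    "HOL-Combinatorics.Permutations"
    "HOL-Library.Infinite_Typeclass"
begin

section \<open>Categories and functors\<close>

record ('o, 'a) category =
  Obj :: "'o set"
  Arr :: "'a set"
  Dom :: "'a \<Rightarrow> 'o"
  Cod :: "'a \<Rightarrow> 'o"
  Id :: "'o \<Rightarrow> 'a"
  Comp :: "'a \<Rightarrow> 'a \<Rightarrow> 'a"  \<comment> \<open>\<open>Comp C g f\<close> is "g after f"\<close>

definition is_category :: "('o, 'a) category \<Rightarrow> bool" where
  "is_category C \<longleftrightarrow>
     (\<forall>f\<in>Arr C. Dom C f \<in> Obj C \<and> Cod C f \<in> Obj C) \<and>
     (\<forall>x\<in>Obj C. Id C x \<in> Arr C \<and> Dom C (Id C x) = x \<and> Cod C (Id C x) = x) \<and>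
     (\<forall>f\<in>Arr C. \<forall>g\<in>Arr C. Dom C g = Cod C f \<longrightarrow>
        Comp C g f \<in> Arr C \<and> Dom C (Comp C g f) = Dom C f \<and> Cod C (Comp C g f) = Cod C g) \<and>
     (\<forall>f\<in>Arr C. Comp C f (Id C (Dom C f)) = f \<and> Comp C (Id C (Cod C f)) f = f) \<and>
     (\<forall>f\<in>Arr C. \<forall>g\<in>Arr C. \<forall>h\<in>Arr C. Dom C g = Cod C f \<and> Dom C h = Cod C g \<longrightarrow>
        Comp C h (Comp C g f) = Comp C (Comp C h g) f)"

record ('o, 'a, 'p, 'b) cat_functor =
  obj_map :: "'o \<Rightarrow> 'p"
  arr_map :: "'a \<Rightarrow> 'b"

text \<open>The two components are extensional, so that equality of functors is equality of records.\<close>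

definition is_functor ::
    "('o, 'a) category \<Rightarrow> ('p, 'b) category \<Rightarrow> ('o, 'a, 'p, 'b) cat_functor \<Rightarrow> bool" where
  "is_functor C D F \<longleftrightarrow>
     obj_map F \<in> Obj C \<rightarrow>\<^sub>E Obj D \<and>
     arr_map F \<in> Arr C \<rightarrow>\<^sub>E Arr D \<and>
     (\<forall>f\<in>Arr C. Dom D (arr_map F f) = obj_map F (Dom C f) \<and>
                 Cod D (arr_map F f) = obj_map F (Cod C f)) \<and>
     (\<forall>x\<in>Obj C. arr_map F (Id C x) = Id D (obj_map F x)) \<and>
     (\<forall>f\<in>Arr C. \<forall>g\<in>Arr C. Dom C g = Cod C f \<longrightarrow>
        arr_map F (Comp C g f) = Comp D (arr_map F g) (arr_map F f))"

definition functor_comp ::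
    "('o, 'a) category \<Rightarrow> ('p, 'b, 'q, 'c) cat_functor \<Rightarrow> ('o, 'a, 'p, 'b) cat_functor
      \<Rightarrow> ('o, 'a, 'q, 'c) cat_functor" where
  "functor_comp C G F =
     \<lparr>obj_map = compose (Obj C) (obj_map G) (obj_map F),
      arr_map = compose (Arr C) (arr_map G) (arr_map F)\<rparr>"

lemma is_functor_comp:
  assumes F: "is_functor C D F" and G: "is_functor D E G"
    and C: "\<And>x. x \<in> Obj C \<Longrightarrow> Id C x \<in> Arr C" "\<And>f. f \<in> Arr C \<Longrightarrow> Dom C f \<in> Obj C \<and> Cod C f \<in> Obj C"
      "\<And>f g. \<lbrakk>f \<in> Arr C; g \<in> Arr C; Dom C g = Cod C f\<rbrakk> \<Longrightarrow> Comp C g f \<in> Arr C"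
  shows "is_functor C E (functor_comp C G F)"
proof -
  have obj: "obj_map F x \<in> Obj D" if "x \<in> Obj C" for x
    using F that by (auto simp: is_functor_def)
  have arr: "arr_map F f \<in> Arr D" if "f \<in> Arr C" for f
    using F that by (auto simp: is_functor_def)
  have obj': "obj_map G x \<in> Obj E" if "x \<in> Obj D" for x
    using G that by (auto simp: is_functor_def)
  have arr': "arr_map G f \<in> Arr E" if "f \<in> Arr D" for f
    using G that by (auto simp: is_functor_def)
  have 1: "compose (Obj C) (obj_map G) (obj_map F) \<in> Obj C \<rightarrow>\<^sub>E Obj E"
    using obj obj' by (simp add: compose_def)
  have 2: "compose (Arr C) (arr_map G) (arr_map F) \<in> Arr C \<rightarrow>\<^sub>E Arr E"
    using arr arr' by (simp add: compose_def)
  show ?thesis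
    unfolding is_functor_def functor_comp_def cat_functor.simps
  proof (intro conjI ballI impI 1 2)
    fix f assume f: "f \<in> Arr C"
    then show "Dom E (compose (Arr C) (arr_map G) (arr_map F) f) =
          compose (Obj C) (obj_map G) (obj_map F) (Dom C f)"
      and "Cod E (compose (Arr C) (arr_map G) (arr_map F) f) =
          compose (Obj C) (obj_map G) (obj_map F) (Cod C f)"
      using F G C(2)[OF f] arr[OF f] by (simp_all add: is_functor_def compose_eq)
  next
    fix x assume x: "x \<in> Obj C"
    then show "compose (Arr C) (arr_map G) (arr_map F) (Id C x) =
        Id E (compose (Obj C) (obj_map G) (obj_map F) x)"
      using F G C(1)[OF x] obj[OF x] by (simp add: is_functor_def compose_eq)
  next
    fix f g assume fg: "f \<in> Arr C" "g \<in> Arr C" "Dom C g = Cod C f"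
    have "Dom D (arr_map F g) = Cod D (arr_map F f)"
      using F fg by (simp add: is_functor_def)
    then show "compose (Arr C) (arr_map G) (arr_map F) (Comp C g f) =
        Comp E (compose (Arr C) (arr_map G) (arr_map F) g) (compose (Arr C) (arr_map G) (arr_map F) f)"
      using F G fg C(3)[OF fg] arr[OF fg(1)] arr[OF fg(2)] by (simp add: is_functor_def compose_eq)
  qed
qed

lemma functor_comp_assoc:
  assumes "is_functor C D F"
  shows "functor_comp C (functor_comp D H G) F = functor_comp C H (functor_comp C G F)"
proof -
  have "obj_map F x \<in> Obj D" if "x \<in> Obj C" for x
    using assms that by (auto simp: is_functor_def)
  moreover have "arr_map F f \<in> Arr D" if "f \<in> Arr C" for f
    using assms that by (auto simp: is_functor_def)
  ultimately show ?thesis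
    by (simp add: functor_comp_def compose_def fun_eq_iff)
qed

definition terminal_category :: "(unit, unit) category" where
  "terminal_category =
     \<lparr>Obj = UNIV, Arr = UNIV, Dom = (\<lambda>_. ()), Cod = (\<lambda>_. ()), Id = (\<lambda>_. ()), Comp = (\<lambda>_ _. ())\<rparr>"

definition to_terminal :: "('o, 'a) category \<Rightarrow> ('o, 'a, unit, unit) cat_functor" where
  "to_terminal C = \<lparr>obj_map = (\<lambda>_\<in>Obj C. ()), arr_map = (\<lambda>_\<in>Arr C. ())\<rparr>"

lemma is_category_terminal: "is_category terminal_category"
  by (simp add: is_category_def terminal_category_def)

lemma is_functor_to_terminal_iff: "is_functor C terminal_category F \<longleftrightarrow> F = to_terminal C"
  by (cases F) (auto simp: is_functor_def terminal_category_def to_terminal_def fun_eq_iff)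

text \<open>The poset \<open>{0 \<le> 1 \<le> \<dots> \<le> n}\<close> as a category.\<close>

definition ordinal :: "nat \<Rightarrow> (nat, nat \<times> nat) category" where
  "ordinal n =
     \<lparr>Obj = {..n}, Arr = {(i, j). i \<le> j \<and> j \<le> n}, Dom = fst, Cod = snd,
      Id = (\<lambda>i. (i, i)), Comp = (\<lambda>g f. (fst f, snd g))\<rparr>"

definition monotone_maps :: "nat \<Rightarrow> nat \<Rightarrow> (nat \<Rightarrow> nat) set" where
  "monotone_maps m n = {\<theta>. \<theta> \<in> {..m} \<rightarrow> {..n} \<and> mono_on {..m} \<theta>}"

definition ordinal_map :: "nat \<Rightarrow> (nat \<Rightarrow> nat) \<Rightarrow> (nat, nat \<times> nat, nat, nat \<times> nat) cat_functor" where
  "ordinal_map m \<theta> =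
     \<lparr>obj_map = restrict \<theta> (Obj (ordinal m)),
      arr_map = (\<lambda>(i, j)\<in>Arr (ordinal m). (\<theta> i, \<theta> j))\<rparr>"

lemma is_functor_ordinal_map:
  assumes "\<theta> \<in> monotone_maps m n"
  shows "is_functor (ordinal m) (ordinal n) (ordinal_map m \<theta>)"
proof -
  have "\<theta> i \<le> n" if "i \<le> m" for i
    using assms that by (auto simp: monotone_maps_def)
  moreover have "\<theta> i \<le> \<theta> j" if "i \<le> j" "j \<le> m" for i j
    using assms that by (auto simp: monotone_maps_def mono_on_def)
  ultimately show ?thesis
    unfolding is_functor_def ordinal_map_def ordinal_def cat_functor.simps category.simps
    by (intro conjI) (auto simp del: restrict_apply simp: restrict_apply')
qed

lemma functor_comp_ordinal_map:
  assumes "\<theta> \<in> monotone_maps l m"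
  shows "functor_comp (ordinal l) (ordinal_map m \<psi>) (ordinal_map l \<theta>) = ordinal_map l (\<psi> \<circ> \<theta>)"
proof -
  have "\<theta> i \<le> m" if "i \<le> l" for i
    using assms that by (auto simp: monotone_maps_def)
  moreover have "\<theta> i \<le> \<theta> j" if "i \<le> j" "j \<le> l" for i j
    using assms that by (auto simp: monotone_maps_def mono_on_def)
  ultimately show ?thesis
    by (simp add: functor_comp_def ordinal_map_def ordinal_def compose_def fun_eq_iff restrict_def
        split: prod.split)
qed

lemma functor_comp_ordinal_map_id:
  assumes "is_functor (ordinal n) C x"
  shows "functor_comp (ordinal n) x (ordinal_map n id) = x"
proof -
  have "obj_map x \<in> extensional (Obj (ordinal n))" "arr_map x \<in> extensional (Arr (ordinal n))"
    using assms by (simp_all add: is_functor_def PiE_iff)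
  then have "compose (Obj (ordinal n)) (obj_map x) (restrict id (Obj (ordinal n))) = obj_map x"
    and "compose (Arr (ordinal n)) (arr_map x) (\<lambda>(i, j)\<in>Arr (ordinal n). (id i, id j)) = arr_map x"
    by (auto simp: compose_def fun_eq_iff restrict_def extensional_def)
  then show ?thesis
    by (simp add: functor_comp_def ordinal_map_def)
qed


section \<open>Simplicial sets and the nerve\<close>

text \<open>\<open>pull X m n \<theta>\<close> is the action \<open>X\<^sub>n \<Rightarrow> X\<^sub>m\<close> of a monotone map \<open>\<theta>\<close> from \<open>{..m}\<close> to \<open>{..n}\<close>.\<close>

record 'x sset =
  simplices :: "nat \<Rightarrow> 'x set"
  pull :: "nat \<Rightarrow> nat \<Rightarrow> (nat \<Rightarrow> nat) \<Rightarrow> 'x \<Rightarrow> 'x"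

definition is_sset :: "'x sset \<Rightarrow> bool" where
  "is_sset X \<longleftrightarrow>
     (\<forall>m n. \<forall>\<theta>\<in>monotone_maps m n. \<forall>x\<in>simplices X n. pull X m n \<theta> x \<in> simplices X m) \<and>
     (\<forall>m n. \<forall>\<theta>\<in>monotone_maps m n. \<forall>\<theta>'\<in>monotone_maps m n. \<forall>x\<in>simplices X n.
        (\<forall>i\<le>m. \<theta> i = \<theta>' i) \<longrightarrow> pull X m n \<theta> x = pull X m n \<theta>' x) \<and>
     (\<forall>n. \<forall>x\<in>simplices X n. pull X n n id x = x) \<and>
     (\<forall>l m n. \<forall>\<theta>\<in>monotone_maps l m. \<forall>\<psi>\<in>monotone_maps m n. \<forall>x\<in>simplices X n.
        pull X l m \<theta> (pull X m n \<psi> x) = pull X l n (\<psi> \<circ> \<theta>) x)"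

definition nerve :: "('o, 'a) category \<Rightarrow> (nat, nat \<times> nat, 'o, 'a) cat_functor sset" where
  "nerve C =
     \<lparr>simplices = (\<lambda>n. {x. is_functor (ordinal n) C x}),
      pull = (\<lambda>m n \<theta> x. functor_comp (ordinal m) x (ordinal_map m \<theta>))\<rparr>"

definition nerve_map ::
    "('o, 'a, 'p, 'b) cat_functor \<Rightarrow> nat
      \<Rightarrow> (nat, nat \<times> nat, 'o, 'a) cat_functor \<Rightarrow> (nat, nat \<times> nat, 'p, 'b) cat_functor" where
  "nerve_map u n x = functor_comp (ordinal n) u x"

lemma is_sset_nerve: "is_sset (nerve C)"
  unfolding is_sset_def
proof (intro conjI allI ballI impI)
  fix m n \<theta> x assume "\<theta> \<in> monotone_maps m n" "x \<in> simplices (nerve C) n"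
  then show "pull (nerve C) m n \<theta> x \<in> simplices (nerve C) m"
    by (auto simp: nerve_def ordinal_def intro!: is_functor_comp[OF is_functor_ordinal_map, unfolded ordinal_def])
next
  fix m n :: nat and \<theta> \<theta>' x assume "\<forall>i\<le>m. \<theta> i = (\<theta>' i :: nat)"
  then have "ordinal_map m \<theta> = ordinal_map m \<theta>'"
    by (simp add: ordinal_map_def ordinal_def fun_eq_iff restrict_def)
  then show "pull (nerve C) m n \<theta> x = pull (nerve C) m n \<theta>' x"
    by (simp add: nerve_def)
next
  fix n x assume "x \<in> simplices (nerve C) n"
  then have "is_functor (ordinal n) C x"
    by (simp add: nerve_def)
  then show "pull (nerve C) n n id x = x"
    by (simp add: nerve_def functor_comp_ordinal_map_id)
next
  fix l m n :: nat and \<theta> \<psi> x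
  assume "\<theta> \<in> monotone_maps l m"
  then have \<theta>: "is_functor (ordinal l) (ordinal m) (ordinal_map l \<theta>)"
    by (rule is_functor_ordinal_map)
  have "pull (nerve C) l m \<theta> (pull (nerve C) m n \<psi> x) =
      functor_comp (ordinal l) x (functor_comp (ordinal l) (ordinal_map m \<psi>) (ordinal_map l \<theta>))"
    using functor_comp_assoc[OF \<theta>] by (simp add: nerve_def)
  also have "functor_comp (ordinal l) (ordinal_map m \<psi>) (ordinal_map l \<theta>) = ordinal_map l (\<psi> \<circ> \<theta>)"
    using \<open>\<theta> \<in> monotone_maps l m\<close> by (rule functor_comp_ordinal_map)
  finally show "pull (nerve C) l m \<theta> (pull (nerve C) m n \<psi> x) = pull (nerve C) l n (\<psi> \<circ> \<theta>) x"
    by (simp add: nerve_def)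
qed


section \<open>Geometric realization\<close>

definition quotient_topology :: "'a topology \<Rightarrow> ('a \<Rightarrow> 'b) \<Rightarrow> 'b topology" where
  "quotient_topology X q =
     topology (\<lambda>U. U \<subseteq> q ` topspace X \<and> openin X {x \<in> topspace X. q x \<in> U})"

lemma openin_quotient_topology:
  "openin (quotient_topology X q) U \<longleftrightarrow>
     U \<subseteq> q ` topspace X \<and> openin X {x \<in> topspace X. q x \<in> U}"
proof -
  have "istopology (\<lambda>U. U \<subseteq> q ` topspace X \<and> openin X {x \<in> topspace X. q x \<in> U})"
    unfolding istopology_def
  proof (intro conjI allI impI)
    fix S T
    assume "S \<subseteq> q ` topspace X \<and> openin X {x \<in> topspace X. q x \<in> S}"
      and "T \<subseteq> q ` topspace X \<and> openin X {x \<in> topspace X. q x \<in> T}"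
    moreover have "{x \<in> topspace X. q x \<in> S \<inter> T} =
        {x \<in> topspace X. q x \<in> S} \<inter> {x \<in> topspace X. q x \<in> T}"
      by auto
    ultimately show "S \<inter> T \<subseteq> q ` topspace X" "openin X {x \<in> topspace X. q x \<in> S \<inter> T}"
      by (blast, simp add: openin_Int)
  next
    fix K
    assume K: "\<forall>S\<in>K. S \<subseteq> q ` topspace X \<and> openin X {x \<in> topspace X. q x \<in> S}"
    show "\<Union>K \<subseteq> q ` topspace X"
      using K by blast
    have "{x \<in> topspace X. q x \<in> \<Union>K} = \<Union>((\<lambda>S. {x \<in> topspace X. q x \<in> S}) ` K)"
      by auto
    moreover have "openin X (\<Union>((\<lambda>S. {x \<in> topspace X. q x \<in> S}) ` K))"
      using K by (intro openin_Union) auto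
    ultimately show "openin X {x \<in> topspace X. q x \<in> \<Union>K}"
      by simp
  qed
  then show ?thesis
    by (simp add: quotient_topology_def)
qed

lemma topspace_quotient_topology [simp]: "topspace (quotient_topology X q) = q ` topspace X"
proof (rule antisym)
  show "topspace (quotient_topology X q) \<subseteq> q ` topspace X"
    using openin_topspace[of "quotient_topology X q"] unfolding openin_quotient_topology by (rule conjunct1)
  have "{x \<in> topspace X. q x \<in> q ` topspace X} = topspace X"
    by auto
  then show "q ` topspace X \<subseteq> topspace (quotient_topology X q)"
    by (intro openin_subset) (simp add: openin_quotient_topology)
qed

lemma quotient_map_quotient_topology: "quotient_map X (quotient_topology X q) q"
  by (auto simp: quotient_map_def openin_quotient_topology)

text \<open>\<open>\<theta>\<^sub>*\<close> on standard simplices: the affine map sending vertex \<open>i\<close> to vertex \<open>\<theta> i\<close>.\<close>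

definition push :: "nat \<Rightarrow> (nat \<Rightarrow> nat) \<Rightarrow> (nat \<Rightarrow> real) \<Rightarrow> nat \<Rightarrow> real" where
  "push m \<theta> t = (\<lambda>j. \<Sum>i | i \<le> m \<and> \<theta> i = j. t i)"

abbreviation simplex_space :: "nat \<Rightarrow> (nat \<Rightarrow> real) topology" where
  "simplex_space n \<equiv> subtopology (powertop_real UNIV) (standard_simplex n)"

definition prerealization :: "'x sset \<Rightarrow> (nat \<times> 'x \<times> (nat \<Rightarrow> real)) topology" where
  "prerealization X =
     sum_topology (\<lambda>n. prod_topology (discrete_topology (simplices X n)) (simplex_space n)) UNIV"

definition glue :: "'x sset \<Rightarrow> (nat \<times> 'x \<times> (nat \<Rightarrow> real)) rel" where
  "glue X = {((m, pull X m n \<theta> x, t), (n, x, push m \<theta> t)) | m n \<theta> x t.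
       \<theta> \<in> monotone_maps m n \<and> x \<in> simplices X n \<and> t \<in> standard_simplex m}"

definition glue_class ::
    "'x sset \<Rightarrow> nat \<times> 'x \<times> (nat \<Rightarrow> real) \<Rightarrow> (nat \<times> 'x \<times> (nat \<Rightarrow> real)) set" where
  "glue_class X p = (glue X \<union> (glue X)\<inverse>)\<^sup>* `` {p}"

definition realization :: "'x sset \<Rightarrow> (nat \<times> 'x \<times> (nat \<Rightarrow> real)) set topology" where
  "realization X = quotient_topology (prerealization X) (glue_class X)"

text \<open>For a simplicial map \<open>f\<close> the union below is over equal classes.\<close>

definition realization_map ::
    "'y sset \<Rightarrow> (nat \<Rightarrow> 'x \<Rightarrow> 'y)
      \<Rightarrow> (nat \<times> 'x \<times> (nat \<Rightarrow> real)) set \<Rightarrow> (nat \<times> 'y \<times> (nat \<Rightarrow> real)) set" where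
  "realization_map Y f c = (\<Union>(n, x, t)\<in>c. glue_class Y (n, f n x, t))"


section \<open>Homotopy groups and weak equivalences\<close>

definition cube :: "nat \<Rightarrow> (nat \<Rightarrow> real) topology" where
  "cube n = product_topology (\<lambda>_. top_of_set {0..1}) {..<n}"

definition cube_boundary :: "nat \<Rightarrow> (nat \<Rightarrow> real) set" where
  "cube_boundary n = {t \<in> topspace (cube n). \<exists>i<n. t i = 0 \<or> t i = 1}"

definition spheroids :: "nat \<Rightarrow> 'a topology \<Rightarrow> 'a \<Rightarrow> ((nat \<Rightarrow> real) \<Rightarrow> 'a) set" where
  "spheroids n X x = {g. continuous_map (cube n) X g \<and> (\<forall>t\<in>cube_boundary n. g t = x)}"

definition spheroid_homotopy :: "nat \<Rightarrow> 'a topology \<Rightarrow> 'a \<Rightarrow> ((nat \<Rightarrow> real) \<Rightarrow> 'a) rel" where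
  "spheroid_homotopy n X x =
     {(g, h). homotopic_with (\<lambda>k. \<forall>t\<in>cube_boundary n. k t = x) (cube n) X g h}"

text \<open>The underlying set of \<open>\<pi>\<^sub>n(X, x)\<close>. As \<open>cube 0\<close> is a point with empty boundary, \<open>homotopy_set 0 X x\<close>
  is the set of path components, whatever \<open>x\<close> is.\<close>

definition homotopy_set :: "nat \<Rightarrow> 'a topology \<Rightarrow> 'a \<Rightarrow> ((nat \<Rightarrow> real) \<Rightarrow> 'a) set set" where
  "homotopy_set n X x = spheroids n X x // spheroid_homotopy n X x"

definition homotopy_set_map ::
    "nat \<Rightarrow> 'b topology \<Rightarrow> ('a \<Rightarrow> 'b) \<Rightarrow> 'a
      \<Rightarrow> ((nat \<Rightarrow> real) \<Rightarrow> 'a) set \<Rightarrow> ((nat \<Rightarrow> real) \<Rightarrow> 'b) set" where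
  "homotopy_set_map n Y f x c = spheroid_homotopy n Y (f x) `` ((\<lambda>g. f \<circ> g) ` c)"

text \<open>The map induced on \<open>\<pi>\<^sub>n\<close>, \<open>n \<ge> 1\<close>, is always a group homomorphism, so it is an isomorphism iff it
  is a bijection. The emptiness clause is the part of bijectivity on \<open>\<pi>\<^sub>0\<close> that is not seen by
  basepoints of \<open>X\<close>.\<close>

definition weak_homotopy_equivalence :: "'a topology \<Rightarrow> 'b topology \<Rightarrow> ('a \<Rightarrow> 'b) \<Rightarrow> bool" where
  "weak_homotopy_equivalence X Y f \<longleftrightarrow>
     continuous_map X Y f \<and>
     (topspace X = {} \<longrightarrow> topspace Y = {}) \<and>
     (\<forall>x\<in>topspace X. \<forall>n.
        bij_betw (homotopy_set_map n Y f x) (homotopy_set n X x) (homotopy_set n Y (f x)))"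

definition sset_weak_equivalence :: "'x sset \<Rightarrow> 'y sset \<Rightarrow> (nat \<Rightarrow> 'x \<Rightarrow> 'y) \<Rightarrow> bool" where
  "sset_weak_equivalence X Y f \<longleftrightarrow>
     weak_homotopy_equivalence (realization X) (realization Y) (realization_map Y f)"

definition weak_equivalence ::
    "('o, 'a) category \<Rightarrow> ('p, 'b) category \<Rightarrow> ('o, 'a, 'p, 'b) cat_functor \<Rightarrow> bool" where
  "weak_equivalence A B u \<longleftrightarrow> sset_weak_equivalence (nerve A) (nerve B) (nerve_map u)"

definition aspherical :: "('o, 'a) category \<Rightarrow> bool" where
  "aspherical A \<longleftrightarrow> weak_equivalence A terminal_category (to_terminal A)"


section \<open>Trees\<close>

text \<open>A vertex is encoded as the pair of its set of inputs and its output. No vertices get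
  identified by this, because distinct vertices have distinct outputs.\<close>

record 'e tree =
  edges :: "'e set"
  vertices :: "('e set \<times> 'e) set"

definition below :: "'e tree \<Rightarrow> 'e rel" where
  "below T = {(e, e'). \<exists>(I, d)\<in>vertices T. e \<in> I \<and> e' = d}"

definition is_root :: "'e tree \<Rightarrow> 'e \<Rightarrow> bool" where
  "is_root T r \<longleftrightarrow> r \<in> edges T \<and> (\<forall>(I, d)\<in>vertices T. r \<notin> I)"

definition is_tree :: "'e tree \<Rightarrow> bool" where
  "is_tree T \<longleftrightarrow>
     finite (edges T) \<and> edges T \<noteq> {} \<and> finite (vertices T) \<and>
     (\<forall>(I, d)\<in>vertices T. I \<subseteq> edges T \<and> d \<in> edges T) \<and>
     (\<forall>v\<in>vertices T. \<forall>w\<in>vertices T. snd v = snd w \<longrightarrow> v = w) \<and>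
     (\<forall>v\<in>vertices T. \<forall>w\<in>vertices T. fst v \<inter> fst w \<noteq> {} \<longrightarrow> v = w) \<and>
     (\<exists>!r. is_root T r) \<and>
     (\<forall>e\<in>edges T. \<forall>r. is_root T r \<longrightarrow> (e, r) \<in> (below T)\<^sup>*)"

definition leaves :: "'e tree \<Rightarrow> 'e set" where
  "leaves T = {e \<in> edges T. \<forall>(I, d)\<in>vertices T. e \<noteq> d}"

definition is_subtree :: "'e tree \<Rightarrow> 'e tree \<Rightarrow> bool" where
  "is_subtree S T \<longleftrightarrow> is_tree S \<and> edges S \<subseteq> edges T \<and> vertices S \<subseteq> vertices T"


section \<open>Symmetric coloured operads\<close>

text \<open>Operations carry their profile. \<open>op_comp P p qs\<close> is the simultaneous composition, defined when
  \<open>map (op_tgt P) qs = op_src P p\<close>; \<open>op_perm P p \<sigma>\<close> is the right action of a permutation \<open>\<sigma>\<close> of the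
  input positions of \<open>p\<close>.\<close>

record ('c, 'o) operad =
  Colours :: "'c set"
  Ops :: "'o set"
  op_src :: "'o \<Rightarrow> 'c list"
  op_tgt :: "'o \<Rightarrow> 'c"
  op_id :: "'c \<Rightarrow> 'o"
  op_comp :: "'o \<Rightarrow> 'o list \<Rightarrow> 'o"
  op_perm :: "'o \<Rightarrow> (nat \<Rightarrow> nat) \<Rightarrow> 'o"

definition composable :: "('c, 'o) operad \<Rightarrow> 'o \<Rightarrow> 'o list \<Rightarrow> bool" where
  "composable P p qs \<longleftrightarrow> p \<in> Ops P \<and> set qs \<subseteq> Ops P \<and> map (op_tgt P) qs = op_src P p"

text \<open>\<open>index_blocks [n\<^sub>1, \<dots>, n\<^sub>k]\<close> cuts \<open>[0..<n\<^sub>1 + \<dots> + n\<^sub>k]\<close> into consecutive blocks of the given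
  lengths. A rearrangement of it, concatenated, lists the values of a permutation.\<close>

definition index_blocks :: "nat list \<Rightarrow> nat list list" where
  "index_blocks ns = map (\<lambda>i. [sum_list (take i ns)..<sum_list (take (Suc i) ns)]) [0..<length ns]"

definition perm_of_list :: "nat list \<Rightarrow> nat \<Rightarrow> nat" where
  "perm_of_list is k = (if k < length is then is ! k else k)"

definition block_perm :: "(nat \<Rightarrow> nat) \<Rightarrow> nat list \<Rightarrow> nat \<Rightarrow> nat" where
  "block_perm \<sigma> ns = perm_of_list (concat (permute_list \<sigma> (index_blocks ns)))"

definition sum_perm :: "(nat \<Rightarrow> nat) list \<Rightarrow> nat list \<Rightarrow> nat \<Rightarrow> nat" where
  "sum_perm \<tau>s ns = perm_of_list (concat (map2 permute_list \<tau>s (index_blocks ns)))"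

definition is_operad :: "('c, 'o) operad \<Rightarrow> bool" where
  "is_operad P \<longleftrightarrow>
     (\<forall>p\<in>Ops P. set (op_src P p) \<subseteq> Colours P \<and> op_tgt P p \<in> Colours P) \<and>
     (\<forall>c\<in>Colours P. op_id P c \<in> Ops P \<and> op_src P (op_id P c) = [c] \<and> op_tgt P (op_id P c) = c) \<and>
     (\<forall>p qs. composable P p qs \<longrightarrow>
        op_comp P p qs \<in> Ops P \<and>
        op_src P (op_comp P p qs) = concat (map (op_src P) qs) \<and>
        op_tgt P (op_comp P p qs) = op_tgt P p) \<and>
     (\<forall>p\<in>Ops P. \<forall>\<sigma>. \<sigma> permutes {..<length (op_src P p)} \<longrightarrow>
        op_perm P p \<sigma> \<in> Ops P \<and>
        op_src P (op_perm P p \<sigma>) = permute_list \<sigma> (op_src P p) \<and>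
        op_tgt P (op_perm P p \<sigma>) = op_tgt P p) \<and>
     (\<forall>p\<in>Ops P. op_comp P (op_id P (op_tgt P p)) [p] = p \<and>
                 op_comp P p (map (op_id P) (op_src P p)) = p) \<and>
     (\<forall>p qs rss. composable P p qs \<and> list_all2 (composable P) qs rss \<longrightarrow>
        op_comp P (op_comp P p qs) (concat rss) = op_comp P p (map2 (op_comp P) qs rss)) \<and>
     (\<forall>p\<in>Ops P. op_perm P p id = p) \<and>
     (\<forall>p\<in>Ops P. \<forall>\<sigma> \<tau>. \<sigma> permutes {..<length (op_src P p)} \<and> \<tau> permutes {..<length (op_src P p)} \<longrightarrow>
        op_perm P (op_perm P p \<sigma>) \<tau> = op_perm P p (\<sigma> \<circ> \<tau>)) \<and>
     (\<forall>p qs \<sigma>. composable P p qs \<and> \<sigma> permutes {..<length qs} \<longrightarrow>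
        op_comp P (op_perm P p \<sigma>) (permute_list \<sigma> qs) =
        op_perm P (op_comp P p qs) (block_perm \<sigma> (map (length \<circ> op_src P) qs))) \<and>
     (\<forall>p qs \<tau>s. composable P p qs \<and>
        list_all2 (\<lambda>q \<tau>. \<tau> permutes {..<length (op_src P q)}) qs \<tau>s \<longrightarrow>
        op_comp P p (map2 (op_perm P) qs \<tau>s) =
        op_perm P (op_comp P p qs) (sum_perm \<tau>s (map (length \<circ> op_src P) qs)))"

record ('c, 'o, 'd, 'q) operad_map =
  colour_map :: "'c \<Rightarrow> 'd"
  op_map :: "'o \<Rightarrow> 'q"

definition is_operad_map ::
    "('c, 'o) operad \<Rightarrow> ('d, 'q) operad \<Rightarrow> ('c, 'o, 'd, 'q) operad_map \<Rightarrow> bool" where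
  "is_operad_map P Q f \<longleftrightarrow>
     colour_map f \<in> Colours P \<rightarrow>\<^sub>E Colours Q \<and>
     op_map f \<in> Ops P \<rightarrow>\<^sub>E Ops Q \<and>
     (\<forall>p\<in>Ops P. op_src Q (op_map f p) = map (colour_map f) (op_src P p) \<and>
                 op_tgt Q (op_map f p) = colour_map f (op_tgt P p)) \<and>
     (\<forall>c\<in>Colours P. op_map f (op_id P c) = op_id Q (colour_map f c)) \<and>
     (\<forall>p qs. composable P p qs \<longrightarrow>
        op_map f (op_comp P p qs) = op_comp Q (op_map f p) (map (op_map f) qs)) \<and>
     (\<forall>p\<in>Ops P. \<forall>\<sigma>. \<sigma> permutes {..<length (op_src P p)} \<longrightarrow>
        op_map f (op_perm P p \<sigma>) = op_perm Q (op_map f p) \<sigma>)"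

definition operad_map_id :: "('c, 'o) operad \<Rightarrow> ('c, 'o, 'c, 'o) operad_map" where
  "operad_map_id P = \<lparr>colour_map = restrict id (Colours P), op_map = restrict id (Ops P)\<rparr>"

definition operad_map_comp ::
    "('c, 'o) operad \<Rightarrow> ('d, 'q, 'f, 'r) operad_map \<Rightarrow> ('c, 'o, 'd, 'q) operad_map
      \<Rightarrow> ('c, 'o, 'f, 'r) operad_map" where
  "operad_map_comp P g f =
     \<lparr>colour_map = compose (Colours P) (colour_map g) (colour_map f),
      op_map = compose (Ops P) (op_map g) (op_map f)\<rparr>"


section \<open>The category of trees\<close>

text \<open>The free symmetric operad on the vertices of a tree, described explicitly: there is one operation
  with inputs \<open>es\<close> and output \<open>e\<close> if the \<open>es\<close> are distinct and are exactly the leaves of a subtree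
  with root \<open>e\<close>, and none otherwise. This operation is represented by its profile \<open>(es, e)\<close>.\<close>

definition tree_operad :: "'e tree \<Rightarrow> ('e, 'e list \<times> 'e) operad" where
  "tree_operad T =
     \<lparr>Colours = edges T,
      Ops = {(es, e). distinct es \<and> (\<exists>S. is_subtree S T \<and> is_root S e \<and> leaves S = set es)},
      op_src = fst,
      op_tgt = snd,
      op_id = (\<lambda>e. ([e], e)),
      op_comp = (\<lambda>p qs. (concat (map fst qs), snd p)),
      op_perm = (\<lambda>p \<sigma>. (permute_list \<sigma> (fst p), snd p))\<rparr>"

type_synonym 'e tree_map = "('e, 'e list \<times> 'e, 'e, 'e list \<times> 'e) operad_map"

text \<open>An arrow is a triple consisting of its domain, an operad morphism and its codomain. To have a
  small category, the edges of all trees are drawn from one type \<open>'e\<close>; when \<open>'e\<close> is infinite, every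
  finite tree is isomorphic to one of these.\<close>

definition Omega :: "('e tree, 'e tree \<times> 'e tree_map \<times> 'e tree) category" where
  "Omega =
     \<lparr>Obj = {T. is_tree T},
      Arr = {(S, f, T). is_tree S \<and> is_tree T \<and> is_operad_map (tree_operad S) (tree_operad T) f},
      Dom = (\<lambda>(S, f, T). S),
      Cod = (\<lambda>(S, f, T). T),
      Id = (\<lambda>T. (T, operad_map_id (tree_operad T), T)),
      Comp = (\<lambda>(S', g, T') (S, f, T). (S, operad_map_comp (tree_operad S) g f, T'))\<rparr>"


section \<open>Well-definedness\<close>

lemma leaves_edges: "leaves T \<subseteq> edges T"
  by (auto simp: leaves_def)

lemma single_valued_below: "is_tree T \<Longrightarrow> single_valued (below T)"
proof (rule single_valuedI)
  fix x y z
  assume T: "is_tree T" and "(x, y) \<in> below T" "(x, z) \<in> below T"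
  then obtain I J where IJ: "(I, y) \<in> vertices T" "(J, z) \<in> vertices T" and "x \<in> I" "x \<in> J"
    by (auto simp: below_def)
  have "\<forall>v\<in>vertices T. \<forall>w\<in>vertices T. fst v \<inter> fst w \<noteq> {} \<longrightarrow> v = w"
    using T by (simp add: is_tree_def)
  moreover have "fst (I, y) \<inter> fst (J, z) \<noteq> {}"
    using \<open>x \<in> I\<close> \<open>x \<in> J\<close> by auto
  ultimately have "(I, y) = (J, z)"
    using IJ by blast
  then show "y = z" by simp
qed

lemma below_edges: "is_tree T \<Longrightarrow> below T \<subseteq> edges T \<times> edges T"
  unfolding below_def is_tree_def by fastforce

lemma rtrancl_below_edges:
  assumes "is_tree T" "(x, y) \<in> (below T)\<^sup>*" "x \<in> edges T"
  shows "y \<in> edges T"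
  using assms(2,3) below_edges[OF assms(1)] by induction auto

lemma acyclic_below:
  assumes T: "is_tree T"
  shows "acyclic (below T)"
proof (rule acyclicI, intro allI notI)
  fix x assume x: "(x, x) \<in> (below T)\<^sup>+"
  obtain r where r: "is_root T r"
    using T by (auto simp: is_tree_def)
  have "x \<in> edges T"
    using x below_edges[OF T] by (auto elim: tranclE)
  then have "(x, r) \<in> (below T)\<^sup>*"
    using T r by (auto simp: is_tree_def)
  then have "(r, x) \<in> (below T)\<^sup>+"
  proof induction
    case base
    show ?case by (rule x)
  next
    case (step y z)
    from step.IH obtain w where w: "(y, w) \<in> below T" "(w, x) \<in> (below T)\<^sup>*"
      by (meson tranclD)
    then have "w = z"
      using step.hyps single_valued_below[OF T] by (auto simp: single_valued_def)
    with w(2) x show ?case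
      by (metis rtrancl_trancl_trancl)
  qed
  then obtain w where "(r, w) \<in> below T"
    by (meson tranclD)
  with r show False
    by (auto simp: is_root_def below_def)
qed

lemma below_mono: "vertices S \<subseteq> vertices T \<Longrightarrow> below S \<subseteq> below T"
  by (auto simp: below_def)

lemma no_cycle:
  assumes "is_tree T" "(x, y) \<in> (below T)\<^sup>*" "(y, x) \<in> (below T)\<^sup>+"
  shows False
  using acyclic_below[OF assms(1)] rtrancl_trancl_trancl[OF assms(2,3)] by (auto simp: acyclic_def)

lemma subtreeI:
  assumes T: "is_tree T"
    and sub: "edges U \<subseteq> edges T" "vertices U \<subseteq> vertices T"
    and cl: "\<And>I d. (I, d) \<in> vertices U \<Longrightarrow> I \<subseteq> edges U \<and> d \<in> edges U"
    and r: "r \<in> edges U" and reach: "\<And>x. x \<in> edges U \<Longrightarrow> (x, r) \<in> (below U)\<^sup>*"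
  shows "is_subtree U T" "is_root U r"
proof -
  show root: "is_root U r"
    unfolding is_root_def
  proof (intro conjI r, clarify)
    fix I d assume *: "(I, d) \<in> vertices U" "r \<in> I"
    then have "(r, d) \<in> below U" "(d, r) \<in> (below U)\<^sup>*"
      using cl reach by (auto simp: below_def)
    then have "(r, r) \<in> (below U)\<^sup>+"
      by (rule rtrancl_into_trancl2)
    then have "(r, r) \<in> (below T)\<^sup>+"
      using below_mono[OF sub(2)] by (rule trancl_mono)
    then show False
      using acyclic_below[OF T] by (auto simp: acyclic_def)
  qed
  have unique: "x = r" if "is_root U x" for x
  proof (rule ccontr)
    assume "x \<noteq> r"
    moreover have "(x, r) \<in> (below U)\<^sup>*"
      using that reach by (auto simp: is_root_def)
    ultimately obtain y where "(x, y) \<in> below U"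
      by (meson converse_rtranclE)
    with that show False
      by (auto simp: is_root_def below_def)
  qed
  have "is_tree U"
    unfolding is_tree_def
  proof (intro conjI)
    show "finite (edges U)" "finite (vertices U)"
      using T sub finite_subset by (auto simp: is_tree_def)
    show "edges U \<noteq> {}"
      using r by auto
    show "\<forall>(I, d)\<in>vertices U. I \<subseteq> edges U \<and> d \<in> edges U"
      using cl by auto
    have "\<forall>v\<in>vertices T. \<forall>w\<in>vertices T. snd v = snd w \<longrightarrow> v = w"
      and "\<forall>v\<in>vertices T. \<forall>w\<in>vertices T. fst v \<inter> fst w \<noteq> {} \<longrightarrow> v = w"
      using T unfolding is_tree_def by blast+
    then show "\<forall>v\<in>vertices U. \<forall>w\<in>vertices U. snd v = snd w \<longrightarrow> v = w"
      and "\<forall>v\<in>vertices U. \<forall>w\<in>vertices U. fst v \<inter> fst w \<noteq> {} \<longrightarrow> v = w"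
      using sub(2) by (meson subsetD)+
    show "\<exists>!r. is_root U r"
      using root unique by blast
    show "\<forall>e\<in>edges U. \<forall>r. is_root U r \<longrightarrow> (e, r) \<in> (below U)\<^sup>*"
      using reach unique by blast
  qed
  then show "is_subtree U T"
    using sub by (simp add: is_subtree_def)
qed

lemma leaf_minimal:
  assumes T: "is_tree T" and S: "is_subtree S T"
    and x: "x \<in> edges S" and l: "l \<in> leaves S" and xl: "(x, l) \<in> (below T)\<^sup>*"
  shows "x = l"
proof -
  have tS: "is_tree S" and ST: "below S \<subseteq> below T"
    using S by (auto simp: is_subtree_def intro!: below_mono)
  obtain r where r: "is_root S r"
    using tS by (auto simp: is_tree_def)
  have reach: "(y, r) \<in> (below S)\<^sup>*" if "y \<in> edges S" for y
    using tS r that by (auto simp: is_tree_def)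
  from xl have "(x, l) \<in> (below S)\<^sup>* \<or> (r, l) \<in> (below T)\<^sup>+"
  proof induction
    case base
    show ?case by simp
  next
    case (step y z)
    from step.IH show ?case
    proof
      assume y: "(x, y) \<in> (below S)\<^sup>*"
      show ?thesis
      proof (cases "y = r")
        case True
        then show ?thesis using step.hyps by auto
      next
        case False
        have "(y, r) \<in> (below S)\<^sup>*"
          using reach rtrancl_below_edges[OF tS y x] by blast
        with False obtain w where w: "(y, w) \<in> below S"
          by (meson converse_rtranclE)
        then have "w = z"
          using step.hyps ST single_valued_below[OF T] by (auto simp: single_valued_def)
        with w y show ?thesis by auto
      qed
    next
      assume "(r, y) \<in> (below T)\<^sup>+"
      then show ?thesis using step.hyps by (meson trancl.trancl_into_trancl)
    qed
  qed
  then show ?thesis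
  proof
    assume "(x, l) \<in> (below S)\<^sup>*"
    then show ?thesis
    proof (cases rule: rtranclE)
      case (step y)
      then show ?thesis using l by (auto simp: leaves_def below_def)
    qed
  next
    assume "(r, l) \<in> (below T)\<^sup>+"
    moreover have "(l, r) \<in> (below T)\<^sup>*"
      using reach[of l] l rtrancl_mono[OF ST] by (auto simp: leaves_def)
    ultimately show ?thesis
      using no_cycle[OF T] by blast
  qed
qed

lemma graft:
  assumes T: "is_tree T" and S: "is_subtree S T" "is_root S r"
    and R: "\<And>l. l \<in> leaves S \<Longrightarrow> is_subtree (R l) T \<and> is_root (R l) l"
  defines "U \<equiv> \<lparr>edges = edges S \<union> (\<Union>l\<in>leaves S. edges (R l)),
                vertices = vertices S \<union> (\<Union>l\<in>leaves S. vertices (R l))\<rparr>"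
  shows "is_subtree U T" "is_root U r" "leaves U = (\<Union>l\<in>leaves S. leaves (R l))"
    and "\<And>l l'. \<lbrakk>l \<in> leaves S; l' \<in> leaves S; l \<noteq> l'\<rbrakk> \<Longrightarrow> edges (R l) \<inter> edges (R l') = {}"
proof -
  have tree: "is_tree S" "\<And>l. l \<in> leaves S \<Longrightarrow> is_tree (R l)"
    using S R by (auto simp: is_subtree_def)
  have cl: "I \<subseteq> edges V \<and> d \<in> edges V" if "is_tree V" "(I, d) \<in> vertices V" for V :: "'a tree" and I d
    using that by (auto simp: is_tree_def)
  have reachS: "(x, r) \<in> (below S)\<^sup>*" if "x \<in> edges S" for x
    using that S tree by (auto simp: is_tree_def)
  have reachR: "(x, l) \<in> (below (R l))\<^sup>*" if "l \<in> leaves S" "x \<in> edges (R l)" for x l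
    using that R tree by (auto simp: is_tree_def)
  have "below S \<subseteq> below U"
    by (rule below_mono) (auto simp: U_def)
  note SU = rtrancl_mono[OF this]
  have "below (R l) \<subseteq> below U" if "l \<in> leaves S" for l
    using that by (intro below_mono) (auto simp: U_def)
  note RU = rtrancl_mono[OF this]
  have "below (R l) \<subseteq> below T" if "l \<in> leaves S" for l
    using that R by (intro below_mono) (auto simp: is_subtree_def)
  note RT = rtrancl_mono[OF this]
  have leafS: "l \<in> edges S" if "l \<in> leaves S" for l
    using that by (simp add: leaves_def)
  have rootR: "l \<in> edges (R l)" if "l \<in> leaves S" for l
    using that R by (auto simp: is_root_def)
  have 1: "edges U \<subseteq> edges T" "vertices U \<subseteq> vertices T"
    using S R by (auto simp: is_subtree_def U_def)
  have 2: "I \<subseteq> edges U \<and> d \<in> edges U" if "(I, d) \<in> vertices U" for I d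
    using that cl tree unfolding U_def by fastforce
  have 3: "r \<in> edges U"
    using S by (auto simp: is_root_def U_def)
  have 4: "(x, r) \<in> (below U)\<^sup>*" if x: "x \<in> edges U" for x
  proof (cases "x \<in> edges S")
    case True
    then show ?thesis using reachS SU by blast
  next
    case False
    then obtain l where l: "l \<in> leaves S" "x \<in> edges (R l)"
      using x by (auto simp: U_def)
    have "(x, l) \<in> (below U)\<^sup>*"
      using reachR[OF l] RU[OF l(1)] by blast
    moreover have "(l, r) \<in> (below U)\<^sup>*"
      using reachS[OF leafS[OF l(1)]] SU by blast
    ultimately show ?thesis by (rule rtrancl_trans)
  qed
  show "is_subtree U T" "is_root U r"
    using subtreeI[OF T 1 2 3 4] by blast+
  show disj: "edges (R l) \<inter> edges (R l') = {}" if l: "l \<in> leaves S" "l' \<in> leaves S" "l \<noteq> l'" for l l'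
  proof (rule ccontr)
    assume "edges (R l) \<inter> edges (R l') \<noteq> {}"
    then obtain x where "x \<in> edges (R l)" "x \<in> edges (R l')"
      by auto
    then have "(x, l) \<in> (below T)\<^sup>*" "(x, l') \<in> (below T)\<^sup>*"
      using reachR RT l by blast+
    then have "(l, l') \<in> (below T)\<^sup>* \<or> (l', l) \<in> (below T)\<^sup>*"
      using single_valued_confluent[OF single_valued_below[OF T]] by metis
    then show False
      using leaf_minimal[OF T S(1)] leafS l by metis
  qed
  show "leaves U = (\<Union>l\<in>leaves S. leaves (R l))"
  proof (intro equalityI subsetI)
    fix x assume x: "x \<in> leaves U"
    have "x \<in> leaves S" if "x \<in> edges S"
      using x that by (auto simp: leaves_def U_def)
    moreover have "x \<in> edges U"
      using x by (simp add: leaves_def)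
    ultimately obtain l where l: "l \<in> leaves S" "x \<in> edges (R l)"
      using rootR[of x] unfolding U_def by auto
    then have "x \<in> leaves (R l)"
    proof -
      have "vertices (R l) \<subseteq> vertices U"
        using l by (auto simp: U_def)
      then show ?thesis
        using x l by (auto simp: leaves_def)
    qed
    with l show "x \<in> (\<Union>l\<in>leaves S. leaves (R l))" by blast
  next
    fix x assume "x \<in> (\<Union>l\<in>leaves S. leaves (R l))"
    then obtain l where l: "l \<in> leaves S" "x \<in> leaves (R l)" by blast
    then have xR: "x \<in> edges (R l)" by (simp add: leaves_def)
    have "x \<noteq> d" if v: "(I, d) \<in> vertices U" for I d
    proof
      assume "x = d"
      from v consider "(I, x) \<in> vertices S" | l' where "l' \<in> leaves S" "(I, x) \<in> vertices (R l')"
        unfolding U_def \<open>x = d\<close> by auto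
      then show False
      proof cases
        case 1
        then have "x \<in> edges S"
          using cl tree by blast
        moreover have "(x, l) \<in> (below T)\<^sup>*"
          using reachR RT l(1) xR by blast
        ultimately have "x = l"
          using leaf_minimal[OF T S(1)] l(1) by blast
        with 1 l(1) show False by (auto simp: leaves_def)
      next
        case 2
        then have "x \<in> edges (R l')"
          using cl tree by blast
        then have "l' = l"
          using disj 2 l(1) xR by blast
        with 2 l(2) show False by (auto simp: leaves_def)
      qed
    qed
    then show "x \<in> leaves U"
      using xR l(1) by (auto simp: leaves_def U_def)
  qed
qed

lemma distinct_concat_map_fst:
  assumes "distinct (map snd qs)" "\<And>q. q \<in> set qs \<Longrightarrow> distinct (fst q)"
    and "\<And>q q'. \<lbrakk>q \<in> set qs; q' \<in> set qs; snd q \<noteq> snd q'\<rbrakk> \<Longrightarrow> set (fst q) \<inter> set (fst q') = {}"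
  shows "distinct (concat (map fst qs))"
  using assms
proof (induction qs)
  case (Cons q qs)
  have "set (fst q) \<inter> set (fst q') = {}" if "q' \<in> set qs" for q'
    using Cons.prems(1) that by (intro Cons.prems(3)) (auto simp: image_iff)
  moreover have "distinct (concat (map fst qs))"
    using Cons.prems by (intro Cons.IH) auto
  ultimately show ?case
    using Cons.prems(2)[of q] by fastforce
qed simp

lemma tree_operad_comp_closed:
  assumes T: "is_tree T" and c: "composable (tree_operad T) p qs"
  shows "op_comp (tree_operad T) p qs \<in> Ops (tree_operad T)"
proof -
  have snd_qs: "map snd qs = fst p" and p: "p \<in> Ops (tree_operad T)"
    and qs: "set qs \<subseteq> Ops (tree_operad T)"
    using c by (auto simp: composable_def tree_operad_def)
  obtain S where S: "is_subtree S T" "is_root S (snd p)" "leaves S = set (fst p)"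
    and dist: "distinct (fst p)"
    using p by (auto simp: tree_operad_def)
  have "\<exists>R. is_subtree R T \<and> is_root R (snd q) \<and> leaves R = set (fst q)" if "q \<in> set qs" for q
    using qs that by (fastforce simp: tree_operad_def)
  then obtain R' where R': "\<And>q. q \<in> set qs \<Longrightarrow>
      is_subtree (R' q) T \<and> is_root (R' q) (snd q) \<and> leaves (R' q) = set (fst q)"
    by metis
  have inj: "inj_on snd (set qs)"
    using dist snd_qs by (metis distinct_map)
  define R where "R l = R' (the_inv_into (set qs) snd l)" for l
  have Rq: "R (snd q) = R' q" if "q \<in> set qs" for q
    using that inj by (simp add: R_def the_inv_into_f_f)
  have leavesS: "leaves S = snd ` set qs"
    using S(3) snd_qs by (metis set_map)
  have R: "is_subtree (R l) T \<and> is_root (R l) l" if "l \<in> leaves S" for l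
    using that R' Rq by (auto simp: leavesS)
  note g = graft[OF T S(1,2) R]
  have disj: "set (fst q) \<inter> set (fst q') = {}" if q: "q \<in> set qs" "q' \<in> set qs" "snd q \<noteq> snd q'" for q q'
  proof -
    have "edges (R (snd q)) \<inter> edges (R (snd q')) = {}"
      using q by (intro g(4)) (auto simp: leavesS)
    moreover have "set (fst q) \<subseteq> edges (R (snd q))" "set (fst q') \<subseteq> edges (R (snd q'))"
      using R'[OF q(1)] R'[OF q(2)] Rq[OF q(1)] Rq[OF q(2)] leaves_edges by metis+
    ultimately show ?thesis by blast
  qed
  have "distinct (concat (map fst qs))"
  proof (rule distinct_concat_map_fst)
    show "distinct (map snd qs)"
      using dist snd_qs by simp
    show "distinct (fst q)" if "q \<in> set qs" for q
      using qs that by (auto simp: tree_operad_def)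
  qed (rule disj)
  moreover have "(\<Union>l\<in>leaves S. leaves (R l)) = set (concat (map fst qs))"
    using R' Rq by (auto simp: leavesS)
  ultimately show ?thesis
    using g(1-3) by (auto simp: tree_operad_def)
qed

lemma nth_concat_offset:
  "\<lbrakk>i < length xss; j < length (xss ! i)\<rbrakk> \<Longrightarrow>
    concat xss ! (sum_list (take i (map length xss)) + j) = xss ! i ! j"
proof (induction xss arbitrary: i)
  case (Cons xs xss)
  then show ?case by (cases i) (auto simp: nth_append add.assoc)
qed simp

lemma map_nth_index_blocks:
  "map (map ((!) (concat xss))) (index_blocks (map length xss)) = xss"
proof (rule nth_equalityI)
  fix i assume "i < length (map (map ((!) (concat xss))) (index_blocks (map length xss)))"
  then have i: "i < length xss" by (simp add: index_blocks_def)
  then have "sum_list (take (Suc i) (map length xss)) =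
      sum_list (take i (map length xss)) + length (xss ! i)"
    by (simp add: take_Suc_conv_app_nth)
  then have "map ((!) (concat xss))
      [sum_list (take i (map length xss))..<sum_list (take (Suc i) (map length xss))] = xss ! i"
    using i by (intro nth_equalityI) (simp_all add: nth_concat_offset)
  then show "map (map ((!) (concat xss))) (index_blocks (map length xss)) ! i = xss ! i"
    using i by (simp add: index_blocks_def)
qed (simp add: index_blocks_def)

lemma permute_list_perm_of_list:
  "length is = length xs \<Longrightarrow> permute_list (perm_of_list is) xs = map ((!) xs) is"
  by (auto simp: permute_list_def perm_of_list_def intro!: nth_equalityI)

lemma length_index_blocks [simp]: "length (index_blocks ns) = length ns"
  by (simp add: index_blocks_def)

lemma map_length_index_blocks: "map length (index_blocks (map length xss)) = map length xss"
proof -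
  have "map length (map (map ((!) (concat xss))) (index_blocks (map length xss))) =
      map length (index_blocks (map length xss))"
    by (simp add: comp_def)
  then show ?thesis
    by (simp add: map_nth_index_blocks)
qed

lemma permute_list_block_perm:
  assumes \<sigma>: "\<sigma> permutes {..<length xss}"
  shows "permute_list (block_perm \<sigma> (map length xss)) (concat xss) = concat (permute_list \<sigma> xss)"
proof -
  let ?B = "index_blocks (map length xss)"
  have \<sigma>': "\<sigma> permutes {..<length ?B}"
    using \<sigma> by simp
  have "map (map ((!) (concat xss))) (permute_list \<sigma> ?B) = permute_list \<sigma> xss"
    using permute_list_map[OF \<sigma>', of "map ((!) (concat xss))"] by (simp add: map_nth_index_blocks)
  moreover have "length (concat (permute_list \<sigma> ?B)) = length (concat xss)"
    using permute_list_map[OF \<sigma>', of length] mset_permute_list[of \<sigma> "map length xss"] \<sigma>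
    by (simp add: length_concat map_length_index_blocks flip: sum_mset_sum_list)
  ultimately show ?thesis
    by (simp add: block_perm_def permute_list_perm_of_list map_concat)
qed

lemma permute_list_sum_perm:
  assumes \<tau>s: "list_all2 (\<lambda>xs \<tau>. \<tau> permutes {..<length xs}) xss \<tau>s"
  shows "permute_list (sum_perm \<tau>s (map length xss)) (concat xss) = concat (map2 permute_list \<tau>s xss)"
proof -
  let ?B = "index_blocks (map length xss)"
  have len: "length \<tau>s = length xss"
    using \<tau>s by (simp add: list_all2_lengthD)
  have lenB: "length (?B ! i) = length (xss ! i)" if "i < length xss" for i
    using that map_length_index_blocks[of xss] by (metis length_index_blocks length_map nth_map)
  have B: "map ((!) (concat xss)) (?B ! i) = xss ! i" if "i < length xss" for i
    using that map_nth_index_blocks[of xss] by (metis length_index_blocks length_map nth_map)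
  have "map ((!) (concat xss)) (permute_list (\<tau>s ! i) (?B ! i)) = permute_list (\<tau>s ! i) (xss ! i)"
    if "i < length xss" for i
    using \<tau>s that permute_list_map[of "\<tau>s ! i" "?B ! i" "(!) (concat xss)"]
    by (simp add: list_all2_conv_all_nth lenB B)
  then have "map (map ((!) (concat xss))) (map2 permute_list \<tau>s ?B) = map2 permute_list \<tau>s xss"
    using len by (intro nth_equalityI) auto
  moreover have "map length (map2 permute_list \<tau>s ?B) = map length xss"
    using len by (intro nth_equalityI) (auto simp: lenB)
  then have "length (concat (map2 permute_list \<tau>s ?B)) = length (concat xss)"
    by (simp add: length_concat)
  ultimately show ?thesis
    by (simp add: sum_perm_def permute_list_perm_of_list map_concat)
qed

lemma is_operad_tree_operad:
  assumes T: "is_tree T"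
  shows "is_operad (tree_operad T)"
proof -
  let ?P = "tree_operad T"
  have sel: "Colours ?P = edges T" "op_src ?P = fst" "op_tgt ?P = snd" "op_id ?P = (\<lambda>e. ([e], e))"
    "op_comp ?P = (\<lambda>p qs. (concat (map fst qs), snd p))"
    "op_perm ?P = (\<lambda>p \<sigma>. (permute_list \<sigma> (fst p), snd p))"
    by (simp_all add: tree_operad_def)
  have profile: "set (fst p) \<subseteq> edges T \<and> snd p \<in> edges T" if "p \<in> Ops ?P" for p
    using that by (auto simp: tree_operad_def is_subtree_def is_root_def leaves_def)
  have id: "([e], e) \<in> Ops ?P" if "e \<in> edges T" for e
  proof -
    let ?S = "\<lparr>edges = {e}, vertices = {}\<rparr>"
    have "is_subtree ?S T" "is_root ?S e"
      using that by (auto intro!: subtreeI[OF T])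
    moreover have "leaves ?S = set [e]"
      by (auto simp: leaves_def)
    ultimately show ?thesis
      unfolding tree_operad_def by fastforce
  qed
  have perm: "(permute_list \<sigma> (fst p), snd p) \<in> Ops ?P"
    if "p \<in> Ops ?P" "\<sigma> permutes {..<length (fst p)}" for p \<sigma>
    using that by (auto simp: tree_operad_def)
  have comp: "(concat (map fst qs), snd p) \<in> Ops ?P" if "composable ?P p qs" for p qs
    using tree_operad_comp_closed[OF T that] by (simp add: sel)
  have assoc: "concat (map fst (concat rss)) = concat (map fst (map2 (\<lambda>p qs. (concat (map fst qs), snd p)) qs rss))"
    if "list_all2 (composable ?P) qs rss" for qs rss
    using that by induction auto
  have block: "concat (map fst (permute_list \<sigma> qs)) =
      permute_list (block_perm \<sigma> (map (length \<circ> fst) qs)) (concat (map fst qs))"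
    if "\<sigma> permutes {..<length qs}" for \<sigma> and qs :: "('a list \<times> 'a) list"
    using permute_list_block_perm[of \<sigma> "map fst qs"] permute_list_map[OF that, of fst] that by simp
  have sum: "concat (map fst (map2 (\<lambda>p \<sigma>. (permute_list \<sigma> (fst p), snd p)) qs \<tau>s)) =
      permute_list (sum_perm \<tau>s (map (length \<circ> fst) qs)) (concat (map fst qs))"
    if "list_all2 (\<lambda>q \<tau>. \<tau> permutes {..<length (fst q)}) qs \<tau>s" for qs :: "('a list \<times> 'a) list" and \<tau>s
  proof -
    have "map fst (map2 (\<lambda>p \<sigma>. (permute_list \<sigma> (fst p), snd p)) qs \<tau>s) = map2 permute_list \<tau>s (map fst qs)"
      using that by induction auto
    moreover have "list_all2 (\<lambda>xs \<tau>. \<tau> permutes {..<length xs}) (map fst qs) \<tau>s"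
      using that by (simp add: list_all2_map1)
    ultimately show ?thesis
      using permute_list_sum_perm[of "map fst qs" \<tau>s] by simp
  qed
  have units: "concat (map fst (map (\<lambda>e. ([e], e)) es)) = es" for es :: "'a list"
    by (induction es) auto
  show ?thesis
    unfolding is_operad_def sel
    using profile id perm comp assoc block sum units
    by (simp add: permute_list_compose)
qed

lemma is_operad_map_id:
  assumes "is_operad P"
  shows "is_operad_map P P (operad_map_id P)"
proof -
  have "map (restrict id (Ops P)) qs = qs" if "set qs \<subseteq> Ops P" for qs
    using that by (intro map_idI) auto
  moreover have "map (restrict id (Colours P)) cs = cs" if "set cs \<subseteq> Colours P" for cs
    using that by (intro map_idI) auto
  ultimately show ?thesis
    using assms unfolding is_operad_def is_operad_map_def operad_map_id_def
    by (auto simp: composable_def)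
qed

lemma is_operad_map_comp:
  assumes P: "is_operad P" and f: "is_operad_map P Q f" and g: "is_operad_map Q R g"
  shows "is_operad_map P R (operad_map_comp P g f)"
proof -
  have fc: "colour_map f c \<in> Colours Q" if "c \<in> Colours P" for c
    using f that by (auto simp: is_operad_map_def)
  have fo: "op_map f p \<in> Ops Q" if "p \<in> Ops P" for p
    using f that by (auto simp: is_operad_map_def)
  have gc: "colour_map g c \<in> Colours R" if "c \<in> Colours Q" for c
    using g that by (auto simp: is_operad_map_def)
  have go: "op_map g p \<in> Ops R" if "p \<in> Ops Q" for p
    using g that by (auto simp: is_operad_map_def)
  have Pc: "set (op_src P p) \<subseteq> Colours P" "op_tgt P p \<in> Colours P" if "p \<in> Ops P" for p
    using P that by (auto simp: is_operad_def)
  have fs: "op_src Q (op_map f p) = map (colour_map f) (op_src P p)"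
    "op_tgt Q (op_map f p) = colour_map f (op_tgt P p)" if "p \<in> Ops P" for p
    using f that by (auto simp: is_operad_map_def)
  have gs: "op_src R (op_map g p) = map (colour_map g) (op_src Q p)"
    "op_tgt R (op_map g p) = colour_map g (op_tgt Q p)" if "p \<in> Ops Q" for p
    using g that by (auto simp: is_operad_map_def)
  have fcomp: "composable Q (op_map f p) (map (op_map f) qs)" if "composable P p qs" for p qs
  proof -
    have "map (op_tgt Q) (map (op_map f) qs) = map (colour_map f) (map (op_tgt P) qs)"
      unfolding map_map using that fs(2) by (intro map_cong) (auto simp: composable_def)
    then show ?thesis
      using that fs(1) fo unfolding composable_def by auto
  qed
  have Pi: "op_id P c \<in> Ops P" if "c \<in> Colours P" for c
    using P that by (auto simp: is_operad_def)
  have Pm: "op_comp P p qs \<in> Ops P" if "composable P p qs" for p qs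
    using P that by (auto simp: is_operad_def)
  have Pp: "op_perm P p \<sigma> \<in> Ops P" if "p \<in> Ops P" "\<sigma> permutes {..<length (op_src P p)}" for p \<sigma>
    using P that by (auto simp: is_operad_def)
  show ?thesis
    unfolding is_operad_map_def operad_map_comp_def operad_map.simps
  proof (intro conjI ballI allI impI)
    show "compose (Colours P) (colour_map g) (colour_map f) \<in> Colours P \<rightarrow>\<^sub>E Colours R"
      using fc gc by (simp add: compose_def)
    show "compose (Ops P) (op_map g) (op_map f) \<in> Ops P \<rightarrow>\<^sub>E Ops R"
      using fo go by (simp add: compose_def)
  next
    fix p assume p: "p \<in> Ops P"
    show "op_src R (compose (Ops P) (op_map g) (op_map f) p) =
        map (compose (Colours P) (colour_map g) (colour_map f)) (op_src P p)"
      using p Pc[OF p] fo[OF p] by (auto simp: compose_eq gs fs)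
    show "op_tgt R (compose (Ops P) (op_map g) (op_map f) p) =
        compose (Colours P) (colour_map g) (colour_map f) (op_tgt P p)"
      using p Pc[OF p] fo[OF p] by (simp add: compose_eq gs fs)
  next
    fix c assume c: "c \<in> Colours P"
    then show "compose (Ops P) (op_map g) (op_map f) (op_id P c) =
        op_id R (compose (Colours P) (colour_map g) (colour_map f) c)"
      using f g fc[OF c] Pi[OF c] by (simp add: compose_eq is_operad_map_def)
  next
    fix p qs assume c: "composable P p qs"
    then have *: "p \<in> Ops P" "set qs \<subseteq> Ops P"
      by (auto simp: composable_def)
    have m: "map (compose (Ops P) (op_map g) (op_map f)) qs = map (op_map g \<circ> op_map f) qs"
      using * by (auto simp: compose_eq)
    show "compose (Ops P) (op_map g) (op_map f) (op_comp P p qs) =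
        op_comp R (compose (Ops P) (op_map g) (op_map f) p)
          (map (compose (Ops P) (op_map g) (op_map f)) qs)"
      unfolding m using f g c * Pm[OF c] fcomp[OF c] by (simp add: compose_eq is_operad_map_def)
  next
    fix p \<sigma> assume p: "p \<in> Ops P" and \<sigma>: "\<sigma> permutes {..<length (op_src P p)}"
    show "compose (Ops P) (op_map g) (op_map f) (op_perm P p \<sigma>) =
        op_perm R (compose (Ops P) (op_map g) (op_map f) p) \<sigma>"
      using f g p \<sigma> Pp[OF p \<sigma>] fo[OF p] by (simp add: compose_eq is_operad_map_def)
  qed
qed

lemma is_category_Omega: "is_category Omega"
proof -
  have ext: "compose A (restrict id B) f = f" "compose A f (restrict id A) = f"
    if "f \<in> A \<rightarrow>\<^sub>E B" for f :: "'b \<Rightarrow> 'c" and A B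
    using that by (fastforce simp: compose_def restrict_def extensional_def PiE_iff fun_eq_iff)+
  have units: "operad_map_comp P f (operad_map_id P) = f" "operad_map_comp P (operad_map_id Q) f = f"
    if "is_operad_map P Q f" for P Q and f :: "'a tree_map"
  proof -
    have "colour_map f \<in> Colours P \<rightarrow>\<^sub>E Colours Q" "op_map f \<in> Ops P \<rightarrow>\<^sub>E Ops Q"
      using that by (simp_all add: is_operad_map_def)
    note e = this[THEN ext(1)] this[THEN ext(2)]
    show "operad_map_comp P f (operad_map_id P) = f" "operad_map_comp P (operad_map_id Q) f = f"
      unfolding operad_map_comp_def operad_map_id_def operad_map.simps e by simp_all
  qed
  have assoc: "operad_map_comp P h (operad_map_comp P g f) = operad_map_comp P (operad_map_comp Q h g) f"
    if "is_operad_map P Q f" for P Q and f g h :: "'a tree_map"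
  proof -
    have "colour_map f c \<in> Colours Q" if "c \<in> Colours P" for c
      using \<open>is_operad_map P Q f\<close> that by (auto simp: is_operad_map_def)
    moreover have "op_map f p \<in> Ops Q" if "p \<in> Ops P" for p
      using \<open>is_operad_map P Q f\<close> that by (auto simp: is_operad_map_def)
    ultimately show ?thesis
      by (simp add: operad_map_comp_def compose_def fun_eq_iff)
  qed
  show ?thesis
    unfolding is_category_def Omega_def category.simps
    by (auto simp: is_operad_map_id is_operad_map_comp is_operad_tree_operad units assoc
        intro: is_operad_map_comp[OF is_operad_tree_operad])
qed

end

theory Submission
  imports Defs "HOL-Analysis.Analysis" "HOL-Library.Product_Order"
begin

text \<open>
  For a tree \<open>T\<close> let \<open>E(T)\<close> be the tree obtained by putting a stump on every leaf and a unary vertex, with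
  a new edge \<open>r\<close> as its output, below the root. As \<open>E(T)\<close> has no leaves, \<open>(e\<^sub>1, \<dots>, e\<^sub>n; e)\<close> is
  inhabited in its operad iff the \<open>e\<^sub>i\<close> are pairwise incomparable edges above \<open>e\<close>. Hence a morphism \<open>S \<rightarrow> T\<close>,
  which preserves the order and incomparability of edges, extends to \<open>E(S) \<rightarrow> E(T)\<close> by new edge to new
  edge, and \<open>E\<close> is an endofunctor of \<open>\<Omega>\<close>. The inclusions \<open>T \<rightarrow> E(T)\<close> and the maps \<open>\<eta> \<rightarrow> E(T)\<close> with value
  \<open>r\<close> are natural, so that the identity of the realization of \<open>N(\<Omega>)\<close> is homotopic to a constant map.
\<close>

section \<open>Homotopy groups of contractible spaces\<close>

text \<open>Without the stumps the extension would fail. The inputs of an operation have to cut off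
  every leaf above its output; if a morphism from \<open>S\<close> to \<open>T\<close> sends the
  root of \<open>S\<close> to an edge that some leaf of \<open>T\<close> is not above, then the
  images of the leaves of \<open>S\<close> cannot be the inputs of an operation with output the new
  edge. Stumps leave nothing to cut off. A natural transformation is usually turned into a homotopy
  by identifying the realization of a product with the product of realizations. Here the homotopy is
  instead given point by point: time and barycentric coordinates determine weights on the prism {0,
  ..., n} \<times> {0, 1}, and any chain that carries these weights represents the same point.
  Independence of choices and compatibility with gluing thereby become statements about weights.
  Weak equivalences are tested on based homotopy sets, whereas the contraction obtained from the two
  homotopies may move the basepoint. This is why spheroids in a contractible space need a separate
  argument.\<close>

lemma topspace_cube: "topspace (cube n) = {..<n} \<rightarrow>\<^sub>E {0..1}"
  by (simp add: cube_def)

lemma cube_boundary_subset: "cube_boundary n \<subseteq> topspace (cube n)"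
  by (auto simp: cube_boundary_def)

lemma continuous_map_into_cube:
  assumes "\<And>x i. i < n \<Longrightarrow> x \<in> topspace X \<Longrightarrow> f x i \<in> {0..1}"
    and "\<And>i. i < n \<Longrightarrow> continuous_map X euclideanreal (\<lambda>x. f x i)"
  shows "continuous_map X (cube n) (\<lambda>x. \<lambda>i\<in>{..<n}. f x i)"
proof -
  have "continuous_map X (top_of_set {0..1}) (\<lambda>x. (\<lambda>i\<in>{..<n}. f x i) i)" if "i < n" for i
    using assms that by (simp add: continuous_map_in_subtopology image_subset_iff)
  then show ?thesis
    by (auto simp: cube_def continuous_map_componentwise simp del: restrict_apply)
qed

lemma continuous_map_cube_coordinate:
  assumes "i < n"
  shows "continuous_map (cube n) euclideanreal (\<lambda>t. t i)"
  using continuous_map_product_projection[of i "{..<n}" "\<lambda>_. top_of_set {0..1::real}"] assms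
  by (auto simp: cube_def continuous_map_in_subtopology)

lemma cube_boundary_homotopic_withI:
  assumes h: "continuous_map (prod_topology (top_of_set {0..1::real}) (cube n)) X h"
    and "\<And>t. t \<in> topspace (cube n) \<Longrightarrow> h (0, t) = f t"
    and "\<And>t. t \<in> topspace (cube n) \<Longrightarrow> h (1, t) = g t"
    and "\<And>s t. \<lbrakk>s \<in> {0..1}; t \<in> cube_boundary n\<rbrakk> \<Longrightarrow> h (s, t) = x"
  shows "(f, g) \<in> spheroid_homotopy n X x"
proof -
  have "homotopic_with (\<lambda>k. \<forall>t\<in>cube_boundary n. k t = x) (cube n) X f g"
  proof (rule iffD2[OF homotopic_with])
    show "(\<forall>t\<in>cube_boundary n. h t = x) \<longleftrightarrow> (\<forall>t\<in>cube_boundary n. k t = x)"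
      if "\<And>t. t \<in> topspace (cube n) \<Longrightarrow> h t = k t" for h k
      using that cube_boundary_subset by (metis subsetD)
    show "\<exists>h. continuous_map (prod_topology (top_of_set {0..1::real}) (cube n)) X h \<and>
        (\<forall>t\<in>topspace (cube n). h (0, t) = f t) \<and> (\<forall>t\<in>topspace (cube n). h (1, t) = g t) \<and>
        (\<forall>s\<in>{0..1}. \<forall>t\<in>cube_boundary n. h (s, t) = x)"
      using assms by blast
  qed
  then show ?thesis by (simp add: spheroid_homotopy_def)
qed

text \<open>A spheroid \<open>g\<close> is first made constant outside the middle cube \<open>[1/4, 3/4]\<^sup>n\<close>; then the
  contraction \<open>H\<close> is applied with a speed that drops to \<open>0\<close> towards the boundary. The resulting spheroid
  does not depend on \<open>g\<close>.\<close>

lemma contractible_spheroid_homotopy: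
  assumes X: "contractible_space X" and x: "x \<in> topspace X"
    and f: "f \<in> spheroids n X x" and g: "g \<in> spheroids n X x"
  shows "(f, g) \<in> spheroid_homotopy n X x"
proof -
  obtain a H where H: "continuous_map (prod_topology (top_of_set {0..1::real}) X) X H"
    and H0: "\<And>y. H (0, y) = y" and H1: "\<And>y. H (1, y) = a"
    using X by (auto simp: contractible_space_def homotopic_with_def)
  let ?I = "top_of_set {0..1::real}" and ?C = "cube n"
  \<comment> \<open>\<open>b\<close> is 0 at both ends and 1 on [1/4, 3/4], so that the speed
    \<open>d\<close> is 0 on the boundary and 1 on the middle cube. \<open>c\<close> stretches
    [1/4, 3/4] onto [0, 1] and clamps the rest, so that \<open>\<rho> 1\<close> sends everything
    outside the middle cube to the boundary.\<close>
  define b where "b u = min 1 (4 * u) * min 1 (4 * (1 - u))" for u :: real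
  define d where "d t = (\<Prod>i<n. b (t i))" for t :: "nat \<Rightarrow> real"
  define c where "c u = max 0 (min 1 (2 * u - 1/2))" for u :: real
  define \<rho> where "\<rho> s t = (\<lambda>i\<in>{..<n}. (1 - s) * t i + s * c (t i))" for s :: real and t :: "nat \<Rightarrow> real"
  have b: "b u \<in> {0..1}" if "u \<in> {0..1}" for u
    using that by (auto simp: b_def intro: mult_le_one)
  have d: "d t \<in> {0..1}" if "t \<in> topspace ?C" for t
    using that b unfolding d_def topspace_cube by (auto intro!: prod_nonneg prod_le_1 simp: PiE_iff)
  have c: "c u \<in> {0..1}" for u by (auto simp: c_def)
  have mid: "(1 - s) * u + s * c u \<in> {0..1}" if "s \<in> {0..1}" "u \<in> {0..1}" for s u
    using that c[of u] convex_bound_le[of u 1 "c u" "1 - s" s] by auto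
  have coord: "continuous_map (prod_topology ?I ?C) euclideanreal (\<lambda>z. snd z i)" if "i < n" for i
    using continuous_map_compose[OF continuous_map_snd continuous_map_cube_coordinate[OF that]]
    by (simp add: comp_def)
  have time: "continuous_map (prod_topology ?I ?C) euclideanreal fst"
    using continuous_map_fst[of ?I ?C] by (simp add: continuous_map_in_subtopology)
  have cont_d: "continuous_map (prod_topology ?I ?C) euclideanreal (\<lambda>z. d (snd z))"
    unfolding d_def b_def by (intro continuous_map_prod continuous_map_real_mult continuous_map_diff
      continuous_map_real_min coord) simp_all
  have cont_\<rho>: "continuous_map (prod_topology ?I ?C) ?C (\<lambda>z. \<rho> (fst z) (snd z))"
    unfolding \<rho>_def
  proof (rule continuous_map_into_cube[where f = "\<lambda>z i. (1 - fst z) * snd z i + fst z * c (snd z i)"])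
    fix z i assume "i < n" "z \<in> topspace (prod_topology ?I ?C)"
    then have "fst z \<in> {0..1}" "snd z \<in> topspace ?C"
      unfolding topspace_prod_topology mem_Times_iff by simp_all
    with \<open>i < n\<close> have "fst z \<in> {0..1}" "snd z i \<in> {0..1}"
      by (simp_all add: topspace_cube PiE_iff)
    then show "(1 - fst z) * snd z i + fst z * c (snd z i) \<in> {0..1}"
      by (rule mid)
  next
    fix i assume "i < n"
    then show "continuous_map (prod_topology ?I ?C) euclideanreal
        (\<lambda>z. (1 - fst z) * snd z i + fst z * c (snd z i))"
      unfolding c_def by (intro continuous_map_add continuous_map_real_mult continuous_map_diff
        continuous_map_real_max continuous_map_real_min coord time) simp_all
  qed
  have bd: "\<rho> s t \<in> cube_boundary n" if "s \<in> {0..1}" "t \<in> topspace ?C" "i < n" "(1 - s) * t i + s * c (t i) \<in> {0, 1}" for s t i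
  proof -
    have "t j \<in> {0..1}" if "j < n" for j
      using \<open>t \<in> topspace ?C\<close> that by (simp add: topspace_cube PiE_iff)
    then have "\<rho> s t \<in> topspace ?C"
      using mid[OF that(1)] by (simp add: \<rho>_def topspace_cube del: atLeastAtMost_iff)
    then show ?thesis
      using that by (auto simp: cube_boundary_def \<rho>_def)
  qed
  have step: "(g, \<lambda>t. H (d t, x)) \<in> spheroid_homotopy n X x" if g: "g \<in> spheroids n X x" for g
  proof -
    have gc: "continuous_map ?C X g" and gb: "\<And>t. t \<in> cube_boundary n \<Longrightarrow> g t = x"
      using g by (auto simp: spheroids_def)
    have 1: "(g, \<lambda>t. g (\<rho> 1 t)) \<in> spheroid_homotopy n X x"
    proof (rule cube_boundary_homotopic_withI)
      show "continuous_map (prod_topology ?I ?C) X (\<lambda>z. g (\<rho> (fst z) (snd z)))"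
        using continuous_map_compose[OF cont_\<rho> gc] by (simp add: comp_def)
      show "g (\<rho> (fst (0, t)) (snd (0, t))) = g t" if "t \<in> topspace ?C" for t
      proof -
        have "\<rho> 0 t = t" using that by (auto simp: \<rho>_def topspace_cube PiE_iff extensional_def)
        then show ?thesis by simp
      qed
      show "g (\<rho> (fst (s, t)) (snd (s, t))) = x" if st: "s \<in> {0..1}" "t \<in> cube_boundary n" for s t
      proof -
        obtain i where "i < n" "t i = 0 \<or> t i = 1" "t \<in> topspace ?C"
          using st(2) by (auto simp: cube_boundary_def)
        then have "\<rho> s t \<in> cube_boundary n"
          using st(1) by (intro bd[of s t i]) (auto simp: c_def)
        then show ?thesis using gb by simp
      qed
    qed simp
    have 2: "(\<lambda>t. g (\<rho> 1 t), \<lambda>t. H (d t, x)) \<in> spheroid_homotopy n X x"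
    proof (rule cube_boundary_homotopic_withI)
      let ?h = "\<lambda>z. H (fst z * d (snd z), g (\<rho> 1 (snd z)))"
      have r: "continuous_map (prod_topology ?I ?C) ?C (\<lambda>z. \<rho> 1 (snd z))"
        unfolding \<rho>_def
      proof (rule continuous_map_into_cube[where f = "\<lambda>z i. (1 - 1) * snd z i + 1 * c (snd z i)"])
        fix i assume "i < n"
        then show "continuous_map (prod_topology ?I ?C) euclideanreal
            (\<lambda>z. (1 - 1) * snd z i + 1 * c (snd z i))"
          unfolding c_def by (intro continuous_map_add continuous_map_real_mult continuous_map_diff
            continuous_map_real_max continuous_map_real_min coord) simp_all
      qed (use c in simp)
      have "continuous_map (prod_topology ?I ?C) ?I (\<lambda>z. fst z * d (snd z))"
        using d continuous_map_real_mult[OF time cont_d]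
        by (auto simp: continuous_map_in_subtopology intro!: mult_le_one)
      moreover have "continuous_map (prod_topology ?I ?C) X (\<lambda>z. g (\<rho> 1 (snd z)))"
        using continuous_map_compose[OF r gc] by (simp add: comp_def)
      ultimately show "continuous_map (prod_topology ?I ?C) X ?h"
        using continuous_map_compose[OF continuous_map_pairedI H] by (simp add: comp_def)
      show "?h (0, t) = g (\<rho> 1 t)" for t
        by (simp add: H0)
      \<comment> \<open>This is where \<open>g\<close> is forgotten: in the middle cube
        \<open>H\<close> has run its full time and gives \<open>a\<close> at every point, and
        elsewhere \<open>g\<close> is evaluated on the boundary, where it is
        \<open>x\<close>.\<close>
      show "?h (1, t) = H (d t, x)" if t: "t \<in> topspace ?C" for t
      proof (cases "\<forall>i<n. t i \<in> {1/4..3/4}")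
        case True
        then have "d t = 1" unfolding d_def by (intro prod.neutral) (auto simp: b_def)
        then show ?thesis by (simp add: H1)
      next
        case False
        then obtain i where i: "i < n" "t i < 1/4 \<or> t i > 3/4"
          by fastforce
        then have "\<rho> 1 t \<in> cube_boundary n"
          using t by (intro bd[of 1 t i]) (auto simp: c_def)
        then show ?thesis by (simp add: gb)
      qed
      show "?h (s, t) = x" if st: "s \<in> {0..1}" "t \<in> cube_boundary n" for s t
      proof -
        obtain i where i: "i < n" "t i = 0 \<or> t i = 1" and t: "t \<in> topspace ?C"
          using st(2) by (auto simp: cube_boundary_def)
        then have "\<rho> 1 t \<in> cube_boundary n"
          by (intro bd[of 1 t i]) (auto simp: c_def)
        moreover have "d t = 0"
          unfolding d_def using i by (intro prod_zero bexI[of _ i]) (auto simp: b_def)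
        ultimately show ?thesis by (simp add: gb H0)
      qed
    qed
    show ?thesis
      using 1 2 by (auto simp: spheroid_homotopy_def intro: homotopic_with_trans)
  qed
  show ?thesis
    using step[OF f] step[OF g]
    by (auto simp: spheroid_homotopy_def intro: homotopic_with_trans homotopic_with_symD)
qed

lemma spheroid_homotopy_Image:
  assumes X: "contractible_space X" and x: "x \<in> topspace X" and g: "g \<in> spheroids n X x"
  shows "spheroid_homotopy n X x `` {g} = spheroids n X x"
proof (intro equalityI subsetI)
  fix h assume "h \<in> spheroid_homotopy n X x `` {g}"
  then have "homotopic_with (\<lambda>k. \<forall>t\<in>cube_boundary n. k t = x) (cube n) X g h"
    by (simp add: spheroid_homotopy_def)
  then show "h \<in> spheroids n X x"
    using homotopic_with_imp_continuous_maps homotopic_with_imp_property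
    unfolding spheroids_def by (metis (mono_tags, lifting) mem_Collect_eq)
qed (use contractible_spheroid_homotopy[OF X x g] in auto)

lemma const_spheroid: "x \<in> topspace X \<Longrightarrow> (\<lambda>_. x) \<in> spheroids n X x"
  by (simp add: spheroids_def)

lemma homotopy_set_contractible:
  assumes X: "contractible_space X" and x: "x \<in> topspace X"
  shows "homotopy_set n X x = {spheroids n X x}"
  using spheroid_homotopy_Image[OF assms] const_spheroid[OF x]
  unfolding homotopy_set_def quotient_def by force

text \<open>All homotopy sets on both sides are singletons, so the induced maps have no choice.
  \<open>ne\<close> excludes the empty space, which also counts as contractible.\<close>

lemma weak_homotopy_equivalence_contractible:
  assumes X: "contractible_space X" and Y: "contractible_space Y" and ne: "topspace X \<noteq> {}"
    and f: "continuous_map X Y f"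
  shows "weak_homotopy_equivalence X Y f"
  unfolding weak_homotopy_equivalence_def
proof (intro conjI ballI allI impI f)
  fix x n assume x: "x \<in> topspace X"
  then have fx: "f x \<in> topspace Y"
    using f by (auto simp: continuous_map_def)
  have "f \<circ> g \<in> spheroids n Y (f x)" if "g \<in> spheroids n X x" for g
    using that continuous_map_compose[OF _ f] by (auto simp: spheroids_def)
  then have "homotopy_set_map n Y f x (spheroids n X x) = spheroids n Y (f x)"
    using spheroid_homotopy_Image[OF Y fx] const_spheroid[OF x, of n]
    unfolding homotopy_set_map_def by fast
  then show "bij_betw (homotopy_set_map n Y f x) (homotopy_set n X x) (homotopy_set n Y (f x))"
    using homotopy_set_contractible[OF X x] homotopy_set_contractible[OF Y fx]
    by (simp add: bij_betw_def)
qed (use ne in simp)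


section \<open>Points and maps of the realization\<close>

lemma topspace_prerealization:
  "(n, x, t) \<in> topspace (prerealization X) \<longleftrightarrow> x \<in> simplices X n \<and> t \<in> standard_simplex n"
  by (auto simp: prerealization_def)

lemma topspace_realization: "topspace (realization X) = glue_class X ` topspace (prerealization X)"
  by (simp add: realization_def)

lemma quotient_map_glue_class: "quotient_map (prerealization X) (realization X) (glue_class X)"
  unfolding realization_def by (rule quotient_map_quotient_topology)

lemma glue_class_refl: "p \<in> glue_class X p"
  by (simp add: glue_class_def)

lemma glue_class_eqI:
  assumes "(p, q) \<in> glue X" shows "glue_class X p = glue_class X q"
proof -
  let ?R = "glue X \<union> (glue X)\<inverse>"
  have 1: "(p, q) \<in> ?R\<^sup>*" "(q, p) \<in> ?R\<^sup>*" using assms by auto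
  show ?thesis
    unfolding glue_class_def using rtrancl_trans[OF 1(1)] rtrancl_trans[OF 1(2)] by blast
qed

lemma glue_class_pull:
  assumes "\<theta> \<in> monotone_maps m n" "x \<in> simplices X n" "t \<in> standard_simplex m"
  shows "glue_class X (m, pull X m n \<theta> x, t) = glue_class X (n, x, push m \<theta> t)"
  using assms by (intro glue_class_eqI) (auto simp: glue_def)

lemma glue_invariant:
  assumes "q \<in> glue_class X p" and inv: "\<And>p q. (p, q) \<in> glue X \<Longrightarrow> h p = h q"
  shows "h q = h p"
proof -
  have "(p, q) \<in> (glue X \<union> (glue X)\<inverse>)\<^sup>*"
    using assms(1) by (simp add: glue_class_def)
  then show ?thesis
    by induction (auto dest: inv)
qed

section \<open>Continuity into and out of a realization\<close>

lemma continuous_map_glue_class_cell: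
  assumes "x \<in> simplices X n"
  shows "continuous_map (simplex_space n) (realization X) (\<lambda>t. glue_class X (n, x, t))"
proof -
  have "continuous_map (simplex_space n) (prod_topology (discrete_topology (simplices X n)) (simplex_space n)) (\<lambda>t. (x, t))"
    using assms by (intro continuous_map_pairedI) auto
  then have "continuous_map (simplex_space n) (prerealization X) (\<lambda>t. (n, x, t))"
    unfolding prerealization_def
    by (rule continuous_map_compose[OF _ continuous_map_component_injection, unfolded comp_def, where i1 = n]) simp
  then show ?thesis
    by (rule continuous_map_compose[OF _ quotient_imp_continuous_map[OF quotient_map_glue_class], unfolded comp_def])
qed

text \<open>Each simplex {n} \<times> {x} \<times> \<open>standard_simplex n\<close> is open in the
  disjoint union, so continuity can be tested on one simplex at a time, also after taking the
  product with \<open>Z\<close>.\<close>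

lemma continuous_map_from_cells:
  assumes cells: "\<And>n x. x \<in> simplices X n \<Longrightarrow>
      continuous_map (prod_topology Z (simplex_space n)) Y (\<lambda>(s, t). h (s, (n, x, t)))"
  shows "continuous_map (prod_topology Z (prerealization X)) Y h"
  unfolding continuous_map_def
proof (intro conjI allI impI)
  show "h \<in> topspace (prod_topology Z (prerealization X)) \<rightarrow> topspace Y"
  proof
    fix p assume p: "p \<in> topspace (prod_topology Z (prerealization X))"
    obtain s n x t where [simp]: "p = (s, (n, x, t))" by (rule prod_cases4)
    have "s \<in> topspace Z" and x: "x \<in> simplices X n" and "t \<in> standard_simplex n"
      using p by (simp_all add: topspace_prerealization)
    then have "(s, t) \<in> topspace (prod_topology Z (simplex_space n))" by simp
    then show "h p \<in> topspace Y"
      using continuous_map_funspace[OF cells[OF x]] by (simp add: Pi_iff split_beta)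
  qed
next
  fix U assume U: "openin Y U"
  let ?W = "{p \<in> topspace (prod_topology Z (prerealization X)). h p \<in> U}"
  show "openin (prod_topology Z (prerealization X)) ?W"
    unfolding openin_prod_topology_alt
  proof (intro allI impI)
    fix s p assume sp: "(s, p) \<in> ?W"
    obtain n x t where p1: "p = (n, x, t)" by (rule prod_cases3)
    then have p: "p = (n, x, t)" "s \<in> topspace Z" "x \<in> simplices X n" "t \<in> standard_simplex n"
      using sp by (simp_all add: topspace_prerealization)
    let ?V = "{z \<in> topspace (prod_topology Z (simplex_space n)). (\<lambda>(s, t). h (s, (n, x, t))) z \<in> U}"
    have "openin (prod_topology Z (simplex_space n)) ?V"
      by (rule openin_continuous_map_preimage[OF cells[OF p(3)] U])
    moreover have "(s, t) \<in> ?V" using p sp by simp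
    ultimately obtain A B where AB: "openin Z A" "openin (simplex_space n) B" "s \<in> A" "t \<in> B" "A \<times> B \<subseteq> ?V"
      unfolding openin_prod_topology_alt by meson
    define B' where "B' = {n} \<times> {x} \<times> B"
    have BS: "B \<subseteq> standard_simplex n" using openin_subset[OF AB(2)] by simp
    have "{y. (i, y) \<in> B'} = (if i = n then {x} \<times> B else {})" for i
      by (auto simp: B'_def)
    moreover have "openin (prod_topology (discrete_topology (simplices X n)) (simplex_space n)) ({x} \<times> B)"
      using AB(2) p(3) by (simp add: openin_prod_Times_iff)
    ultimately have "openin (prerealization X) B'"
      unfolding prerealization_def openin_sum_topology using BS p(3) by (auto simp: B'_def)
    moreover have "A \<times> B' \<subseteq> ?W"
      using AB(5) openin_subset[OF AB(1)] BS p(3) by (auto simp: B'_def topspace_prerealization)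
    ultimately show "\<exists>A B. openin Z A \<and> openin (prerealization X) B \<and> s \<in> A \<and> p \<in> B \<and> A \<times> B \<subseteq> ?W"
      using AB(1,3,4) by (intro exI[of _ A] exI[of _ B']) (simp add: B'_def p(1))
  qed
qed

text \<open>The product of a quotient map with an identity map need not be a quotient map. It is one
  here because the interval is locally compact and Hausdorff, so a family compatible with the gluing
  at each time descends to a jointly continuous map.\<close>

lemma realization_homotopy:
  assumes cells: "\<And>n x. x \<in> simplices X n \<Longrightarrow>
      continuous_map (prod_topology (top_of_set {0..1::real}) (simplex_space n)) Y (\<lambda>(s, t). h s (n, x, t))"
    and inv: "\<And>s p q. \<lbrakk>s \<in> {0..1}; (p, q) \<in> glue X\<rbrakk> \<Longrightarrow> h s p = h s q"
  obtains H where "continuous_map (prod_topology (top_of_set {0..1::real}) (realization X)) Y H"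
    "\<And>s p. \<lbrakk>s \<in> {0..1}; p \<in> topspace (prerealization X)\<rbrakk> \<Longrightarrow> H (s, glue_class X p) = h s p"
proof -
  let ?I = "top_of_set {0..1::real}"
  have "locally_compact_space ?I"
    by (intro compact_imp_locally_compact_space compact_space_subtopology) simp
  moreover have "Hausdorff_space ?I"
    by (simp add: Hausdorff_space_subtopology)
  ultimately have q: "quotient_map (prod_topology ?I (prerealization X)) (prod_topology ?I (realization X))
      (\<lambda>(s, p). (s, glue_class X p))"
    by (intro quotient_map_prod_right quotient_map_glue_class) auto
  have c: "continuous_map (prod_topology ?I (prerealization X)) Y (\<lambda>(s, p). h s p)"
    by (rule continuous_map_from_cells) (use cells in simp)
  have e: "h s p = h s p'" if "s \<in> {0..1}" "glue_class X p = glue_class X p'" for s p p'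
    using glue_invariant[of p' X p "h s"] inv that glue_class_refl[of p' X] by metis
  obtain H where "continuous_map (prod_topology ?I (realization X)) Y H"
    and H: "\<And>z. z \<in> topspace (prod_topology ?I (prerealization X)) \<Longrightarrow>
        H ((\<lambda>(s, p). (s, glue_class X p)) z) = (\<lambda>(s, p). h s p) z"
  proof (rule quotient_map_lift_exists[OF q c])
    show "(\<lambda>(s, p). h s p) y = (\<lambda>(s, p). h s p) z"
      if "y \<in> topspace (prod_topology ?I (prerealization X))"
        "(\<lambda>(s, p). (s, glue_class X p)) y = (\<lambda>(s, p). (s, glue_class X p)) z" for y z
      using that e[of "fst y" "snd y" "snd z"] by (simp add: split_beta mem_Times_iff)
  qed blast
  moreover have "H (s, glue_class X p) = h s p" if "s \<in> {0..1}" "p \<in> topspace (prerealization X)" for s p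
    using H[of "(s, p)"] that by simp
  ultimately show thesis using that by blast
qed

lemma realization_map_glue_class:
  assumes f: "\<And>n x. x \<in> simplices X n \<Longrightarrow> f n x \<in> simplices Y n"
    and nat: "\<And>m n \<theta> x. \<lbrakk>\<theta> \<in> monotone_maps m n; x \<in> simplices X n\<rbrakk> \<Longrightarrow>
        f m (pull X m n \<theta> x) = pull Y m n \<theta> (f n x)"
  shows "realization_map Y f (glue_class X (n, x, t)) = glue_class Y (n, f n x, t)"
proof -
  let ?h = "\<lambda>(n, x, t). glue_class Y (n, f n x, t)"
  have "?h p = ?h q" if "(p, q) \<in> glue X" for p q
    using that f nat by (auto simp: glue_def glue_class_pull)
  then have "?h q = ?h (n, x, t)" if "q \<in> glue_class X (n, x, t)" for q
    using glue_invariant[OF that, of ?h] by blast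
  then show ?thesis
    unfolding realization_map_def using glue_class_refl[of "(n, x, t)" X] by (auto simp: split_beta)
qed


section \<open>Points of a realization given by weights on a poset\<close>

text \<open>The simplices of the nerve of \<open>P\<close>, degenerate ones included. Values beyond
  \<open>m\<close> are left free; hence the congruence hypothesis of
  \<open>glue_class_push_weight\<close>.\<close>

definition poset_chains :: "'p::order set \<Rightarrow> nat \<Rightarrow> (nat \<Rightarrow> 'p) set" where
  "poset_chains P m = {c. c \<in> {..m} \<rightarrow> P \<and> mono_on {..m} c}"

text \<open>The analogue of \<open>push\<close> with a poset as target: the barycentric coordinates,
  indexed by all vertices of the order complex, of the point \<open>v\<close> of the simplex
  \<open>c\<close>.\<close>

definition push_weight :: "nat \<Rightarrow> (nat \<Rightarrow> 'p) \<Rightarrow> (nat \<Rightarrow> real) \<Rightarrow> 'p \<Rightarrow> real" where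
  "push_weight m c v p = (\<Sum>i | i \<le> m \<and> c i = p. v i)"


text \<open>The enumeration inverts the rank function, which counts the strictly smaller elements of
  the chain.\<close>

lemma finite_chain_enumeration:
  fixes A :: "'p::order set"
  assumes "finite A" "A \<noteq> {}" and total: "\<And>x y. \<lbrakk>x \<in> A; y \<in> A\<rbrakk> \<Longrightarrow> x \<le> y \<or> y \<le> x"
  shows "\<exists>M e. bij_betw e {..M} A \<and> (\<forall>i\<le>M. \<forall>j\<le>M. e i \<le> e j \<longleftrightarrow> i \<le> (j::nat))"
proof -
  define r where "r p = card {q \<in> A. q < p}" for p
  have less: "r p < r q" if "p \<in> A" "q \<in> A" "p < q" for p q
    unfolding r_def using that assms(1) by (intro psubset_card_mono) auto
  have inj: "inj_on r A"
  proof (rule inj_onI)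
    fix p q assume pq: "p \<in> A" "q \<in> A" "r p = r q"
    then show "p = q"
      using less[of p q] less[of q p] total[of p q] by (auto simp: order_le_less)
  qed
  have "r ` A \<subseteq> {..<card A}"
    unfolding r_def using assms(1) by (auto intro!: psubset_card_mono)
  moreover have "card (r ` A) = card A"
    using inj by (rule card_image)
  ultimately have "r ` A = {..<card A}"
    by (intro card_subset_eq) auto
  moreover have "{..<card A} = {..card A - 1}"
  proof -
    have "card A > 0" using assms(1,2) by (simp add: card_gt_0_iff)
    then show ?thesis by auto
  qed
  ultimately have bij: "bij_betw r A {..card A - 1}"
    using inj by (simp add: bij_betw_def)
  define e where "e = the_inv_into A r"
  have e: "e i \<in> A" "r (e i) = i" if "i \<le> card A - 1" for i
  proof -
    have "i \<in> r ` A" using bij that by (simp add: bij_betw_def)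
    then show "e i \<in> A" "r (e i) = i"
      using inj unfolding e_def by (simp_all add: the_inv_into_into f_the_inv_into_f)
  qed
  show ?thesis
  proof (intro exI conjI allI impI)
    show "bij_betw e {..card A - 1} A"
      unfolding e_def using bij by (rule bij_betw_the_inv_into)
    show "e i \<le> e j \<longleftrightarrow> i \<le> j" if "i \<le> card A - 1" "j \<le> card A - 1" for i j
    proof
      assume "e i \<le> e j"
      then consider "e i = e j" | "e i < e j" by (auto dest: order.not_eq_order_implies_strict)
      then show "i \<le> j"
      proof cases
        case 1
        then have "r (e i) = r (e j)" by (rule arg_cong)
        then show ?thesis unfolding e(2)[OF that(1)] e(2)[OF that(2)] by (rule eq_refl)
      next
        case 2
        then have "r (e i) < r (e j)" by (rule less[OF e(1)[OF that(1)] e(1)[OF that(2)]])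
        then show ?thesis unfolding e(2)[OF that(1)] e(2)[OF that(2)] by (rule less_imp_le)
      qed
    next
      assume "i \<le> j"
      have "\<not> e j < e i"
      proof
        assume "e j < e i"
        then have "r (e j) < r (e i)" by (rule less[OF e(1)[OF that(2)] e(1)[OF that(1)]])
        then show False unfolding e(2)[OF that(1)] e(2)[OF that(2)] using \<open>i \<le> j\<close> by linarith
      qed
      with total[OF e(1)[OF that(1)] e(1)[OF that(2)]] show "e i \<le> e j"
        by (metis order_le_less)
    qed
  qed
qed

text \<open>\<open>S m c\<close> is the restriction along \<open>c\<close> of a \<open>P\<close>-shaped diagram in \<open>Y\<close>. The point only depends on
  the weight because it is also represented on the support of the weight.\<close>

lemma glue_class_push_weight:
  fixes S :: "nat \<Rightarrow> (nat \<Rightarrow> 'p::order) \<Rightarrow> 'y"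
  assumes S: "\<And>m c. c \<in> poset_chains P m \<Longrightarrow> S m c \<in> simplices Y m"
    and pull: "\<And>l m \<theta> c. \<lbrakk>\<theta> \<in> monotone_maps l m; c \<in> poset_chains P m\<rbrakk> \<Longrightarrow> pull Y l m \<theta> (S m c) = S l (c \<circ> \<theta>)"
    and cong: "\<And>m c c'. (\<And>i. i \<le> m \<Longrightarrow> c i = c' i) \<Longrightarrow> S m c = S m c'"
    and c: "c \<in> poset_chains P m" "v \<in> standard_simplex m"
    and c': "c' \<in> poset_chains P m'" "v' \<in> standard_simplex m'"
    and eq: "push_weight m c v = push_weight m' c' v'"
  shows "glue_class Y (m, S m c, v) = glue_class Y (m', S m' c', v')"
proof -
  define w where "w = push_weight m c v"
  define Q where "Q = {p. w p \<noteq> 0}"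
  have supp: "Q \<subseteq> c ` {..m}" if "push_weight m c v = w" for m c v
  proof
    fix p assume "p \<in> Q"
    then have "sum v {i. i \<le> m \<and> c i = p} \<noteq> 0"
      by (simp add: Q_def that[symmetric] push_weight_def)
    then have "\<not> (\<forall>i\<in>{i. i \<le> m \<and> c i = p}. v i = 0)"
      by (rule contrapos_nn) (rule sum.neutral)
    then show "p \<in> c ` {..m}" by auto
  qed
  have total: "x \<le> y \<or> y \<le> x" if xy: "c \<in> poset_chains P m" "x \<in> c ` {..m}" "y \<in> c ` {..m}" for c m x y
  proof -
    obtain i j where "i \<le> m" "x = c i" "j \<le> m" "y = c j" using xy(2,3) by auto
    then show ?thesis
      using xy(1) nat_le_linear[of i j] by (auto simp: poset_chains_def mono_on_def)
  qed
  have finQ: "finite Q" using finite_subset[OF supp[OF w_def[symmetric]]] by simp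
  have sumw: "sum w (c ` {..m}) = 1" if "push_weight m c v = w" "v \<in> standard_simplex m" for m c v
    using sum.image_gen[of "{..m}" v c] that
    by (simp add: standard_simplex_def push_weight_def flip: that(1))
  have "Q \<noteq> {}"
  proof
    assume "Q = {}"
    then have "w = (\<lambda>_. 0)" by (auto simp: Q_def)
    then show False using sumw[OF w_def[symmetric] c(2)] by simp
  qed
  moreover have "x \<le> y \<or> y \<le> x" if "x \<in> Q" "y \<in> Q" for x y
    using that subsetD[OF supp[OF w_def[symmetric]]] by (intro total[OF c(1)])
  ultimately have "\<exists>N e. bij_betw e {..N} Q \<and> (\<forall>i\<le>N. \<forall>j\<le>N. e i \<le> e j \<longleftrightarrow> i \<le> (j::nat))"
    by (rule finite_chain_enumeration[OF finQ])
  then obtain N e where e: "bij_betw e {..N} Q" "\<And>i j. \<lbrakk>i \<le> N; j \<le> N\<rbrakk> \<Longrightarrow> e i \<le> e j \<longleftrightarrow> i \<le> (j::nat)"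
    by blast
  define u where "u j = (if j \<le> N then w (e j) else 0)" for j
  \<comment> \<open>\<open>c\<close> and the enumeration \<open>e\<close> of the support are
    compared inside the image of \<open>c\<close>, enumerated by \<open>d\<close>. Both factor
    through \<open>d\<close>: \<open>\<rho> \<circ> c\<close> may repeat vertices,
    \<open>\<rho> \<circ> e\<close> may skip vertices of weight 0, and both push their coordinates
    to \<open>w \<circ> d\<close>.\<close>
  have main: "glue_class Y (m, S m c, v) = glue_class Y (N, S N e, u)"
    if c: "c \<in> poset_chains P m" and v: "v \<in> standard_simplex m" and w: "push_weight m c v = w" for m c v
  proof -
    let ?A = "c ` {..m}"
    have "\<exists>M d. bij_betw d {..M} ?A \<and> (\<forall>i\<le>M. \<forall>j\<le>M. d i \<le> d j \<longleftrightarrow> i \<le> (j::nat))"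
    proof (rule finite_chain_enumeration[of ?A])
      show "x \<le> y \<or> y \<le> x" if "x \<in> ?A" "y \<in> ?A" for x y
        by (rule total[OF c that])
    qed auto
    then obtain M d where d: "bij_betw d {..M} ?A" "\<And>i j. \<lbrakk>i \<le> M; j \<le> M\<rbrakk> \<Longrightarrow> d i \<le> d j \<longleftrightarrow> i \<le> (j::nat)"
      by blast
    define \<rho> where "\<rho> = the_inv_into {..M} d"
    have \<rho>: "\<rho> p \<le> M" "d (\<rho> p) = p" if "p \<in> ?A" for p
    proof -
      have "p \<in> d ` {..M}" "inj_on d {..M}" using d(1) that by (simp_all add: bij_betw_def)
      then show "\<rho> p \<le> M" "d (\<rho> p) = p"
        using the_inv_into_into[of d "{..M}" p "{..M}"] by (simp_all add: \<rho>_def f_the_inv_into_f)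
    qed
    have \<rho>d: "\<rho> (d j) = j" if "j \<le> M" for j
      using d(1) that by (simp add: \<rho>_def bij_betw_def the_inv_into_f_f)
    have dA: "d j \<in> ?A" if "j \<le> M" for j
      using d(1) that by (auto simp: bij_betw_def)
    have dP: "d \<in> poset_chains P M"
    proof -
      have "?A \<subseteq> P" using c by (auto simp: poset_chains_def)
      then show ?thesis using dA d(2) by (auto simp: poset_chains_def mono_on_def)
    qed
    have inA: "c i \<in> ?A" if "i \<le> m" for i using that by auto
    have eA: "e j \<in> ?A" "e j \<in> Q" if "j \<le> N" for j
      using e(1) that supp[OF w] by (auto simp: bij_betw_def)
    have 1: "\<rho> \<circ> c \<in> monotone_maps m M"
    proof -
      have "\<rho> (c i) \<le> \<rho> (c j)" if "i \<le> j" "j \<le> m" for i j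
      proof -
        have "c i \<le> c j" using c that by (auto simp: poset_chains_def mono_on_def)
        then show ?thesis using \<rho>[OF inA, of i] \<rho>[OF inA, of j] d(2)[of "\<rho> (c i)" "\<rho> (c j)"] that by simp
      qed
      then show ?thesis using \<rho>(1)[OF inA] by (auto simp: monotone_maps_def mono_on_def)
    qed
    have 2: "\<rho> \<circ> e \<in> monotone_maps N M"
    proof -
      have "\<rho> (e i) \<le> \<rho> (e j)" if "i \<le> j" "j \<le> N" for i j
        using \<rho>[OF eA(1), of i] \<rho>[OF eA(1), of j] d(2)[of "\<rho> (e i)" "\<rho> (e j)"] e(2)[of i j] that by simp
      then show ?thesis using \<rho>(1)[OF eA(1)] by (auto simp: monotone_maps_def mono_on_def)
    qed
    have pc: "push m (\<rho> \<circ> c) v j = (if j \<le> M then w (d j) else 0)" for j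
    proof -
      have "{i. i \<le> m \<and> (\<rho> \<circ> c) i = j} = (if j \<le> M then {i. i \<le> m \<and> c i = d j} else {})"
        using \<rho> inA \<rho>d by auto
      then show ?thesis
        using w by (auto simp: push_def push_weight_def)
    qed
    have pe: "push N (\<rho> \<circ> e) u j = (if j \<le> M then w (d j) else 0)" for j
    proof (cases "j \<le> M \<and> d j \<in> Q")
      case True
      then have "d j \<in> e ` {..N}"
        using e(1) by (simp add: bij_betw_def)
      then obtain i where i: "i \<le> N" "e i = d j"
        by auto
      have "k = i" if "k \<le> N" "\<rho> (e k) = j" for k
      proof -
        have "e k = e i" using \<rho>(2)[OF eA(1)[OF that(1)]] that(2) i(2) by simp
        then show ?thesis using e(1) that(1) i(1) by (auto simp: bij_betw_def inj_on_def)
      qed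
      moreover have "\<rho> (e i) = j" using i(2) True \<rho>d[of j] by simp
      ultimately have "{k. k \<le> N \<and> (\<rho> \<circ> e) k = j} = {i}"
        using i(1) unfolding comp_apply by blast
      then show ?thesis using True i by (simp add: push_def u_def)
    next
      case False
      have "{k. k \<le> N \<and> (\<rho> \<circ> e) k = j} = {}"
      proof -
        have "\<not> (k \<le> N \<and> \<rho> (e k) = j)" for k
          using False \<rho>[OF eA(1), of k] eA(2)[of k] by auto
        then show ?thesis by simp
      qed
      moreover have "j \<le> M \<Longrightarrow> w (d j) = 0" using False by (simp add: Q_def)
      ultimately show ?thesis unfolding push_def by (simp only: sum.empty) simp
    qed
    have u: "u \<in> standard_simplex N"
    proof -
      have nn: "0 \<le> w p" for p
        unfolding w[symmetric] push_weight_def using v by (intro sum_nonneg) (auto simp: standard_simplex_def)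
      have "sum u {..N} = sum w Q"
        using sum.reindex_bij_betw[OF e(1), of w] by (simp add: u_def)
      also have "\<dots> = sum w ?A"
        using supp[OF w] by (intro sum.mono_neutral_left) (auto simp: Q_def)
      finally have s: "sum u {..N} = 1" using sumw[OF w v] by simp
      have nu: "0 \<le> u j" for j using nn by (simp add: u_def)
      have "u j \<le> 1" for j
      proof (cases "j \<le> N")
        case True
        then show ?thesis using nu by (subst s[symmetric], intro member_le_sum) simp_all
      qed (simp add: u_def)
      then show ?thesis
        using nu s by (simp add: standard_simplex_def) (simp add: u_def)
    qed
    have "S m c = S m (d \<circ> (\<rho> \<circ> c))"
      using \<rho> inA by (intro cong) auto
    then have "glue_class Y (m, S m c, v) = glue_class Y (M, S M d, push m (\<rho> \<circ> c) v)"
      using glue_class_pull[OF 1 S[OF dP] v] pull[OF 1 dP] by simp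
    also have "push m (\<rho> \<circ> c) v = push N (\<rho> \<circ> e) u"
      using pc pe by (intro ext) simp
    also have "glue_class Y (M, S M d, push N (\<rho> \<circ> e) u) = glue_class Y (N, S N (d \<circ> (\<rho> \<circ> e)), u)"
      using glue_class_pull[OF 2 S[OF dP] u] pull[OF 2 dP] by simp
    also have "S N (d \<circ> (\<rho> \<circ> e)) = S N e"
      using \<rho> eA by (intro cong) auto
    finally show ?thesis .
  qed
  show ?thesis
    using main[OF c w_def[symmetric]] main[OF c'] eq by (simp add: w_def)
qed


section \<open>Natural transformations\<close>

definition id_functor :: "('o, 'a) category \<Rightarrow> ('o, 'a, 'o, 'a) cat_functor" where
  "id_functor C = \<lparr>obj_map = restrict id (Obj C), arr_map = restrict id (Arr C)\<rparr>"

definition const_functor :: "('o, 'a) category \<Rightarrow> ('p, 'b) category \<Rightarrow> 'p \<Rightarrow> ('o, 'a, 'p, 'b) cat_functor" where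
  "const_functor C D d = \<lparr>obj_map = (\<lambda>_\<in>Obj C. d), arr_map = (\<lambda>_\<in>Arr C. Id D d)\<rparr>"

lemma is_functor_id: "is_category C \<Longrightarrow> is_functor C C (id_functor C)"
  by (auto simp: is_functor_def id_functor_def is_category_def)

lemma is_functor_const:
  assumes C: "is_category C" and D: "is_category D" and d: "d \<in> Obj D"
  shows "is_functor C D (const_functor C D d)"
proof -
  have I: "Id D d \<in> Arr D" "Dom D (Id D d) = d" "Cod D (Id D d) = d"
    using D d by (auto simp: is_category_def)
  moreover have "Comp D (Id D d) (Id D d) = Id D d"
    using D I by (auto simp: is_category_def)
  ultimately show ?thesis
    using C d by (auto simp: is_functor_def const_functor_def is_category_def)
qed

definition natural_transformation ::
    "('o, 'a) category \<Rightarrow> ('p, 'b) category \<Rightarrow> ('o, 'a, 'p, 'b) cat_functor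
      \<Rightarrow> ('o, 'a, 'p, 'b) cat_functor \<Rightarrow> ('o \<Rightarrow> 'b) \<Rightarrow> bool" where
  "natural_transformation C D F G \<alpha> \<longleftrightarrow>
     (\<forall>x\<in>Obj C. \<alpha> x \<in> Arr D \<and> Dom D (\<alpha> x) = obj_map F x \<and> Cod D (\<alpha> x) = obj_map G x) \<and>
     (\<forall>f\<in>Arr C. Comp D (\<alpha> (Cod C f)) (arr_map F f) = Comp D (arr_map G f) (\<alpha> (Dom C f)))"


section \<open>Cutting a simplex at height \<open>1 - s\<close>\<close>

text \<open>A point \<open>t\<close> of a simplex is thought of as the subdivision of \<open>[0, 1]\<close> into consecutive intervals of
  lengths \<open>t 0, t 1, \<dots>\<close>. Cutting the interval \<open>i\<close> at \<open>1 - s\<close> leaves \<open>cut_weight s t (i, 0)\<close> below and \<open>cut_weight s t (i, 1)\<close>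
  is_above: these are the coordinates of the point \<open>(t, s)\<close> of the prism.\<close>

definition partial_sum :: "(nat \<Rightarrow> real) \<Rightarrow> nat \<Rightarrow> real" where
  "partial_sum t p = (\<Sum>i<p. t i)"

definition cut_weight :: "real \<Rightarrow> (nat \<Rightarrow> real) \<Rightarrow> nat \<times> nat \<Rightarrow> real" where
  "cut_weight s t = (\<lambda>(i, b).
     if b = 0 then min (partial_sum t (Suc i)) (1 - s) - min (partial_sum t i) (1 - s)
     else if b = 1 then max (partial_sum t (Suc i)) (1 - s) - max (partial_sum t i) (1 - s)
     else 0)"

abbreviation prism_poset :: "nat \<Rightarrow> (nat \<times> nat) set" where
  "prism_poset n \<equiv> {..n} \<times> {..1}"

text \<open>The maximal chain (0, 0), ..., (k, 0), (k, 1), ..., (n, 1), that is, a top simplex of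
  the standard triangulation of the prism. The first coordinate \<open>k\<close> occurs twice
  because the interval \<open>k\<close> is the one being cut.\<close>

definition staircase :: "nat \<Rightarrow> nat \<Rightarrow> nat \<times> nat" where
  "staircase k j = (if j \<le> k then (j, 0) else (j - 1, 1))"

lemma partial_sum_0 [simp]: "partial_sum t 0 = 0"
  by (simp add: partial_sum_def)

lemma partial_sum_Suc [simp]: "partial_sum t (Suc i) = partial_sum t i + t i"
  by (simp add: partial_sum_def)

lemma partial_sum_mono:
  assumes "t \<in> standard_simplex n" "i \<le> j"
  shows "partial_sum t i \<le> partial_sum t j"
  using assms unfolding partial_sum_def by (intro sum_mono2) (auto simp: standard_simplex_def)

lemma partial_sum_total:
  assumes "t \<in> standard_simplex n"
  shows "partial_sum t (Suc n) = 1"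
  using assms unfolding partial_sum_def standard_simplex_def by (simp only: lessThan_Suc_atMost mem_Collect_eq)

lemma partial_sum_le_1:
  assumes t: "t \<in> standard_simplex n" shows "partial_sum t p \<le> 1"
proof (cases "p \<le> Suc n")
  case True
  then show ?thesis using partial_sum_mono[OF t True] partial_sum_total[OF t] by linarith
next
  case False
  have "partial_sum t (Suc n + q) = 1" for q
    using t partial_sum_total[OF t] by (induction q) (auto simp: standard_simplex_def)
  from this[of "p - Suc n"] False show ?thesis by simp
qed

lemma standard_simplexD:
  assumes "t \<in> standard_simplex n"
  shows "0 \<le> t i" "t i \<le> 1" "i > n \<Longrightarrow> t i = 0" "(\<Sum>i\<le>n. t i) = 1"
  using assms by (auto simp: standard_simplex_def)

lemma cut_nonneg:
  assumes "t \<in> standard_simplex n" shows "0 \<le> cut_weight s t p"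
proof (cases p)
  case (Pair i b)
  then show ?thesis using standard_simplexD(1)[OF assms, of i] by (auto simp: cut_weight_def min_def max_def)
qed

lemma staircase_chain: "k \<le> n \<Longrightarrow> staircase k \<in> poset_chains (prism_poset n) (Suc n)"
  by (auto simp: poset_chains_def staircase_def mono_on_def less_eq_prod_def)

text \<open>Both halves telescope: the pieces below the cut add up to \<open>1 - s\<close>, those
  above it to \<open>s\<close>.\<close>

lemma sum_cut_staircase:
  assumes t: "t \<in> standard_simplex n" and s: "s \<in> {0..1}" and k: "k \<le> n"
    and cut_weight: "partial_sum t k \<le> 1 - s" "1 - s \<le> partial_sum t (Suc k)"
  shows "(\<Sum>j\<le>Suc n. cut_weight s t (staircase k j)) = 1"
proof -
  have low: "(\<Sum>j<q. cut_weight s t (j, 0)) = min (partial_sum t q) (1 - s) - min 0 (1 - s)" for q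
    by (induction q) (simp_all add: cut_weight_def)
  have high: "(\<Sum>j<q. cut_weight s t (k + j, 1)) = max (partial_sum t (k + q)) (1 - s) - max (partial_sum t k) (1 - s)" for q
    by (induction q) (simp_all add: cut_weight_def)
  have "{..Suc n} = {..<Suc k} \<union> {Suc k..<Suc k + (Suc n - k)}"
    using k by auto
  then have "(\<Sum>j\<le>Suc n. cut_weight s t (staircase k j)) =
      (\<Sum>j<Suc k. cut_weight s t (staircase k j)) + (\<Sum>j=Suc k..<Suc k + (Suc n - k). cut_weight s t (staircase k j))"
    by (simp only:) (rule sum.union_disjoint, auto)
  also have "(\<Sum>j<Suc k. cut_weight s t (staircase k j)) = (\<Sum>j<Suc k. cut_weight s t (j, 0))"
    by (intro sum.cong) (auto simp: staircase_def)
  also have "(\<Sum>j=Suc k..<Suc k + (Suc n - k). cut_weight s t (staircase k j)) = (\<Sum>j<Suc n - k. cut_weight s t (k + j, 1))"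
    by (rule sum.reindex_bij_witness[of _ "\<lambda>j. Suc k + j" "\<lambda>j. j - Suc k"]) (auto simp: staircase_def)
  also have "(\<Sum>j<Suc k. cut_weight s t (j, 0)) = 1 - s"
    unfolding low using cut_weight s by simp
  also have "(\<Sum>j<Suc n - k. cut_weight s t (k + j, 1)) = s"
    unfolding high using k cut_weight s partial_sum_total[OF t] by (simp add: Suc_diff_le del: partial_sum_Suc)
  finally show ?thesis by simp
qed

lemma staircase_simplex:
  assumes t: "t \<in> standard_simplex n" and s: "s \<in> {0..1}" and k: "k \<le> n"
    and cut_weight: "partial_sum t k \<le> 1 - s" "1 - s \<le> partial_sum t (Suc k)"
  shows "(\<lambda>j. cut_weight s t (staircase k j)) \<in> standard_simplex (Suc n)"
proof -
  note sum1 = sum_cut_staircase[OF assms]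
  have zero: "cut_weight s t (staircase k j) = 0" if "j > Suc n" for j
  proof -
    have "t (j - 1) = 0" "staircase k j = (j - 1, 1)"
      using standard_simplexD(3)[OF t, of "j - 1"] that k by (auto simp: staircase_def)
    then show ?thesis by (simp add: cut_weight_def)
  qed
  have "cut_weight s t (staircase k j) \<le> 1" for j
  proof (cases "j \<le> Suc n")
    case True
    then show ?thesis unfolding sum1[symmetric] by (intro member_le_sum cut_nonneg[OF t]) auto
  qed (simp add: zero)
  then show ?thesis
    using sum1 zero cut_nonneg[OF t] by (simp only: standard_simplex_def mem_Collect_eq) blast
qed

text \<open>If the cut falls into the interval \<open>k\<close>, later intervals have no lower piece
  and earlier ones no upper piece, so the staircase at \<open>k\<close> carries the whole
  weight.\<close>

lemma push_weight_staircase: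
  assumes t: "t \<in> standard_simplex n" and s: "s \<in> {0..1}" and k: "k \<le> n"
    and cut_weight: "partial_sum t k \<le> 1 - s" "1 - s \<le> partial_sum t (Suc k)"
  shows "push_weight (Suc n) (staircase k) (\<lambda>j. cut_weight s t (staircase k j)) = cut_weight s t"
proof
  fix p :: "nat \<times> nat"
  let ?A = "{j. j \<le> Suc n \<and> staircase k j = p}"
  obtain i b where p: "p = (i, b)" by (cases p)
  consider "b = 0" "i \<le> k" | "b = 1" "k \<le> i" "i \<le> n" | "b = 0" "k < i" | "b = 1" "i < k" | "b = 1" "i > n" | "b > 1"
    by linarith
  then have "(\<exists>j. ?A = {j} \<and> staircase k j = p) \<or> ?A = {} \<and> cut_weight s t p = 0"
  proof cases
    case 1
    then have "?A = {i}" using k by (auto simp: p staircase_def)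
    then show ?thesis by blast
  next
    case 2
    then have "?A = {Suc i}" by (auto simp: p staircase_def)
    then show ?thesis by blast
  next
    case 3
    then have "?A = {}" by (auto simp: p staircase_def)
    moreover have "1 - s \<le> partial_sum t i"
      using cut_weight(2) partial_sum_mono[OF t, of "Suc k" i] 3 by linarith
    ultimately show ?thesis
      using 3 standard_simplexD(1)[OF t, of i] by (simp add: p cut_weight_def)
  next
    case 4
    then have "?A = {}" by (auto simp: p staircase_def)
    moreover have "partial_sum t (Suc i) \<le> 1 - s"
      using cut_weight(1) partial_sum_mono[OF t, of "Suc i" k] 4 by linarith
    ultimately show ?thesis
      using 4 standard_simplexD(1)[OF t, of i] by (simp add: p cut_weight_def)
  next
    case 5
    then have "?A = {}" by (auto simp: p staircase_def)
    then show ?thesis using 5 standard_simplexD(3)[OF t, of i] by (simp add: p cut_weight_def)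
  next
    case 6
    then have "?A = {}" by (auto simp: p staircase_def)
    then show ?thesis using 6 by (simp add: p cut_weight_def)
  qed
  then show "push_weight (Suc n) (staircase k) (\<lambda>j. cut_weight s t (staircase k j)) p = cut_weight s t p"
    unfolding push_weight_def by (elim disjE exE conjE) simp_all
qed

lemma staircase_exists:
  assumes t: "t \<in> standard_simplex n" and s: "s \<in> {0..1}"
  obtains k where "k \<le> n" "partial_sum t k \<le> 1 - s" "1 - s \<le> partial_sum t (Suc k)"
proof -
  let ?Q = "\<lambda>k. 1 - s \<le> partial_sum t (Suc k)"
  have n: "?Q n" using partial_sum_total[OF t] s by simp
  define k where "k = (LEAST k. ?Q k)"
  have "?Q k" "k \<le> n" unfolding k_def using n by (auto intro: LeastI Least_le)
  moreover have "partial_sum t k \<le> 1 - s"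
  proof (cases k)
    case 0
    then show ?thesis using s by simp
  next
    case (Suc l)
    then have "\<not> ?Q l" unfolding k_def using not_less_Least[of l ?Q] by simp
    then show ?thesis using Suc by simp
  qed
  ultimately show thesis using that by blast
qed

text \<open>The fibres of a monotone map are runs of consecutive indices, so pushing forward merges
  neighbouring intervals and the differences over a fibre telescope. The functions \<open>g\<close>
  that matter are the minimum and the maximum with \<open>1 - s\<close>, which define the two kinds
  of pieces.\<close>

lemma push_fibre_sum:
  assumes \<theta>: "\<theta> \<in> monotone_maps m n"
  shows "(\<Sum>i | i \<le> m \<and> \<theta> i = j. g (partial_sum t (Suc i)) - g (partial_sum t i)) =
    g (partial_sum (push m \<theta> t) (Suc j)) - (g (partial_sum (push m \<theta> t) j) :: real)"
proof -
  \<comment> \<open>\<open>q p\<close> is the length of the initial segment mapped below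
    \<open>p\<close>. The disjunct \<open>m < i\<close> gives it the value \<open>Suc m\<close> when
    all of \<open>{..m}\<close> is mapped below \<open>p\<close>.\<close>
  define q where "q p = (LEAST i. m < i \<or> p \<le> \<theta> i)" for p
  have q: "{i. i \<le> m \<and> \<theta> i < p} = {..<q p}" for p
  proof (intro equalityI subsetI)
    fix i assume i: "i \<in> {i. i \<le> m \<and> \<theta> i < p}"
    have ex: "m < q p \<or> p \<le> \<theta> (q p)"
      unfolding q_def by (rule LeastI[of _ "Suc m"]) simp
    show "i \<in> {..<q p}"
    proof (rule ccontr)
      assume "i \<notin> {..<q p}"
      then have "q p \<le> i" by simp
      then have "\<theta> (q p) \<le> \<theta> i" "q p \<le> m"
        using \<theta> i by (auto simp: monotone_maps_def mono_on_def)
      with ex i show False by simp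
    qed
  next
    fix i assume "i \<in> {..<q p}"
    then have "\<not> (m < i \<or> p \<le> \<theta> i)"
      unfolding q_def using not_less_Least by blast
    then show "i \<in> {i. i \<le> m \<and> \<theta> i < p}" by auto
  qed
  have ps: "partial_sum (push m \<theta> t) p = partial_sum t (q p)" for p
  proof -
    have "partial_sum (push m \<theta> t) p = (\<Sum>j<p. \<Sum>i | i \<in> {i. i \<le> m \<and> \<theta> i < p} \<and> \<theta> i = j. t i)"
      unfolding partial_sum_def push_def by (intro sum.cong) auto
    also have "\<dots> = (\<Sum>i | i \<le> m \<and> \<theta> i < p. t i)"
      by (rule sum.group) auto
    finally show ?thesis unfolding q partial_sum_def .
  qed
  have tel: "(\<Sum>i<r. g (partial_sum t (Suc i)) - g (partial_sum t i)) = g (partial_sum t r) - g 0" for r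
    by (induction r) simp_all
  have "{..<q (Suc j)} = {..<q j} \<union> {i. i \<le> m \<and> \<theta> i = j}"
    unfolding q[symmetric] by auto
  moreover have "{..<q j} \<inter> {i. i \<le> m \<and> \<theta> i = j} = {}"
    unfolding q[symmetric] by auto
  ultimately have "(\<Sum>i<q (Suc j). g (partial_sum t (Suc i)) - g (partial_sum t i)) =
      (\<Sum>i<q j. g (partial_sum t (Suc i)) - g (partial_sum t i)) +
      (\<Sum>i | i \<le> m \<and> \<theta> i = j. g (partial_sum t (Suc i)) - g (partial_sum t i))"
    by (simp only:) (rule sum.union_disjoint, auto)
  then show ?thesis
    unfolding tel ps by simp
qed

text \<open>Cutting at a fixed height commutes with merging intervals. This is the compatibility of
  the homotopy with gluing, expressed by weights.\<close>

lemma push_weight_cut_push: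
  assumes \<theta>: "\<theta> \<in> monotone_maps m n" and c: "c \<in> poset_chains (prism_poset m) l"
    and eq: "push_weight l c v = cut_weight s t"
  shows "push_weight l (apfst \<theta> \<circ> c) v = cut_weight s (push m \<theta> t)"
proof
  fix p :: "nat \<times> nat"
  obtain j b where p: "p = (j, b)" by (cases p)
  let ?B = "{q \<in> prism_poset m. apfst \<theta> q = p}"
  have "push_weight l (apfst \<theta> \<circ> c) v p = (\<Sum>q\<in>?B. \<Sum>i | i \<in> {i. i \<le> l \<and> apfst \<theta> (c i) = p} \<and> c i = q. v i)"
    unfolding push_weight_def comp_apply
  proof (rule sum.group[symmetric])
    show "c ` {i. i \<le> l \<and> apfst \<theta> (c i) = p} \<subseteq> ?B"
      using c unfolding poset_chains_def by blast
  qed simp_all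
  also have "\<dots> = (\<Sum>q\<in>?B. push_weight l c v q)"
    unfolding push_weight_def by (intro sum.cong) auto
  also have "\<dots> = (\<Sum>q\<in>?B. cut_weight s t q)"
    by (simp add: eq)
  also have "\<dots> = cut_weight s (push m \<theta> t) p"
  proof (cases "b \<le> 1")
    case True
    have "?B = (\<lambda>i. (i, b)) ` {i. i \<le> m \<and> \<theta> i = j}"
      using True by (auto simp: p)
    then have "(\<Sum>q\<in>?B. cut_weight s t q) = (\<Sum>i | i \<le> m \<and> \<theta> i = j. cut_weight s t (i, b))"
      by (simp add: sum.reindex inj_on_def)
    also have "\<dots> = cut_weight s (push m \<theta> t) (j, b)"
      using True push_fibre_sum[OF \<theta>, of "\<lambda>u. min u (1 - s)" t j] push_fibre_sum[OF \<theta>, of "\<lambda>u. max u (1 - s)" t j]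
      by (cases "b = 0") (simp_all add: cut_weight_def del: partial_sum_Suc)
    finally show ?thesis by (simp add: p)
  next
    case False
    then have "?B = {}" by (auto simp: p)
    then show ?thesis using False by (simp only: sum.empty p cut_weight_def) simp
  qed
  finally show "push_weight l (apfst \<theta> \<circ> c) v p = cut_weight s (push m \<theta> t) p" .
qed

text \<open>At time 0 the cut is at height 1 and everything lies below it; in
  \<open>push_weight_top\<close> the cut is at height 0 and everything lies above.\<close>

lemma push_weight_bottom:
  assumes t: "t \<in> standard_simplex n"
  shows "push_weight n (\<lambda>i. (i, 0)) t = cut_weight 0 t"
proof
  fix p :: "nat \<times> nat"
  obtain i b where p: "p = (i, b)" by (cases p)
  have "{j. j \<le> n \<and> (j, 0) = p} = (if b = 0 \<and> i \<le> n then {i} else {})" by (auto simp: p)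
  then show "push_weight n (\<lambda>i. (i, 0)) t p = cut_weight 0 t p"
    using partial_sum_le_1[OF t, of i] partial_sum_le_1[OF t, of "Suc i"] standard_simplexD(3)[OF t, of i]
    by (auto simp: push_weight_def cut_weight_def p min_def max_def)
qed

lemma push_weight_top:
  assumes t: "t \<in> standard_simplex n"
  shows "push_weight n (\<lambda>i. (i, 1)) t = cut_weight 1 t"
proof
  fix p :: "nat \<times> nat"
  obtain i b where p: "p = (i, b)" by (cases p)
  have "{j. j \<le> n \<and> (j, 1) = p} = (if b = 1 \<and> i \<le> n then {i} else {})" by (auto simp: p)
  moreover have "0 \<le> partial_sum t i" using partial_sum_mono[OF t, of 0 i] by simp
  ultimately show "push_weight n (\<lambda>i. (i, 1)) t p = cut_weight 1 t p"
    using standard_simplexD(1,3)[OF t, of i]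
    by (auto simp: push_weight_def cut_weight_def p min_def max_def)
qed


section \<open>Natural transformations induce homotopies\<close>

text \<open>\<open>cylinder C D F G \<alpha>\<close> is the functor from the product of \<open>C\<close> with \<open>0 \<le> 1\<close> to \<open>D\<close> given by \<open>\<alpha>\<close>, on
  the pair of an arrow \<open>f\<close> of \<open>C\<close> and \<open>b \<le> b'\<close>.\<close>

definition cylinder where
  "cylinder C D F G \<alpha> b b' f =
     (if b' = (0::nat) then arr_map F f
      else if b = (0::nat) then Comp D (\<alpha> (Cod C f)) (arr_map F f) else arr_map G f)"

text \<open>The composite of the chain \<open>c\<close>, the product of \<open>x\<close> with the
  identity of 0 \<le> 1, and the functor \<open>cylinder\<close>.\<close>

definition prism where
  "prism C D F G \<alpha> x m c =
     \<lparr>obj_map = (\<lambda>j\<in>{..m}. obj_map (if snd (c j) = 0 then F else G) (obj_map x (fst (c j)))),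
      arr_map = (\<lambda>(i, j)\<in>Arr (ordinal m).
        cylinder C D F G \<alpha> (snd (c i)) (snd (c j)) (arr_map x (fst (c i), fst (c j))))\<rparr>"

lemma ordinal_simps [simp]:
  "Obj (ordinal n) = {..n}" "(i, j) \<in> Arr (ordinal n) \<longleftrightarrow> i \<le> j \<and> j \<le> n"
  "Dom (ordinal n) = fst" "Cod (ordinal n) = snd" "Id (ordinal n) i = (i, i)"
  "Comp (ordinal n) g f = (fst f, snd g)"
  by (simp_all add: ordinal_def)

lemma ordinal_functorD:
  assumes "is_functor (ordinal n) C x"
  shows "i \<le> n \<Longrightarrow> obj_map x i \<in> Obj C"
    and "\<lbrakk>i \<le> j; j \<le> n\<rbrakk> \<Longrightarrow> arr_map x (i, j) \<in> Arr C"
    and "\<lbrakk>i \<le> j; j \<le> n\<rbrakk> \<Longrightarrow> Dom C (arr_map x (i, j)) = obj_map x i"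
    and "\<lbrakk>i \<le> j; j \<le> n\<rbrakk> \<Longrightarrow> Cod C (arr_map x (i, j)) = obj_map x j"
    and "i \<le> n \<Longrightarrow> arr_map x (i, i) = Id C (obj_map x i)"
    and "\<lbrakk>i \<le> j; j \<le> k; k \<le> n\<rbrakk> \<Longrightarrow> arr_map x (i, k) = Comp C (arr_map x (j, k)) (arr_map x (i, j))"
proof -
  note x = assms[unfolded is_functor_def]
  have o: "obj_map x \<in> {..n} \<rightarrow>\<^sub>E Obj C" and a: "arr_map x \<in> Arr (ordinal n) \<rightarrow>\<^sub>E Arr C"
    and dc: "\<And>f. f \<in> Arr (ordinal n) \<Longrightarrow> Dom C (arr_map x f) = obj_map x (fst f) \<and> Cod C (arr_map x f) = obj_map x (snd f)"
    and idc: "\<And>i. i \<in> {..n} \<Longrightarrow> arr_map x (i, i) = Id C (obj_map x i)"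
    and cc: "\<And>f g. \<lbrakk>f \<in> Arr (ordinal n); g \<in> Arr (ordinal n); fst g = snd f\<rbrakk> \<Longrightarrow>
      arr_map x (fst f, snd g) = Comp C (arr_map x g) (arr_map x f)"
    using x by simp_all
  show "i \<le> n \<Longrightarrow> obj_map x i \<in> Obj C" using o by auto
  show "i \<le> j \<Longrightarrow> j \<le> n \<Longrightarrow> arr_map x (i, j) \<in> Arr C"
    by (rule PiE_mem[OF a]) simp
  show "i \<le> j \<Longrightarrow> j \<le> n \<Longrightarrow> Dom C (arr_map x (i, j)) = obj_map x i"
    "i \<le> j \<Longrightarrow> j \<le> n \<Longrightarrow> Cod C (arr_map x (i, j)) = obj_map x j"
    using dc[of "(i, j)"] by simp_all
  show "i \<le> n \<Longrightarrow> arr_map x (i, i) = Id C (obj_map x i)" using idc by simp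
  show "\<lbrakk>i \<le> j; j \<le> k; k \<le> n\<rbrakk> \<Longrightarrow> arr_map x (i, k) = Comp C (arr_map x (j, k)) (arr_map x (i, j))"
    using cc[of "(i, j)" "(j, k)"] by simp
qed

lemma is_functor_ordinalI:
  assumes "x = \<lparr>obj_map = restrict o' {..n}, arr_map = restrict a (Arr (ordinal n))\<rparr>"
    and "\<And>i. i \<le> n \<Longrightarrow> o' i \<in> Obj C"
    and "\<And>i j. \<lbrakk>i \<le> j; j \<le> n\<rbrakk> \<Longrightarrow> a (i, j) \<in> Arr C \<and> Dom C (a (i, j)) = o' i \<and> Cod C (a (i, j)) = o' j"
    and "\<And>i. i \<le> n \<Longrightarrow> a (i, i) = Id C (o' i)"
    and "\<And>i j k. \<lbrakk>i \<le> j; j \<le> k; k \<le> n\<rbrakk> \<Longrightarrow> a (i, k) = Comp C (a (j, k)) (a (i, j))"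
  shows "is_functor (ordinal n) C x"
  unfolding is_functor_def
proof (intro conjI ballI impI)
  show "obj_map x \<in> Obj (ordinal n) \<rightarrow>\<^sub>E Obj C" using assms(1,2) by simp
  show "arr_map x \<in> Arr (ordinal n) \<rightarrow>\<^sub>E Arr C"
  proof (intro PiE_I)
    fix p assume p: "p \<in> Arr (ordinal n)"
    obtain i j where "p = (i, j)" by (cases p)
    with p assms(3)[of i j] show "arr_map x p \<in> Arr C" by (simp add: assms(1))
  qed (simp add: assms(1))
next
  fix f assume f: "f \<in> Arr (ordinal n)"
  obtain i j where [simp]: "f = (i, j)" by (cases f)
  from f have "i \<le> j" "j \<le> n" by simp_all
  then show "Dom C (arr_map x f) = obj_map x (Dom (ordinal n) f)" "Cod C (arr_map x f) = obj_map x (Cod (ordinal n) f)"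
    using assms(1,3) by simp_all
next
  fix i assume "i \<in> Obj (ordinal n)"
  then show "arr_map x (Id (ordinal n) i) = Id C (obj_map x i)"
    using assms(1,4) by simp
next
  fix f g assume fg: "f \<in> Arr (ordinal n)" "g \<in> Arr (ordinal n)" "Dom (ordinal n) g = Cod (ordinal n) f"
  obtain i j k where [simp]: "f = (i, j)" "g = (j, k)" using fg(3) by (cases f; cases g) auto
  from fg have "i \<le> j" "j \<le> k" "k \<le> n" by simp_all
  then show "arr_map x (Comp (ordinal n) g f) = Comp C (arr_map x g) (arr_map x f)"
    using assms(5)[of i j k] by (simp add: assms(1))
qed

lemma chain_memD:
  assumes "c \<in> poset_chains (prism_poset n) m" "i \<le> j" "j \<le> m"
  shows "fst (c i) \<le> fst (c j)" "fst (c j) \<le> n" "snd (c i) \<le> snd (c j)" "snd (c j) \<le> 1"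
proof -
  have "c i \<le> c j" using assms by (auto simp: poset_chains_def mono_on_def)
  moreover have "c j \<in> prism_poset n" using assms by (auto simp: poset_chains_def)
  ultimately show "fst (c i) \<le> fst (c j)" "fst (c j) \<le> n" "snd (c i) \<le> snd (c j)" "snd (c j) \<le> 1"
    by (auto simp: less_eq_prod_def mem_Times_iff)
qed

lemma nerve_simps [simp]:
  "x \<in> simplices (nerve C) n \<longleftrightarrow> is_functor (ordinal n) C x"
  "pull (nerve C) m n \<theta> x = functor_comp (ordinal m) x (ordinal_map m \<theta>)"
  by (simp_all add: nerve_def)

locale natural_homotopy =
  fixes C :: "('o, 'a) category" and D :: "('p, 'b) category" and F G \<alpha>
  assumes catC: "is_category C" and catD: "is_category D"
    and F: "is_functor C D F" and G: "is_functor C D G"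
    and \<alpha>: "natural_transformation C D F G \<alpha>"
begin

section \<open>Functoriality of the cylinder and simplices of the prism\<close>

abbreviation "cyl \<equiv> cylinder C D F G \<alpha>"
abbreviation "pr \<equiv> prism C D F G \<alpha>"

lemma C_arr: "f \<in> Arr C \<Longrightarrow> Dom C f \<in> Obj C \<and> Cod C f \<in> Obj C"
  and C_comp: "\<lbrakk>f \<in> Arr C; g \<in> Arr C; Dom C g = Cod C f\<rbrakk> \<Longrightarrow>
    Comp C g f \<in> Arr C \<and> Dom C (Comp C g f) = Dom C f \<and> Cod C (Comp C g f) = Cod C g"
  using catC by (auto simp: is_category_def)

lemma D_comp: "\<lbrakk>f \<in> Arr D; g \<in> Arr D; Dom D g = Cod D f\<rbrakk> \<Longrightarrow>
    Comp D g f \<in> Arr D \<and> Dom D (Comp D g f) = Dom D f \<and> Cod D (Comp D g f) = Cod D g"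
  and D_assoc: "\<lbrakk>f \<in> Arr D; g \<in> Arr D; h \<in> Arr D; Dom D g = Cod D f; Dom D h = Cod D g\<rbrakk> \<Longrightarrow>
    Comp D h (Comp D g f) = Comp D (Comp D h g) f"
  using catD unfolding is_category_def by blast+

lemma functor_arr:
  assumes "H \<in> {F, G}" "f \<in> Arr C"
  shows "arr_map H f \<in> Arr D" "Dom D (arr_map H f) = obj_map H (Dom C f)"
    "Cod D (arr_map H f) = obj_map H (Cod C f)"
proof -
  have "is_functor C D H" using assms(1) F G by auto
  then have "arr_map H \<in> Arr C \<rightarrow>\<^sub>E Arr D"
    "Dom D (arr_map H f) = obj_map H (Dom C f)" "Cod D (arr_map H f) = obj_map H (Cod C f)"
    using assms(2) unfolding is_functor_def by blast+
  then show "arr_map H f \<in> Arr D" "Dom D (arr_map H f) = obj_map H (Dom C f)"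
    "Cod D (arr_map H f) = obj_map H (Cod C f)"
    using assms(2) by auto
qed

lemma functor_comp_id:
  assumes "H \<in> {F, G}"
  shows "x \<in> Obj C \<Longrightarrow> obj_map H x \<in> Obj D"
    and "x \<in> Obj C \<Longrightarrow> arr_map H (Id C x) = Id D (obj_map H x)"
    and "\<lbrakk>f \<in> Arr C; g \<in> Arr C; Dom C g = Cod C f\<rbrakk> \<Longrightarrow>
      arr_map H (Comp C g f) = Comp D (arr_map H g) (arr_map H f)"
  using assms F G unfolding is_functor_def by auto

lemma \<alpha>_arr: "x \<in> Obj C \<Longrightarrow> \<alpha> x \<in> Arr D \<and> Dom D (\<alpha> x) = obj_map F x \<and> Cod D (\<alpha> x) = obj_map G x"
  and \<alpha>_nat: "f \<in> Arr C \<Longrightarrow> Comp D (\<alpha> (Cod C f)) (arr_map F f) = Comp D (arr_map G f) (\<alpha> (Dom C f))"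
  using \<alpha> by (auto simp: natural_transformation_def)

lemma cyl_arr:
  assumes f: "f \<in> Arr C" and "b \<le> b'"
  shows "cyl b b' f \<in> Arr D" "Dom D (cyl b b' f) = obj_map (if b = 0 then F else G) (Dom C f)"
    "Cod D (cyl b b' f) = obj_map (if b' = 0 then F else G) (Cod C f)"
  using assms functor_arr[OF _ f] \<alpha>_arr[of "Cod C f"] C_arr[OF f] D_comp[of "arr_map F f" "\<alpha> (Cod C f)"]
  by (auto simp: cylinder_def)

lemma cyl_comp:
  assumes f: "f \<in> Arr C" and g: "g \<in> Arr C" and fg: "Dom C g = Cod C f" and b: "b \<le> b'" "b' \<le> b''"
  shows "cyl b b'' (Comp C g f) = Comp D (cyl b' b'' g) (cyl b b' f)"
proof -
  note a = functor_arr[OF _ f] functor_arr[OF _ g] \<alpha>_arr[OF conjunct2[OF C_arr[OF f]]] \<alpha>_arr[OF conjunct2[OF C_arr[OF g]]]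
  consider "b'' = 0" "b' = 0" "b = 0" | "b'' > 0" "b' = 0" "b = 0" | "b'' > 0" "b' > 0" "b = 0" | "b'' > 0" "b' > 0" "b > 0"
    using b by linarith
  then show ?thesis
  proof cases
    case 1
    then show ?thesis using functor_comp_id(3)[OF _ f g fg, of F] by (simp add: cylinder_def)
  next
    case 2
    have "Comp D (\<alpha> (Cod C g)) (Comp D (arr_map F g) (arr_map F f)) = Comp D (Comp D (\<alpha> (Cod C g)) (arr_map F g)) (arr_map F f)"
      using a fg by (intro D_assoc) auto
    with 2 show ?thesis using functor_comp_id(3)[OF _ f g fg, of F] C_comp[OF f g fg] by (simp add: cylinder_def)
  next
    \<comment> \<open>Only here is naturality needed: the passage from \<open>F\<close> to
      \<open>G\<close> takes place along \<open>f\<close>, so \<open>\<alpha>\<close> has to be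
      moved past \<open>g\<close>.\<close>
    case 3
    have "Comp D (\<alpha> (Cod C g)) (Comp D (arr_map F g) (arr_map F f)) = Comp D (Comp D (\<alpha> (Cod C g)) (arr_map F g)) (arr_map F f)"
      using a fg by (intro D_assoc) auto
    also have "\<dots> = Comp D (Comp D (arr_map G g) (\<alpha> (Cod C f))) (arr_map F f)"
      using \<alpha>_nat[OF g] fg by simp
    also have "\<dots> = Comp D (arr_map G g) (Comp D (\<alpha> (Cod C f)) (arr_map F f))"
      using a fg by (intro D_assoc[symmetric]) auto
    finally show ?thesis using 3 functor_comp_id(3)[OF _ f g fg, of F] C_comp[OF f g fg] by (simp add: cylinder_def)
  next
    case 4
    then show ?thesis using functor_comp_id(3)[OF _ f g fg, of G] by (simp add: cylinder_def)
  qed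
qed

lemma prism_simplex:
  assumes x: "is_functor (ordinal n) C x" and c: "c \<in> poset_chains (prism_poset n) m"
  shows "is_functor (ordinal m) D (pr x m c)"
proof (rule is_functor_ordinalI)
  show "pr x m c = \<lparr>obj_map = (\<lambda>j\<in>{..m}. obj_map (if snd (c j) = 0 then F else G) (obj_map x (fst (c j)))),
      arr_map = (\<lambda>p\<in>Arr (ordinal m). cyl (snd (c (fst p))) (snd (c (snd p))) (arr_map x (fst (c (fst p)), fst (c (snd p)))))\<rparr>"
    by (simp add: prism_def split_beta')
next
  fix i assume "i \<le> m"
  then show "obj_map (if snd (c i) = 0 then F else G) (obj_map x (fst (c i))) \<in> Obj D"
    using chain_memD(2)[OF c, of i i] by (intro functor_comp_id(1) ordinal_functorD(1)[OF x]) auto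
next
  fix i j assume ij: "i \<le> j" "j \<le> m"
  note cm = chain_memD[OF c ij]
  show "cyl (snd (c (fst (i, j)))) (snd (c (snd (i, j)))) (arr_map x (fst (c (fst (i, j))), fst (c (snd (i, j))))) \<in> Arr D \<and>
    Dom D (cyl (snd (c (fst (i, j)))) (snd (c (snd (i, j)))) (arr_map x (fst (c (fst (i, j))), fst (c (snd (i, j))))))
      = obj_map (if snd (c i) = 0 then F else G) (obj_map x (fst (c i))) \<and>
    Cod D (cyl (snd (c (fst (i, j)))) (snd (c (snd (i, j)))) (arr_map x (fst (c (fst (i, j))), fst (c (snd (i, j))))))
      = obj_map (if snd (c j) = 0 then F else G) (obj_map x (fst (c j)))"
    using cyl_arr[OF ordinal_functorD(2)[OF x cm(1,2)] cm(3)] ordinal_functorD(3,4)[OF x cm(1,2)] by simp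
next
  fix i assume i: "i \<le> m"
  have o: "obj_map x (fst (c i)) \<in> Obj C"
    using chain_memD(2)[OF c _ i, of i] by (intro ordinal_functorD(1)[OF x]) simp
  have "arr_map x (fst (c i), fst (c i)) = Id C (obj_map x (fst (c i)))"
    using chain_memD(2)[OF c _ i, of i] by (intro ordinal_functorD(5)[OF x]) simp
  then show "cyl (snd (c (fst (i, i)))) (snd (c (snd (i, i)))) (arr_map x (fst (c (fst (i, i))), fst (c (snd (i, i)))))
      = Id D (obj_map (if snd (c i) = 0 then F else G) (obj_map x (fst (c i))))"
    using functor_comp_id(2)[OF _ o] by (simp add: cylinder_def)
next
  fix i j k assume ij: "i \<le> j" and jk: "j \<le> k" "k \<le> m"
  note cm = chain_memD[OF c ij order_trans[OF jk]] chain_memD[OF c jk]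
  show "cyl (snd (c (fst (i, k)))) (snd (c (snd (i, k)))) (arr_map x (fst (c (fst (i, k))), fst (c (snd (i, k))))) =
      Comp D (cyl (snd (c (fst (j, k)))) (snd (c (snd (j, k)))) (arr_map x (fst (c (fst (j, k))), fst (c (snd (j, k))))))
        (cyl (snd (c (fst (i, j)))) (snd (c (snd (i, j)))) (arr_map x (fst (c (fst (i, j))), fst (c (snd (i, j))))))"
    using cyl_comp[OF ordinal_functorD(2)[OF x cm(1,2)] ordinal_functorD(2)[OF x cm(5,6)] _ cm(3,7)]
      ordinal_functorD(3)[OF x cm(5,6)] ordinal_functorD(4)[OF x cm(1,2)] ordinal_functorD(6)[OF x cm(1,5,6)]
    by simp
qed

lemma prism_cong:
  assumes "\<And>i. i \<le> m \<Longrightarrow> c i = c' i"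
  shows "pr x m c = pr x m c'"
  using assms by (auto simp: prism_def fun_eq_iff restrict_def)

lemma prism_pull:
  assumes "\<theta> \<in> monotone_maps l m"
  shows "functor_comp (ordinal l) (pr x m c) (ordinal_map l \<theta>) = pr x l (c \<circ> \<theta>)"
proof -
  have "\<theta> i \<le> m" if "i \<le> l" for i
    using assms that by (auto simp: monotone_maps_def)
  moreover have "\<theta> i \<le> \<theta> j" if "i \<le> j" "j \<le> l" for i j
    using assms that by (auto simp: monotone_maps_def mono_on_def)
  ultimately show ?thesis
    by (simp add: functor_comp_def prism_def ordinal_map_def compose_def fun_eq_iff restrict_def split: prod.split)
qed

text \<open>A simplicial operator on \<open>x\<close> can be absorbed into the first coordinate of
  the chain, so that two glued points are represented by prisms over the same simplex
  \<open>x\<close>.\<close>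

lemma prism_of_pull:
  assumes "\<theta> \<in> monotone_maps l n" and c: "c \<in> poset_chains (prism_poset l) m"
  shows "pr (functor_comp (ordinal l) x (ordinal_map l \<theta>)) m c = pr x m (apfst \<theta> \<circ> c)"
proof -
  have "\<theta> i \<le> n" if "i \<le> l" for i
    using assms that by (auto simp: monotone_maps_def)
  moreover have "\<theta> i \<le> \<theta> j" if "i \<le> j" "j \<le> l" for i j
    using assms that by (auto simp: monotone_maps_def mono_on_def)
  moreover have "fst (c i) \<le> l" if "i \<le> m" for i
    using chain_memD(2)[OF c order_refl that] .
  ultimately show ?thesis
    using chain_memD(1)[OF c]
    by (simp add: functor_comp_def prism_def ordinal_map_def compose_def fun_eq_iff restrict_def split: prod.split)
qed

lemma prism_bottom: "is_functor (ordinal n) C x \<Longrightarrow> pr x n (\<lambda>i. (i, 0)) = nerve_map F n x"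
  and prism_top: "is_functor (ordinal n) C x \<Longrightarrow> pr x n (\<lambda>i. (i, 1)) = nerve_map G n x"
  by (auto simp: prism_def nerve_map_def functor_comp_def compose_def cylinder_def fun_eq_iff restrict_def)

lemma apfst_chain:
  assumes \<theta>: "\<theta> \<in> monotone_maps l n" and c: "c \<in> poset_chains (prism_poset l) m"
  shows "apfst \<theta> \<circ> c \<in> poset_chains (prism_poset n) m"
proof -
  have "apfst \<theta> (c i) \<le> apfst \<theta> (c j) \<and> apfst \<theta> (c j) \<in> prism_poset n" if "i \<le> j" "j \<le> m" for i j
    using chain_memD[OF c that] \<theta>
    by (auto simp: monotone_maps_def mono_on_def less_eq_prod_def mem_Times_iff)
  then show ?thesis unfolding poset_chains_def mono_on_def by (simp add: Pi_iff) blast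
qed

text \<open>By \<open>glue_class_push_weight\<close> there is exactly one candidate for the choice.\<close>

definition homotopy_point :: "real \<Rightarrow> nat \<times> (nat, nat \<times> nat, 'o, 'a) cat_functor \<times> (nat \<Rightarrow> real)
    \<Rightarrow> (nat \<times> (nat, nat \<times> nat, 'p, 'b) cat_functor \<times> (nat \<Rightarrow> real)) set" where
  "homotopy_point s = (\<lambda>(n, x, t). SOME z. \<exists>m c v.
     c \<in> poset_chains (prism_poset n) m \<and> v \<in> standard_simplex m \<and> push_weight m c v = cut_weight s t \<and>
     z = glue_class (nerve D) (m, pr x m c, v))"

lemma homotopy_point_eq:
  assumes x: "is_functor (ordinal n) C x" and c: "c \<in> poset_chains (prism_poset n) m"
    and v: "v \<in> standard_simplex m" and eq: "push_weight m c v = cut_weight s t"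
  shows "homotopy_point s (n, x, t) = glue_class (nerve D) (m, pr x m c, v)"
proof -
  let ?P = "\<lambda>z. \<exists>m c v. c \<in> poset_chains (prism_poset n) m \<and> v \<in> standard_simplex m \<and> push_weight m c v = cut_weight s t \<and>
     z = glue_class (nerve D) (m, pr x m c, v)"
  have "z = glue_class (nerve D) (m, pr x m c, v)" if z: "?P z" for z
  proof -
    obtain m' c' v' where *: "c' \<in> poset_chains (prism_poset n) m'" "v' \<in> standard_simplex m'"
      "push_weight m' c' v' = cut_weight s t" "z = glue_class (nerve D) (m', pr x m' c', v')"
      using z by blast
    have "glue_class (nerve D) (m', pr x m' c', v') = glue_class (nerve D) (m, pr x m c, v)"
    proof (rule glue_class_push_weight[where S = "pr x" and P = "prism_poset n"])
      show "pr x m c \<in> simplices (nerve D) m" if "c \<in> poset_chains (prism_poset n) m" for m c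
        using prism_simplex[OF x that] by simp
      show "pull (nerve D) l m \<theta> (pr x m c) = pr x l (c \<circ> \<theta>)" if "\<theta> \<in> monotone_maps l m" for l m \<theta> c
        using prism_pull[OF that] by simp
      show "pr x m c = pr x m c'" if "\<And>i. i \<le> m \<Longrightarrow> c i = c' i" for m c c'
        by (rule prism_cong[OF that])
      show "push_weight m' c' v' = push_weight m c v" using *(3) eq by simp
    qed fact+
    then show ?thesis using *(4) by simp
  qed
  moreover have "?P (glue_class (nerve D) (m, pr x m c, v))" using c v eq by blast
  ultimately show ?thesis
    unfolding homotopy_point_def prod.case by (rule some_equality[rotated])
qed

section \<open>Gluing, ends and continuity of the homotopy\<close>

lemma homotopy_point_staircase:
  assumes x: "is_functor (ordinal n) C x" and t: "t \<in> standard_simplex n" and s: "s \<in> {0..1}"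
    and k: "k \<le> n" "partial_sum t k \<le> 1 - s" "1 - s \<le> partial_sum t (Suc k)"
  shows "homotopy_point s (n, x, t) =
    glue_class (nerve D) (Suc n, pr x (Suc n) (staircase k), \<lambda>j. cut_weight s t (staircase k j))"
  by (rule homotopy_point_eq[OF x staircase_chain[OF k(1)] staircase_simplex[OF t s k] push_weight_staircase[OF t s k]])

text \<open>One staircase with one set of weights represents both points. Its image under
  \<open>apfst \<theta>\<close> need not be a staircase any more, which is why
  \<open>homotopy_point\<close> admits arbitrary chains.\<close>

lemma homotopy_point_glue:
  assumes s: "s \<in> {0..1}" and pq: "(p, q) \<in> glue (nerve C)"
  shows "homotopy_point s p = homotopy_point s q"
proof -
  obtain m n \<theta> x t where p: "p = (m, functor_comp (ordinal m) x (ordinal_map m \<theta>), t)" "q = (n, x, push m \<theta> t)"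
    and \<theta>: "\<theta> \<in> monotone_maps m n" and x: "is_functor (ordinal n) C x" and t: "t \<in> standard_simplex m"
    using pq unfolding glue_def nerve_simps by blast
  have x': "is_functor (ordinal m) C (functor_comp (ordinal m) x (ordinal_map m \<theta>))"
  proof -
    have "\<forall>m n. \<forall>\<theta>\<in>monotone_maps m n. \<forall>x\<in>simplices (nerve C) n. pull (nerve C) m n \<theta> x \<in> simplices (nerve C) m"
      using is_sset_nerve[of C] unfolding is_sset_def by (rule conjunct1)
    then show ?thesis using \<theta> x by simp
  qed
  obtain k where k: "k \<le> m" "partial_sum t k \<le> 1 - s" "1 - s \<le> partial_sum t (Suc k)"
    by (rule staircase_exists[OF t s])
  note c = staircase_chain[OF k(1)] and v = staircase_simplex[OF t s k] and w = push_weight_staircase[OF t s k]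
  have "homotopy_point s q = glue_class (nerve D) (Suc m, pr x (Suc m) (apfst \<theta> \<circ> staircase k), \<lambda>j. cut_weight s t (staircase k j))"
    unfolding p by (rule homotopy_point_eq[OF x apfst_chain[OF \<theta> c] v push_weight_cut_push[OF \<theta> c w]])
  then show ?thesis
    unfolding p homotopy_point_staircase[OF x' t s k] prism_of_pull[OF \<theta> c] by simp
qed

lemma homotopy_point_bottom:
  assumes x: "is_functor (ordinal n) C x" and t: "t \<in> standard_simplex n"
  shows "homotopy_point 0 (n, x, t) = glue_class (nerve D) (n, nerve_map F n x, t)"
proof -
  have "(\<lambda>i. (i, 0)) \<in> poset_chains (prism_poset n) n"
    by (auto simp: poset_chains_def mono_on_def)
  from homotopy_point_eq[OF x this t push_weight_bottom[OF t]] show ?thesis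
    by (simp add: prism_bottom[OF x])
qed

lemma homotopy_point_top:
  assumes x: "is_functor (ordinal n) C x" and t: "t \<in> standard_simplex n"
  shows "homotopy_point 1 (n, x, t) = glue_class (nerve D) (n, nerve_map G n x, t)"
proof -
  have "(\<lambda>i. (i, 1)) \<in> poset_chains (prism_poset n) n"
    by (auto simp: poset_chains_def mono_on_def)
  from homotopy_point_eq[OF x this t push_weight_top[OF t]] show ?thesis
    unfolding prism_top[OF x] .
qed

text \<open>Where the cut falls into the interval \<open>k\<close>, the point stays in one simplex
  and its coordinates are continuous. These closed regions, one for each \<open>k \<le> n\<close>,
  cover the product; the formulas agree on overlaps because each of them equals
  \<open>homotopy_point\<close>.\<close>

lemma continuous_map_homotopy_point:
  assumes x: "is_functor (ordinal n) C x"
  shows "continuous_map (prod_topology (top_of_set {0..1::real}) (simplex_space n)) (realization (nerve D))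
    (\<lambda>(s, t). homotopy_point s (n, x, t))"
proof -
  let ?T = "prod_topology (top_of_set {0..1::real}) (simplex_space n)"
  \<comment> \<open>The inequalities are written as differences lying in \<open>{..0}\<close>, which
    makes each condition the preimage of a closed set under a real function.\<close>
  define R where "R k = {z \<in> topspace ?T. partial_sum (snd z) k - (1 - fst z) \<in> {..0} \<and>
      1 - fst z - partial_sum (snd z) (Suc k) \<in> {..0}}" for k
  have mem: "fst z \<in> {0..1} \<and> snd z \<in> standard_simplex n" if "z \<in> topspace ?T" for z
    using that by (simp add: mem_Times_iff)
  have time: "continuous_map ?T euclideanreal fst"
    using continuous_map_fst[of "top_of_set {0..1::real}" "simplex_space n"]
    by (simp add: continuous_map_in_subtopology)
  have "continuous_map ?T (powertop_real UNIV) snd"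
    using continuous_map_snd[of "top_of_set {0..1::real}" "simplex_space n"]
    unfolding continuous_map_in_subtopology by simp
  then have coord: "continuous_map ?T euclideanreal (\<lambda>z. snd z i)" for i
    unfolding continuous_map_componentwise_UNIV by blast
  have psum: "continuous_map ?T euclideanreal (\<lambda>z. partial_sum (snd z) i)" for i
    unfolding partial_sum_def by (intro continuous_map_sum coord) simp
  have cont_cut: "continuous_map ?T euclideanreal (\<lambda>z. cut_weight (fst z) (snd z) p)" for p
  proof (cases p)
    case (Pair i b)
    consider "b = 0" | "b = 1" | "b > 1" by linarith
    then show ?thesis
    proof cases
      case 1
      then show ?thesis unfolding Pair cut_weight_def prod.case
        by (simp only: if_True simp_thms) (intro continuous_map_diff continuous_map_real_min psum time, simp_all)
    next
      case 2
      then show ?thesis unfolding Pair cut_weight_def prod.case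
        by (simp only: if_True if_False simp_thms one_neq_zero)
          (intro continuous_map_diff continuous_map_real_max psum time, simp_all)
    next
      case 3
      then show ?thesis unfolding Pair cut_weight_def prod.case by simp
    qed
  qed
  have closed: "closedin ?T (R k)" for k
  proof -
    have "closedin ?T {z \<in> topspace ?T. partial_sum (snd z) k - (1 - fst z) \<in> {..0}}"
      by (rule closedin_continuous_map_preimage[of _ euclideanreal])
        (intro continuous_map_diff psum time, simp_all)
    moreover have "closedin ?T {z \<in> topspace ?T. 1 - fst z - partial_sum (snd z) (Suc k) \<in> {..0}}"
      by (rule closedin_continuous_map_preimage[of _ euclideanreal])
        (intro continuous_map_diff psum time, simp_all del: partial_sum_Suc)
    ultimately have "closedin ?T ({z \<in> topspace ?T. partial_sum (snd z) k - (1 - fst z) \<in> {..0}} \<inter>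
        {z \<in> topspace ?T. 1 - fst z - partial_sum (snd z) (Suc k) \<in> {..0}})"
      by (rule closedin_Int)
    moreover have "\<dots> = R k" unfolding R_def by blast
    ultimately show ?thesis by simp
  qed
  have RD: "fst z \<in> {0..1}" "snd z \<in> standard_simplex n" "partial_sum (snd z) k \<le> 1 - fst z"
    "1 - fst z \<le> partial_sum (snd z) (Suc k)" if "z \<in> R k" for z k
    using that mem unfolding R_def by simp_all
  define f where "f k z = glue_class (nerve D) (Suc n, pr x (Suc n) (staircase k), \<lambda>j. cut_weight (fst z) (snd z) (staircase k j))" for k z
  have f: "homotopy_point (fst z) (n, x, snd z) = f k z" if "k \<le> n" "z \<in> R k" for k z
    unfolding f_def by (rule homotopy_point_staircase[OF x RD(2,1)[OF that(2)] that(1) RD(3,4)[OF that(2)]])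
  have "continuous_map ?T (realization (nerve D)) (\<lambda>z. homotopy_point (fst z) (n, x, snd z))"
  proof (rule pasting_lemma_closed[where I = "{..n}" and T = R and f = f])
    fix k assume k: "k \<in> {..n}"
    have "pr x (Suc n) (staircase k) \<in> simplices (nerve D) (Suc n)"
      using prism_simplex[OF x staircase_chain] k by simp
    from continuous_map_glue_class_cell[OF this]
    have cell: "continuous_map (simplex_space (Suc n)) (realization (nerve D))
      (\<lambda>t. glue_class (nerve D) (Suc n, pr x (Suc n) (staircase k), t))" .
    have "continuous_map (subtopology ?T (R k)) (simplex_space (Suc n)) (\<lambda>z. \<lambda>j. cut_weight (fst z) (snd z) (staircase k j))"
      unfolding continuous_map_in_subtopology continuous_map_componentwise_UNIV
    proof (intro conjI allI continuous_map_from_subtopology cont_cut funcsetI)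
      fix z assume "z \<in> topspace (subtopology ?T (R k))"
      then have z: "z \<in> R k" by simp
      show "(\<lambda>j. cut_weight (fst z) (snd z) (staircase k j)) \<in> standard_simplex (Suc n)"
        using k by (intro staircase_simplex RD[OF z]) simp_all
    qed
    from continuous_map_compose[OF this cell]
    show "continuous_map (subtopology ?T (R k)) (realization (nerve D)) (f k)"
      by (simp add: comp_def f_def[abs_def])
  next
    fix i j z assume "i \<in> {..n}" "j \<in> {..n}" "z \<in> topspace ?T \<inter> R i \<inter> R j"
    then show "f i z = f j z" using f[of i z] f[of j z] by simp
  next
    fix z assume z: "z \<in> topspace ?T"
    obtain k where k: "k \<le> n" "partial_sum (snd z) k \<le> 1 - fst z" "1 - fst z \<le> partial_sum (snd z) (Suc k)"
      using staircase_exists[of "snd z" n "fst z"] mem[OF z] by blast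
    then have "z \<in> R k" using z unfolding R_def by simp
    then show "\<exists>k. k \<in> {..n} \<and> z \<in> R k \<and> homotopy_point (fst z) (n, x, snd z) = f k z"
      using k(1) f[OF k(1)] by blast
  qed (simp_all add: closed)
  then show ?thesis by (simp add: case_prod_unfold)
qed

lemma realization_map_nerve_map:
  assumes H: "H \<in> {F, G}"
  shows "realization_map (nerve D) (nerve_map H) (glue_class (nerve C) (n, x, t)) =
    glue_class (nerve D) (n, nerve_map H n x, t)"
proof (rule realization_map_glue_class)
  show "nerve_map H n x \<in> simplices (nerve D) n" if "x \<in> simplices (nerve C) n" for n x
    using that H F G unfolding nerve_map_def
    by (auto intro!: is_functor_comp[of _ C])
  show "nerve_map H m (pull (nerve C) m n \<theta> x) = pull (nerve D) m n \<theta> (nerve_map H n x)"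
    if "\<theta> \<in> monotone_maps m n" for m n \<theta> x
    using functor_comp_assoc[OF is_functor_ordinal_map[OF that], of H x] by (simp add: nerve_map_def)
qed

theorem homotopic_realization_map:
  "homotopic_with (\<lambda>_. True) (realization (nerve C)) (realization (nerve D))
    (realization_map (nerve D) (nerve_map F)) (realization_map (nerve D) (nerve_map G))"
proof -
  obtain H where H: "continuous_map (prod_topology (top_of_set {0..1::real}) (realization (nerve C))) (realization (nerve D)) H"
    and Hp: "\<And>s p. \<lbrakk>s \<in> {0..1}; p \<in> topspace (prerealization (nerve C))\<rbrakk> \<Longrightarrow>
      H (s, glue_class (nerve C) p) = homotopy_point s p"
  proof (rule realization_homotopy[of "nerve C" "realization (nerve D)" homotopy_point])
    show "continuous_map (prod_topology (top_of_set {0..1::real}) (simplex_space n)) (realization (nerve D))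
        (\<lambda>(s, t). homotopy_point s (n, x, t))" if "x \<in> simplices (nerve C) n" for n x
      using that by (intro continuous_map_homotopy_point) simp
    show "homotopy_point s p = homotopy_point s q" if "s \<in> {0..1}" "(p, q) \<in> glue (nerve C)" for s p q
      by (rule homotopy_point_glue[OF that])
  qed blast
  have ends: "H (0, z) = realization_map (nerve D) (nerve_map F) z \<and> H (1, z) = realization_map (nerve D) (nerve_map G) z"
    if z: "z \<in> topspace (realization (nerve C))" for z
  proof -
    obtain p where p: "p \<in> topspace (prerealization (nerve C))" "z = glue_class (nerve C) p"
      using z unfolding topspace_realization by blast
    obtain n x t where pn: "p = (n, x, t)" by (rule prod_cases3)
    have xt: "is_functor (ordinal n) C x" "t \<in> standard_simplex n"
      using p(1) unfolding pn topspace_prerealization by simp_all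
    show ?thesis
      using Hp[OF _ p(1), of 0] Hp[OF _ p(1), of 1]
      unfolding p(2) pn
      by (simp add: realization_map_nerve_map xt homotopy_point_bottom homotopy_point_top)
  qed
  show ?thesis
  proof (rule iffD2[OF homotopic_with])
    show "\<exists>h. continuous_map (prod_topology (top_of_set {0..1::real}) (realization (nerve C))) (realization (nerve D)) h \<and>
        (\<forall>z\<in>topspace (realization (nerve C)). h (0, z) = realization_map (nerve D) (nerve_map F) z) \<and>
        (\<forall>z\<in>topspace (realization (nerve C)). h (1, z) = realization_map (nerve D) (nerve_map G) z) \<and>
        (\<forall>s\<in>{0..1}. True)"
      using H ends by blast
  qed simp
qed

end


section \<open>Categories contractible through two natural transformations\<close>

lemma nerve_map_id_functor:
  assumes "is_functor (ordinal n) C x"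
  shows "nerve_map (id_functor C) n x = x"
proof -
  have "obj_map x \<in> {..n} \<rightarrow>\<^sub>E Obj C" "arr_map x \<in> Arr (ordinal n) \<rightarrow>\<^sub>E Arr C"
    using assms by (simp_all add: is_functor_def)
  then have "compose {..n} (restrict id (Obj C)) (obj_map x) = obj_map x"
    "compose (Arr (ordinal n)) (restrict id (Arr C)) (arr_map x) = arr_map x"
    by (auto simp: compose_def fun_eq_iff PiE_iff extensional_def)
  then show ?thesis
    by (simp add: nerve_map_def functor_comp_def id_functor_def)
qed

text \<open>Both transformations end in \<open>G\<close>, so the homotopy from
  \<open>\<beta>\<close> is run backwards. The constant functor collapses the realization to the
  vertex \<open>c\<close>.\<close>

lemma contractible_realization_nerve:
  assumes C: "is_category C" and c: "c \<in> Obj C" and G: "is_functor C C G"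
    and \<alpha>: "natural_transformation C C (id_functor C) G \<alpha>"
    and \<beta>: "natural_transformation C C (const_functor C C c) G \<beta>"
  shows "contractible_space (realization (nerve C))" "topspace (realization (nerve C)) \<noteq> {}"
proof -
  let ?N = "nerve C" and ?K = "const_functor C C c"
  interpret id: natural_homotopy C C "id_functor C" G \<alpha>
    using C G \<alpha> is_functor_id[OF C] by unfold_locales
  interpret const: natural_homotopy C C ?K G \<beta>
    using C G \<beta> is_functor_const[OF C C c] by unfold_locales
  define y where "y = const_functor (ordinal 0) C c"
  define a where "a = glue_class ?N (0, y, \<lambda>j. if j = 0 then 1 else 0)"
  have ordinal_cat: "is_category (ordinal 0)"
    by (auto simp: is_category_def ordinal_def)
  have y: "is_functor (ordinal 0) C y"
    unfolding y_def by (rule is_functor_const[OF ordinal_cat C c])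
  have point: "(\<lambda>j. if j = 0 then 1 else 0) \<in> standard_simplex 0"
    by (simp add: standard_simplex_def)
  have "a \<in> topspace (realization ?N)"
    unfolding topspace_realization a_def using y point by (intro imageI) (simp add: topspace_prerealization)
  then show "topspace (realization ?N) \<noteq> {}" by blast
  have ends: "realization_map ?N (nerve_map (id_functor C)) z = z \<and> realization_map ?N (nerve_map ?K) z = a"
    if z: "z \<in> topspace (realization ?N)" for z
  proof -
    obtain p where p: "p \<in> topspace (prerealization ?N)" "z = glue_class ?N p"
      using z unfolding topspace_realization by blast
    obtain n x t where pn: "p = (n, x, t)" by (rule prod_cases3)
    have x: "is_functor (ordinal n) C x" and t: "t \<in> standard_simplex n"
      using p(1) unfolding pn topspace_prerealization by simp_all
    have \<theta>: "(\<lambda>_. 0) \<in> monotone_maps n 0"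
      by (auto simp: monotone_maps_def mono_on_def)
    \<comment> \<open>The image simplex is an iterated degeneracy of the 0-simplex \<open>y\<close>,
      so gluing identifies all its points with that vertex.\<close>
    have "nerve_map ?K n x = pull ?N n 0 (\<lambda>_. 0) y"
      using ordinal_functorD(1)[OF x] ordinal_functorD(2)[OF x]
      by (auto simp: nerve_map_def functor_comp_def y_def const_functor_def ordinal_map_def compose_def
          fun_eq_iff restrict_def)
    then have "glue_class ?N (n, nerve_map ?K n x, t) = glue_class ?N (0, y, push n (\<lambda>_. 0) t)"
      using glue_class_pull[OF \<theta>, of y ?N t] y t by simp
    also have "push n (\<lambda>_. 0) t = (\<lambda>j. if j = 0 then 1 else 0)"
      using standard_simplexD(4)[OF t] by (auto simp: push_def fun_eq_iff atMost_def)
    finally show ?thesis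
      unfolding p(2) pn a_def using id.realization_map_nerve_map[of "id_functor C" n x t]
        const.realization_map_nerve_map[of ?K n x t] x t nerve_map_id_functor[OF x] by simp
  qed
  have "homotopic_with (\<lambda>_. True) (realization ?N) (realization ?N)
      (realization_map ?N (nerve_map (id_functor C))) (realization_map ?N (nerve_map ?K))"
    using id.homotopic_realization_map homotopic_with_symD[OF const.homotopic_realization_map]
    by (rule homotopic_with_trans)
  then have "homotopic_with (\<lambda>_. True) (realization ?N) (realization ?N) id (\<lambda>_. a)"
    by (rule homotopic_with_eq) (use ends in auto)
  then show "contractible_space (realization ?N)"
    unfolding contractible_space_def by blast
qed

theorem aspherical_if_natural_transformations:
  assumes C: "is_category C" and "c \<in> Obj C" "is_functor C C G"
    and "natural_transformation C C (id_functor C) G \<alpha>"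
    and "natural_transformation C C (const_functor C C c) G \<beta>"
  shows "aspherical C"
proof -
  let ?T = terminal_category and ?u = "to_terminal C"
  note T = is_category_terminal
  have "contractible_space (realization (nerve ?T))"
  proof (rule contractible_realization_nerve(1)[OF T])
    show "() \<in> Obj ?T" by (simp add: terminal_category_def)
    show "is_functor ?T ?T (id_functor ?T)" by (rule is_functor_id[OF T])
    show "natural_transformation ?T ?T (id_functor ?T) (id_functor ?T) (\<lambda>_. ())"
      "natural_transformation ?T ?T (const_functor ?T ?T ()) (id_functor ?T) (\<lambda>_. ())"
      by (simp_all add: natural_transformation_def terminal_category_def)
  qed
  \<comment> \<open>The identity transformation of \<open>?u\<close>; its homotopy supplies the
    continuity of the realized map.\<close>
  moreover interpret natural_homotopy C ?T ?u ?u "\<lambda>_. ()"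
    using C T is_functor_to_terminal_iff[of C]
    by unfold_locales (auto simp: natural_transformation_def terminal_category_def)
  have "continuous_map (realization (nerve C)) (realization (nerve ?T)) (realization_map (nerve ?T) (nerve_map ?u))"
    using homotopic_realization_map by (blast dest: homotopic_with_imp_continuous_maps)
  ultimately show ?thesis
    unfolding aspherical_def weak_equivalence_def sset_weak_equivalence_def
    using contractible_realization_nerve[OF assms] by (intro weak_homotopy_equivalence_contractible)
qed


section \<open>Maps between tree operads\<close>

lemma Ops_tree_operad:
  "(es, e) \<in> Ops (tree_operad T) \<longleftrightarrow>
    distinct es \<and> (\<exists>S. is_subtree S T \<and> is_root S e \<and> leaves S = set es)"
  by (simp add: tree_operad_def)

lemma tree_operad_simps [simp]:
  "Colours (tree_operad T) = edges T" "op_src (tree_operad T) = fst" "op_tgt (tree_operad T) = snd"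
  "op_id (tree_operad T) e = ([e], e)"
  "op_comp (tree_operad T) p qs = (concat (map fst qs), snd p)"
  "op_perm (tree_operad T) p \<sigma> = (permute_list \<sigma> (fst p), snd p)"
  by (simp_all add: tree_operad_def)

lemma op_profile:
  assumes "p \<in> Ops (tree_operad T)"
  shows "set (fst p) \<subseteq> edges T" "snd p \<in> edges T"
  using assms by (auto simp: tree_operad_def is_subtree_def is_root_def leaves_def)

text \<open>An operation of a tree operad is its profile, so a morphism is determined by its values
  on edges. The restrictions provide the extensionality required of operad maps.\<close>

definition edge_map :: "'e tree \<Rightarrow> ('e \<Rightarrow> 'e) \<Rightarrow> 'e tree_map" where
  "edge_map S \<phi> = \<lparr>colour_map = restrict \<phi> (edges S),
     op_map = (\<lambda>(es, e)\<in>Ops (tree_operad S). (map \<phi> es, \<phi> e))\<rparr>"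

definition preserves_ops :: "'e tree \<Rightarrow> 'e tree \<Rightarrow> ('e \<Rightarrow> 'e) \<Rightarrow> bool" where
  "preserves_ops S T \<phi> \<longleftrightarrow>
     (\<forall>(es, e)\<in>Ops (tree_operad S). (map \<phi> es, \<phi> e) \<in> Ops (tree_operad T))"

lemma edge_map_cong:
  assumes "\<And>x. x \<in> edges S \<Longrightarrow> \<phi> x = \<psi> x"
  shows "edge_map S \<phi> = edge_map S \<psi>"
proof -
  have "map \<phi> es = map \<psi> es \<and> \<phi> e = \<psi> e" if "(es, e) \<in> Ops (tree_operad S)" for es e
    using op_profile[OF that] assms by (auto intro!: map_cong)
  then show ?thesis
    using assms by (auto simp: edge_map_def fun_eq_iff restrict_def)
qed

lemma edge_op:
  assumes T: "is_tree T" and e: "e \<in> edges T"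
  shows "([e], e) \<in> Ops (tree_operad T)"
  using is_operad_tree_operad[OF T] e by (auto simp: is_operad_def)

lemma preserves_opsD:
  "\<lbrakk>preserves_ops S T \<phi>; (es, e) \<in> Ops (tree_operad S)\<rbrakk> \<Longrightarrow> (map \<phi> es, \<phi> e) \<in> Ops (tree_operad T)"
  by (auto simp: preserves_ops_def)

lemma preserves_ops_edge:
  assumes "is_tree S" "preserves_ops S T \<phi>" "e \<in> edges S"
  shows "\<phi> e \<in> edges T"
  using op_profile(2)[OF preserves_opsD[OF assms(2) edge_op[OF assms(1,3)]]] by simp

text \<open>Units, composites and permutations in a tree operad are computed on profiles, and list
  mapping commutes with them; what has to be required is that the image profiles are
  operations.\<close>

lemma is_operad_map_edge_map:
  assumes S: "is_tree S" and \<phi>: "preserves_ops S T \<phi>"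
  shows "is_operad_map (tree_operad S) (tree_operad T) (edge_map S \<phi>)"
proof -
  let ?P = "tree_operad S" and ?Q = "tree_operad T" and ?f = "edge_map S \<phi>"
  have opS: "is_operad ?P" by (rule is_operad_tree_operad[OF S])
  have om: "op_map ?f p = (map \<phi> (fst p), \<phi> (snd p))" if "p \<in> Ops ?P" for p
    using that by (simp add: edge_map_def split_beta)
  have cm: "colour_map ?f c = \<phi> c" if "c \<in> edges S" for c
    using that by (simp add: edge_map_def)
  have mcm: "map (colour_map ?f) (fst p) = map \<phi> (fst p)" "colour_map ?f (snd p) = \<phi> (snd p)" if "p \<in> Ops ?P" for p
    using op_profile[OF that] cm by auto
  show ?thesis
    unfolding is_operad_map_def
  proof (intro conjI ballI allI impI)
    show "colour_map ?f \<in> Colours ?P \<rightarrow>\<^sub>E Colours ?Q"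
      using preserves_ops_edge[OF S \<phi>] by (auto simp: edge_map_def)
    show "op_map ?f \<in> Ops ?P \<rightarrow>\<^sub>E Ops ?Q"
      using preserves_opsD[OF \<phi>] by (auto simp: edge_map_def)
  next
    fix p assume p: "p \<in> Ops ?P"
    show "op_src ?Q (op_map ?f p) = map (colour_map ?f) (op_src ?P p)"
      "op_tgt ?Q (op_map ?f p) = colour_map ?f (op_tgt ?P p)"
      using om[OF p] mcm[OF p] by simp_all
  next
    fix c assume "c \<in> Colours ?P"
    then show "op_map ?f (op_id ?P c) = op_id ?Q (colour_map ?f c)"
      using om[OF edge_op[OF S]] cm by simp
  next
    fix p qs assume c: "composable ?P p qs"
    then have "op_comp ?P p qs \<in> Ops ?P" by (rule tree_operad_comp_closed[OF S])
    then have "op_map ?f (op_comp ?P p qs) = (map \<phi> (concat (map fst qs)), \<phi> (snd p))"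
      using om by fastforce
    moreover have "map (op_map ?f) qs = map (\<lambda>q. (map \<phi> (fst q), \<phi> (snd q))) qs"
      using c om by (intro map_cong) (auto simp: composable_def)
    moreover have "snd (op_map ?f p) = \<phi> (snd p)"
      using c om[of p] by (simp add: composable_def)
    ultimately show "op_map ?f (op_comp ?P p qs) = op_comp ?Q (op_map ?f p) (map (op_map ?f) qs)"
      by (simp add: map_concat comp_def del: map_eq_conv)
  next
    fix p \<sigma> assume p: "p \<in> Ops ?P" and \<sigma>: "\<sigma> permutes {..<length (op_src ?P p)}"
    then have "op_perm ?P p \<sigma> \<in> Ops ?P" using opS unfolding is_operad_def by blast
    then have "op_map ?f (op_perm ?P p \<sigma>) = (map \<phi> (permute_list \<sigma> (fst p)), \<phi> (snd p))"
      using om by fastforce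
    then show "op_map ?f (op_perm ?P p \<sigma>) = op_perm ?Q (op_map ?f p) \<sigma>"
      using om[OF p] \<sigma> by (simp add: permute_list_map)
  qed
qed

text \<open>The converse of \<open>is_operad_map_edge_map\<close>: from here on an arrow of
  \<open>Omega\<close> is handled as a function on edges.\<close>

lemma is_operad_map_tree_operadD:
  assumes "is_operad_map (tree_operad S) (tree_operad T) f"
  shows "preserves_ops S T (colour_map f)" "f = edge_map S (colour_map f)"
proof -
  have om: "op_map f p = (map (colour_map f) (fst p), colour_map f (snd p))" "op_map f p \<in> Ops (tree_operad T)"
    if "p \<in> Ops (tree_operad S)" for p
    using assms that by (auto simp: is_operad_map_def prod_eq_iff)
  then show "preserves_ops S T (colour_map f)"
    by (fastforce simp: preserves_ops_def)
  have "colour_map f \<in> extensional (edges S)" "op_map f \<in> extensional (Ops (tree_operad S))"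
    using assms by (auto simp: is_operad_map_def PiE_iff)
  then have "colour_map f = restrict (colour_map f) (edges S)"
    "op_map f = (\<lambda>(es, e)\<in>Ops (tree_operad S). (map (colour_map f) es, colour_map f e))"
    using om(1) by (auto simp: fun_eq_iff restrict_def extensional_def)
  then show "f = edge_map S (colour_map f)"
    by (cases f) (auto simp: edge_map_def)
qed

lemma operad_map_comp_edge_map:
  assumes "is_tree S" "preserves_ops S T \<phi>"
  shows "operad_map_comp (tree_operad S) (edge_map T \<psi>) (edge_map S \<phi>) = edge_map S (\<psi> \<circ> \<phi>)"
  using preserves_ops_edge[OF assms] preserves_opsD[OF assms(2)]
  by (auto simp: operad_map_comp_def edge_map_def compose_def fun_eq_iff restrict_def)

lemma operad_map_id_edge_map: "operad_map_id (tree_operad S) = edge_map S id"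
  by (auto simp: operad_map_id_def edge_map_def fun_eq_iff restrict_def)

lemma preserves_ops_comp:
  "\<lbrakk>preserves_ops S T \<phi>; preserves_ops T U \<psi>\<rbrakk> \<Longrightarrow> preserves_ops S U (\<psi> \<circ> \<phi>)"
  unfolding preserves_ops_def by (auto split: prod.splits) (metis map_map)

lemma preserves_ops_id: "preserves_ops S S id"
  by (auto simp: preserves_ops_def)

section \<open>Operations of a tree and antichains of edges\<close>

text \<open>Non-strict, and reflexive on the whole type; statements such as
  \<open>above_capped_iff\<close> therefore have to ask that \<open>x\<close> is an edge.\<close>

abbreviation is_above :: "'e tree \<Rightarrow> 'e \<Rightarrow> 'e \<Rightarrow> bool" where
  "is_above T x y \<equiv> (x, y) \<in> (below T)\<^sup>*"

text \<open>The inputs are the leaves of a subtree, and by \<open>leaf_minimal\<close> no other edge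
  of a subtree lies above one of its leaves.\<close>

lemma op_antichain:
  assumes T: "is_tree T" and p: "(es, e) \<in> Ops (tree_operad T)"
  shows "distinct es"
    and "\<And>x. x \<in> set es \<Longrightarrow> is_above T x e"
    and "\<And>x y. \<lbrakk>x \<in> set es; y \<in> set es; is_above T x y\<rbrakk> \<Longrightarrow> x = y"
proof -
  obtain S where S: "is_subtree S T" "is_root S e" "leaves S = set es" and "distinct es"
    using p by (auto simp: Ops_tree_operad)
  show "distinct es" by fact
  show "x = y" if "x \<in> set es" "y \<in> set es" "is_above T x y" for x y
    using leaf_minimal[OF T S(1), of x y] that S(3) leaves_edges[of S] by blast
  show "is_above T x e" if "x \<in> set es" for x
  proof -
    have "is_above S x e"
      using that S by (auto simp: is_subtree_def is_tree_def leaves_def)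
    moreover have "below S \<subseteq> below T"
      using S(1) by (intro below_mono) (auto simp: is_subtree_def)
    ultimately show ?thesis using rtrancl_mono by blast
  qed
qed

text \<open>The subtree is obtained by cutting \<open>T\<close> at the edges in \<open>A\<close> and at \<open>e\<close>.\<close>

lemma cut_op:
  assumes T: "is_tree T" and e: "e \<in> edges T"
    and A: "A \<subseteq> edges T" "\<And>x. x \<in> A \<Longrightarrow> is_above T x e" "\<And>x y. \<lbrakk>x \<in> A; y \<in> A; is_above T x y\<rbrakk> \<Longrightarrow> x = y"
    and es: "distinct es" "set es = A \<union> {l \<in> leaves T. is_above T l e \<and> (\<forall>x\<in>A. \<not> is_above T l x)}"
  shows "(es, e) \<in> Ops (tree_operad T)"
proof -
  \<comment> \<open>\<open>B\<close> lies between \<open>e\<close> and the cut: edges of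
    \<open>A\<close> belong to it, edges strictly above them do not. Vertices with output in
    \<open>A\<close> are dropped, which turns the elements of \<open>A\<close> into leaves.\<close>
  define B where "B = {y \<in> edges T. is_above T y e \<and> (\<forall>x\<in>A. (y, x) \<notin> (below T)\<^sup>+)}"
  define U where "U = \<lparr>edges = B, vertices = {(I, d) \<in> vertices T. d \<in> B - A}\<rparr>"
  have Ae: "A \<subseteq> B"
    using A no_cycle[OF T] unfolding B_def by (blast dest: trancl_into_rtrancl)
  have eB: "e \<in> B"
    using e A(2) no_cycle[OF T] by (auto simp: B_def)
  have up: "d \<in> B - A" if y: "y \<in> B" and b: "(y, d) \<in> below T" and "y \<noteq> e" for y d
  proof -
    have "(y, e) \<in> (below T)\<^sup>*" using y by (simp add: B_def)
    then obtain d' where "(y, d') \<in> below T" "is_above T d' e"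
      using \<open>y \<noteq> e\<close> by (meson converse_rtranclE)
    then have "is_above T d e"
      using b single_valued_below[OF T] by (metis single_valuedD)
    moreover have "d \<in> edges T" using b below_edges[OF T] by auto
    moreover have "\<not> (d, x) \<in> (below T)\<^sup>*" if "x \<in> A" for x
      using y that b by (auto simp: B_def dest: rtrancl_into_trancl2)
    ultimately show ?thesis by (auto simp: B_def dest: trancl_into_rtrancl)
  qed
  have cl: "I \<subseteq> B \<and> d \<in> B" if "(I, d) \<in> vertices U" for I d
  proof -
    have v: "(I, d) \<in> vertices T" and d: "d \<in> B" "d \<notin> A"
      using that by (auto simp: U_def)
    have "i \<in> B" if i: "i \<in> I" for i
    proof -
      have b: "(i, d) \<in> below T" using v i by (auto simp: below_def)
      moreover have "(i, x) \<notin> (below T)\<^sup>+" if "x \<in> A" for x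
      proof
        assume "(i, x) \<in> (below T)\<^sup>+"
        then have "is_above T d x"
          using b single_valued_below[OF T] by (metis single_valuedD tranclD)
        then have "(d, x) \<in> (below T)\<^sup>+"
          using d that by (metis rtranclD)
        then show False using d(1) that by (auto simp: B_def)
      qed
      moreover have "is_above T i e"
        using b d(1) by (auto simp: B_def)
      ultimately show ?thesis
        using below_edges[OF T] by (auto simp: B_def)
    qed
    then show ?thesis using d by auto
  qed
  have reach: "(y, e) \<in> (below U)\<^sup>*" if "y \<in> B" for y
  proof -
    have "is_above T y e" using that by (simp add: B_def)
    then show ?thesis using that
    proof (induction rule: converse_rtrancl_induct)
      case (step y z)
      show ?case
      proof (cases "y = e")
        case False
        then have "z \<in> B - A" using up step by blast
        moreover have "(y, z) \<in> below U"
          using step.hyps(1) \<open>z \<in> B - A\<close> by (auto simp: below_def U_def)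
        ultimately show ?thesis using step.IH by auto
      qed simp
    qed simp
  qed
  have "edges U = B" by (simp add: U_def)
  have U: "is_subtree U T" "is_root U e"
    using subtreeI[OF T, of U e] cl reach eB by (auto simp: U_def B_def)
  have "leaves U = set es"
  proof (intro equalityI subsetI)
    fix y assume y: "y \<in> leaves U"
    then have yB: "y \<in> B" by (simp add: leaves_def U_def)
    show "y \<in> set es"
    proof (cases "y \<in> A")
      case False
      then have "y \<in> leaves T"
        using y yB by (auto simp: leaves_def U_def B_def)
      moreover have "\<not> is_above T y x" if "x \<in> A" for x
        using yB that False by (auto simp: B_def dest: rtranclD)
      ultimately show ?thesis using yB es(2) by (auto simp: B_def)
    qed (use es in auto)
  next
    fix y assume "y \<in> set es"
    then consider "y \<in> A" | "y \<in> leaves T" "is_above T y e" "\<forall>x\<in>A. \<not> is_above T y x"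
      using es(2) by auto
    then show "y \<in> leaves U"
    proof cases
      case 1
      then show ?thesis using Ae by (auto simp: leaves_def U_def)
    next
      case 2
      then have "y \<in> B" by (auto simp: B_def leaves_def dest: trancl_into_rtrancl)
      with 2 show ?thesis by (auto simp: leaves_def U_def)
    qed
  qed
  with U es(1) show ?thesis by (auto simp: Ops_tree_operad)
qed

text \<open>An antichain above \<open>e\<close> may fail to be a set of inputs because some leaves
  are not cut off; adding these leaves repairs this. Thus conditions on operations yield conditions
  on arbitrary antichains.\<close>

lemma antichain_op:
  assumes T: "is_tree T" and e: "e \<in> edges T"
    and A: "A \<subseteq> edges T" "\<And>x. x \<in> A \<Longrightarrow> is_above T x e" "\<And>x y. \<lbrakk>x \<in> A; y \<in> A; is_above T x y\<rbrakk> \<Longrightarrow> x = y"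
  obtains es where "(es, e) \<in> Ops (tree_operad T)" "A \<subseteq> set es"
proof -
  let ?B = "A \<union> {l \<in> leaves T. is_above T l e \<and> (\<forall>x\<in>A. \<not> is_above T l x)}"
  have "finite (edges T)" using T by (simp add: is_tree_def)
  moreover have "?B \<subseteq> edges T" using A by (auto simp: leaves_def)
  ultimately have "finite ?B" by (rule finite_subset[rotated])
  from finite_distinct_list[OF this] obtain es where es: "set es = ?B" "distinct es" by (elim exE conjE)
  have "(es, e) \<in> Ops (tree_operad T)"
    by (rule cut_op[OF T e A es(2,1)])
  then show thesis
    using es(1) that by blast
qed

text \<open>In \<open>cut_op\<close> there are no leaves left to be added.\<close>

lemma closed_op_iff:
  assumes T: "is_tree T" and cl: "leaves T = {}"
  shows "(es, e) \<in> Ops (tree_operad T) \<longleftrightarrow>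
    distinct es \<and> e \<in> edges T \<and> set es \<subseteq> edges T \<and> (\<forall>x\<in>set es. is_above T x e) \<and>
    (\<forall>x\<in>set es. \<forall>y\<in>set es. is_above T x y \<longrightarrow> x = y)"
proof
  assume p: "(es, e) \<in> Ops (tree_operad T)"
  show "distinct es \<and> e \<in> edges T \<and> set es \<subseteq> edges T \<and> (\<forall>x\<in>set es. is_above T x e) \<and>
    (\<forall>x\<in>set es. \<forall>y\<in>set es. is_above T x y \<longrightarrow> x = y)"
    using op_antichain[OF T p] op_profile[OF p] by simp
qed (auto intro!: cut_op[OF T, of e "set es"] simp: cl)

text \<open>The single edge \<open>x\<close> is an antichain above \<open>y\<close>, hence an input
  of some operation with output \<open>y\<close>; the image of that operation gives the
  claim.\<close>

lemma preserves_ops_above: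
  assumes S: "is_tree S" and T: "is_tree T" and \<phi>: "preserves_ops S T \<phi>"
    and x: "x \<in> edges S" "is_above S x y"
  shows "is_above T (\<phi> x) (\<phi> y)"
proof -
  have "y \<in> edges S" using rtrancl_below_edges[OF S x(2,1)] .
  then obtain es where es: "(es, y) \<in> Ops (tree_operad S)" "{x} \<subseteq> set es"
    using antichain_op[OF S, of y "{x}"] x by blast
  then show ?thesis
    using op_antichain(2)[OF T preserves_opsD[OF \<phi> es(1)], of "\<phi> x"] by simp
qed

text \<open>Incomparable edges are inputs of a common operation whose output is the root. The image
  profile is again an operation, so its inputs are distinct and form an antichain.\<close>

lemma preserves_ops_incomparable:
  assumes S: "is_tree S" and T: "is_tree T" and \<phi>: "preserves_ops S T \<phi>"
    and x: "x \<in> edges S" and y: "y \<in> edges S" and inc: "\<not> is_above S x y" "\<not> is_above S y x"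
  shows "\<phi> x \<noteq> \<phi> y" "\<not> is_above T (\<phi> x) (\<phi> y)"
proof -
  obtain r where r: "is_root S r" using S by (auto simp: is_tree_def)
  then have "r \<in> edges S" "is_above S x r" "is_above S y r"
    using S x y by (auto simp: is_tree_def is_root_def)
  then obtain es where es: "(es, r) \<in> Ops (tree_operad S)" "{x, y} \<subseteq> set es"
    using antichain_op[OF S, of r "{x, y}"] x y inc by blast
  note p = op_antichain[OF T preserves_opsD[OF \<phi> es(1)]]
  have "inj_on \<phi> (set es)" using p(1) by (simp add: distinct_map)
  moreover have "x \<noteq> y" using inc by auto
  ultimately show "\<phi> x \<noteq> \<phi> y" using es(2) by (metis inj_onD insert_subset)
  then show "\<not> is_above T (\<phi> x) (\<phi> y)" using p(3)[of "\<phi> x" "\<phi> y"] es(2) by simp blast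
qed


section \<open>Capping a tree\<close>

definition tree_root :: "'e tree \<Rightarrow> 'e" where
  "tree_root T = (THE r. is_root T r)"

text \<open>Chosen separately for each tree, without any coherence. This does not disturb
  functoriality, since morphisms send one chosen edge to the other.\<close>

definition new_edge :: "'e tree \<Rightarrow> 'e" where
  "new_edge T = (SOME e. e \<notin> edges T)"

definition capped :: "'e tree \<Rightarrow> 'e tree" where
  "capped T = \<lparr>edges = insert (new_edge T) (edges T),
     vertices = insert ({tree_root T}, new_edge T) (vertices T \<union> Pair {} ` leaves T)\<rparr>"

lemma is_root_root:
  assumes "is_tree T" shows "is_root T (tree_root T)"
proof -
  have "\<exists>!r. is_root T r" using assms by (simp add: is_tree_def)
  then show ?thesis unfolding tree_root_def by (rule theI')
qed

lemma root_unique: "\<lbrakk>is_tree T; is_root T r\<rbrakk> \<Longrightarrow> r = tree_root T"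
  using is_root_root[of T] by (auto simp: is_tree_def)

lemma root_edge: "is_tree T \<Longrightarrow> tree_root T \<in> edges T"
  using is_root_root[of T] by (simp add: is_root_def)

lemma above_root: "\<lbrakk>is_tree T; x \<in> edges T\<rbrakk> \<Longrightarrow> is_above T x (tree_root T)"
  using is_root_root[of T] by (simp add: is_tree_def)

lemma new_edge_notin:
  fixes T :: "'e::infinite tree"
  assumes "is_tree T" shows "new_edge T \<notin> edges T"
proof -
  have "finite (edges T)" using assms by (simp add: is_tree_def)
  then have "\<exists>e. e \<notin> edges T" by (rule ex_new_if_finite[OF infinite_UNIV])
  then show ?thesis unfolding new_edge_def by (rule someI_ex)
qed

lemma edges_capped [simp]: "edges (capped T) = insert (new_edge T) (edges T)"
  by (simp add: capped_def)

lemma below_capped: "below (capped T) = insert (tree_root T, new_edge T) (below T)"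
  by (auto simp: below_def capped_def)

context
  fixes T :: "'e::infinite tree"
  assumes T: "is_tree T"
begin

lemma above_capped_iff:
  assumes "x \<in> edges (capped T)"
  shows "is_above (capped T) x y \<longleftrightarrow> y = new_edge T \<or> x \<in> edges T \<and> is_above T x y"
proof
  assume "is_above (capped T) x y"
  then show "y = new_edge T \<or> x \<in> edges T \<and> is_above T x y"
  proof induction
    case base
    show ?case using assms by auto
  next
    case (step y z)
    then show ?case
      using below_edges[OF T] new_edge_notin[OF T] root_edge[OF T]
      by (auto simp: below_capped)
  qed
next
  assume "y = new_edge T \<or> x \<in> edges T \<and> is_above T x y"
  moreover have "is_above T x y \<Longrightarrow> is_above (capped T) x y" for x y
    by (rule subsetD[OF rtrancl_mono]) (auto simp: below_capped)
  moreover have "(tree_root T, new_edge T) \<in> below (capped T)"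
    by (simp add: below_capped)
  ultimately show "is_above (capped T) x y"
    using above_root[OF T] assms by (metis edges_capped insertE rtrancl.simps)
qed

lemma is_root_capped: "is_root (capped T) r \<longleftrightarrow> r = new_edge T"
proof
  assume r: "is_root (capped T) r"
  show "r = new_edge T"
  proof (rule ccontr)
    assume "r \<noteq> new_edge T"
    with r have "is_root T r" by (auto simp: is_root_def capped_def)
    then have "r = tree_root T" by (rule root_unique[OF T])
    with r show False by (auto simp: is_root_def capped_def)
  qed
next
  have "new_edge T \<notin> I" if "(I, d) \<in> vertices (capped T)" for I d
    using that T new_edge_notin[OF T] root_edge[OF T] by (fastforce simp: capped_def is_tree_def)
  then show "r = new_edge T \<Longrightarrow> is_root (capped T) r"
    by (auto simp: is_root_def)
qed

lemma is_tree_capped: "is_tree (capped T)"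
proof -
  have fin: "finite (edges T)" "finite (vertices T)"
    and ends: "\<And>I d. (I, d) \<in> vertices T \<Longrightarrow> I \<subseteq> edges T \<and> d \<in> edges T"
    and out: "\<And>I J d. \<lbrakk>(I, d) \<in> vertices T; (J, d) \<in> vertices T\<rbrakk> \<Longrightarrow> I = J"
    and inp: "\<And>I J d c. \<lbrakk>(I, d) \<in> vertices T; (J, c) \<in> vertices T; I \<inter> J \<noteq> {}\<rbrakk> \<Longrightarrow> I = J \<and> d = c"
  proof -
    have 1: "\<forall>v\<in>vertices T. \<forall>w\<in>vertices T. snd v = snd w \<longrightarrow> v = w"
      and 2: "\<forall>v\<in>vertices T. \<forall>w\<in>vertices T. fst v \<inter> fst w \<noteq> {} \<longrightarrow> v = w"
      using T by (simp_all add: is_tree_def)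
    show "finite (edges T)" "finite (vertices T)" "\<And>I d. (I, d) \<in> vertices T \<Longrightarrow> I \<subseteq> edges T \<and> d \<in> edges T"
      using T by (auto simp: is_tree_def)
    show "I = J" if "(I, d) \<in> vertices T" "(J, d) \<in> vertices T" for I J d
      using 1[rule_format, OF that] by simp
    show "I = J \<and> d = c" if "(I, d) \<in> vertices T" "(J, c) \<in> vertices T" "I \<inter> J \<noteq> {}" for I J d c
      using 2[rule_format, OF that(1,2)] that(3) by simp
  qed
  have tree_root: "tree_root T \<notin> I" if "(I, d) \<in> vertices T" for I d
    using is_root_root[OF T] that by (auto simp: is_root_def)
  note new = new_edge_notin[OF T]
  have V: "(I, d) \<in> vertices (capped T) \<longleftrightarrow>
      I = {tree_root T} \<and> d = new_edge T \<or> (I, d) \<in> vertices T \<or> I = {} \<and> d \<in> leaves T" for I d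
    by (auto simp: capped_def)
  have leaf: "d \<in> edges T" "(I, d) \<notin> vertices T" if "d \<in> leaves T" for I d
    using that by (auto simp: leaves_def)
  have out': "I = J" if "(I, d) \<in> vertices (capped T)" "(J, d) \<in> vertices (capped T)" for I J d
    using that out[of I d J] ends[of I d] ends[of J d] leaf[of d] new unfolding V by metis
  have inp': "I = J \<and> d = c"
    if v: "(I, d) \<in> vertices (capped T)" "(J, c) \<in> vertices (capped T)" and ne: "I \<inter> J \<noteq> {}" for I J d c
  proof -
    \<comment> \<open>Stumps have no inputs, and the old root is not an input in \<open>T\<close>.
      So a common input belongs either to two old vertices or to the new unary vertex twice.\<close>
    have "I \<noteq> {}" "J \<noteq> {}" using ne by auto
    then consider "I = {tree_root T}" "J = {tree_root T}" "d = new_edge T" "c = new_edge T"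
      | "(I, d) \<in> vertices T" "(J, c) \<in> vertices T"
      | "I = {tree_root T}" "(J, c) \<in> vertices T" | "J = {tree_root T}" "(I, d) \<in> vertices T"
      using v unfolding V by auto
    then show ?thesis
    proof cases
      case 2
      then show ?thesis using inp ne by blast
    qed (use tree_root ne in auto)
  qed
  show ?thesis
    unfolding is_tree_def
  proof (intro conjI)
    have "finite (leaves T)" using fin(1) leaves_edges by (rule rev_finite_subset)
    then show "finite (edges (capped T))" "finite (vertices (capped T))" "edges (capped T) \<noteq> {}"
      using fin by (simp_all add: capped_def)
    show "\<forall>(I, d)\<in>vertices (capped T). I \<subseteq> edges (capped T) \<and> d \<in> edges (capped T)"
      using ends root_edge[OF T] leaves_edges[of T] by (fastforce simp: capped_def)
    show "\<forall>v\<in>vertices (capped T). \<forall>w\<in>vertices (capped T). snd v = snd w \<longrightarrow> v = w"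
      using out' by (metis prod.collapse)
    show "\<forall>v\<in>vertices (capped T). \<forall>w\<in>vertices (capped T). fst v \<inter> fst w \<noteq> {} \<longrightarrow> v = w"
      using inp' by (metis prod.collapse)
    show "\<exists>!r. is_root (capped T) r"
      by (simp add: is_root_capped)
    show "\<forall>e\<in>edges (capped T). \<forall>r. is_root (capped T) r \<longrightarrow> is_above (capped T) e r"
      using above_capped_iff by (auto simp: is_root_capped)
  qed
qed

lemma leaves_capped: "leaves (capped T) = {}"
proof -
  have "\<exists>I. (I, e) \<in> vertices (capped T)" if "e \<in> edges (capped T)" for e
    using that by (cases "e \<in> leaves T") (auto simp: capped_def leaves_def)
  then show ?thesis by (fastforce simp: leaves_def)
qed

text \<open>A subtree of \<open>T\<close> is also a subtree of \<open>capped T\<close>, and it keeps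
  its leaves, because these are computed in the subtree and the stumps are not part of it.\<close>

lemma preserves_ops_capped: "preserves_ops T (capped T) id"
proof -
  have "is_subtree S T \<Longrightarrow> is_subtree S (capped T)" for S
    by (auto simp: is_subtree_def capped_def)
  then show ?thesis
    unfolding preserves_ops_def by (auto simp: Ops_tree_operad) blast
qed

end

lemma preserves_ops_capped_map:
  fixes S T :: "'e::infinite tree"
  assumes S: "is_tree S" and T: "is_tree T" and \<phi>: "preserves_ops S T \<phi>"
  shows "preserves_ops (capped S) (capped T) (\<phi>(new_edge S := new_edge T))" (is "preserves_ops _ _ ?\<psi>")
proof -
  have val: "?\<psi> x = \<phi> x" "\<phi> x \<in> edges T" "\<phi> x \<noteq> new_edge T" if "x \<in> edges S" for x
    using that new_edge_notin[OF S] new_edge_notin[OF T] preserves_ops_edge[OF S \<phi> that] by auto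
  have edge: "?\<psi> x \<in> edges (capped T)" if "x \<in> edges (capped S)" for x
    using that val by auto
  have mono: "is_above (capped T) (?\<psi> x) (?\<psi> y)"
    if "x \<in> edges (capped S)" "is_above (capped S) x y" for x y
  proof (cases "y = new_edge S")
    case True
    then show ?thesis using above_capped_iff[OF T edge[OF that(1)]] by simp
  next
    case False
    then have *: "x \<in> edges S" "is_above S x y"
      using that above_capped_iff[OF S] by auto
    moreover have "y \<in> edges S" using rtrancl_below_edges[OF S *(2,1)] .
    ultimately show ?thesis
      using preserves_ops_above[OF S T \<phi>] val above_capped_iff[OF T edge[OF that(1)]] by simp
  qed
  \<comment> \<open>The new edge lies below every edge, hence two incomparable edges are both
    old.\<close>
  have inc: "?\<psi> x \<noteq> ?\<psi> y \<and> \<not> is_above (capped T) (?\<psi> x) (?\<psi> y)"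
    if "x \<in> edges (capped S)" "y \<in> edges (capped S)" "\<not> is_above (capped S) x y" "\<not> is_above (capped S) y x" for x y
  proof -
    have *: "x \<in> edges S" "y \<in> edges S"
      using that above_capped_iff[OF S] by auto
    moreover have "\<not> is_above S x y" "\<not> is_above S y x"
      using that above_capped_iff[OF S] * by auto
    ultimately show ?thesis
      using preserves_ops_incomparable[OF S T \<phi>] val above_capped_iff[OF T edge[OF that(1)]] by simp
  qed
  show ?thesis
    unfolding preserves_ops_def
  proof clarify
    fix es e assume "(es, e) \<in> Ops (tree_operad (capped S))"
    then have p: "distinct es" "e \<in> edges (capped S)" "set es \<subseteq> edges (capped S)"
      "\<And>x. x \<in> set es \<Longrightarrow> is_above (capped S) x e"
      "\<And>x y. \<lbrakk>x \<in> set es; y \<in> set es; is_above (capped S) x y\<rbrakk> \<Longrightarrow> x = y"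
      using closed_op_iff[OF is_tree_capped[OF S] leaves_capped[OF S]] by auto
    \<comment> \<open>\<open>\<phi>\<close> may identify comparable edges, as degeneracies do, but
      distinct inputs of one operation are incomparable and so stay distinct.\<close>
    have e: "?\<psi> x \<noteq> ?\<psi> y \<and> \<not> is_above (capped T) (?\<psi> x) (?\<psi> y)" if "x \<in> set es" "y \<in> set es" "x \<noteq> y" for x y
      using that p(3,5) by (intro inc) auto
    have "distinct (map ?\<psi> es)"
      using p(1) e unfolding distinct_map inj_on_def by blast
    moreover have "?\<psi> e \<in> edges (capped T)" using edge p(2) .
    moreover have "set (map ?\<psi> es) \<subseteq> edges (capped T)"
      using edge p(3) unfolding set_map by blast
    moreover have "\<forall>x\<in>set (map ?\<psi> es). is_above (capped T) x (?\<psi> e)"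
      using mono p(3,4) unfolding set_map by blast
    moreover have "\<forall>x\<in>set (map ?\<psi> es). \<forall>y\<in>set (map ?\<psi> es). is_above (capped T) x y \<longrightarrow> x = y"
      using e unfolding set_map by blast
    ultimately show "(map ?\<psi> es, ?\<psi> e) \<in> Ops (tree_operad (capped T))"
      using closed_op_iff[OF is_tree_capped[OF T] leaves_capped[OF T]] by blast
  qed
qed


section \<open>Functors and natural transformations on the category of trees\<close>

lemma Obj_Omega [simp]: "T \<in> Obj Omega \<longleftrightarrow> is_tree T"
  by (simp add: Omega_def)

lemma Arr_Omega_edge_map:
  "\<lbrakk>is_tree S; is_tree T; preserves_ops S T \<phi>\<rbrakk> \<Longrightarrow> (S, edge_map S \<phi>, T) \<in> Arr Omega"
  by (simp add: Omega_def is_operad_map_edge_map)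

lemma Arr_OmegaE:
  assumes "f \<in> Arr Omega"
  obtains S T \<phi> where "f = (S, edge_map S \<phi>, T)" "is_tree S" "is_tree T" "preserves_ops S T \<phi>"
proof -
  obtain S g T where f: "f = (S, g, T)" by (rule prod_cases3)
  then have "is_tree S" "is_tree T" and g: "is_operad_map (tree_operad S) (tree_operad T) g"
    using assms by (simp_all add: Omega_def)
  moreover have "f = (S, edge_map S (colour_map g), T)"
    unfolding f using is_operad_map_tree_operadD(2)[OF g] by simp
  ultimately show thesis
    using that is_operad_map_tree_operadD(1)[OF g] by blast
qed

lemma Omega_simps [simp]:
  "Dom Omega (S, f, T) = S" "Cod Omega (S, f, T) = T" "Id Omega T = (T, edge_map T id, T)"
  by (simp_all add: Omega_def operad_map_id_edge_map)

lemma Comp_Omega_edge_map: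
  assumes "is_tree S" "preserves_ops S T \<phi>"
  shows "Comp Omega (T', edge_map T \<psi>, U) (S, edge_map S \<phi>, T) = (S, edge_map S (\<psi> \<circ> \<phi>), U)"
  using operad_map_comp_edge_map[OF assms] by (simp add: Omega_def)

definition cap_functor :: "('e tree, 'e tree \<times> 'e tree_map \<times> 'e tree, 'e tree, 'e tree \<times> 'e tree_map \<times> 'e tree) cat_functor" where
  "cap_functor = \<lparr>obj_map = restrict capped (Obj Omega),
     arr_map = (\<lambda>(S, f, T)\<in>Arr Omega.
       (capped S, edge_map (capped S) ((colour_map f)(new_edge S := new_edge T)), capped T))\<rparr>"

lemma arr_map_cap_functor:
  fixes S T :: "'e::infinite tree"
  assumes "is_tree S" "is_tree T" "preserves_ops S T \<phi>"
  shows "arr_map cap_functor (S, edge_map S \<phi>, T) =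
    (capped S, edge_map (capped S) (\<phi>(new_edge S := new_edge T)), capped T)"
proof -
  \<comment> \<open>Off \<open>edges S\<close> the colour map has the value
    \<open>undefined\<close>; the one further edge of \<open>capped S\<close> is the updated
    one.\<close>
  have "edge_map (capped S) ((colour_map (edge_map S \<phi>))(new_edge S := new_edge T)) =
      edge_map (capped S) (\<phi>(new_edge S := new_edge T))"
    by (rule edge_map_cong) (auto simp: edge_map_def)
  then show ?thesis
    using Arr_Omega_edge_map[OF assms] by (simp add: cap_functor_def)
qed

lemma is_functor_cap_functor:
  "is_functor (Omega :: ('e::infinite tree, _) category) Omega cap_functor"
  unfolding is_functor_def
proof (intro conjI ballI impI)
  show "obj_map (cap_functor :: ('e tree, _, _, _) cat_functor) \<in> Obj Omega \<rightarrow>\<^sub>E Obj Omega"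
    by (auto simp: cap_functor_def is_tree_capped)
  have "arr_map cap_functor f \<in> Arr Omega" if "f \<in> Arr Omega" for f :: "'e tree \<times> 'e tree_map \<times> 'e tree"
    using that by (elim Arr_OmegaE)
      (simp add: arr_map_cap_functor Arr_Omega_edge_map is_tree_capped preserves_ops_capped_map)
  moreover have "arr_map (cap_functor :: ('e tree, _, _, _) cat_functor) \<in> extensional (Arr Omega)"
    by (simp add: cap_functor_def)
  ultimately show "arr_map (cap_functor :: ('e tree, _, _, _) cat_functor) \<in> Arr Omega \<rightarrow>\<^sub>E Arr Omega"
    by (auto simp: PiE_iff)
next
  fix f :: "'e tree \<times> 'e tree_map \<times> 'e tree" assume "f \<in> Arr Omega"
  then show "Dom Omega (arr_map cap_functor f) = obj_map cap_functor (Dom Omega f)"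
    "Cod Omega (arr_map cap_functor f) = obj_map cap_functor (Cod Omega f)"
    by (auto elim!: Arr_OmegaE simp: arr_map_cap_functor) (simp_all add: cap_functor_def)
next
  fix T :: "'e tree" assume T: "T \<in> Obj Omega"
  then show "arr_map cap_functor (Id Omega T) = Id Omega (obj_map cap_functor T)"
    by (simp add: arr_map_cap_functor preserves_ops_id) (auto simp: cap_functor_def intro!: edge_map_cong)
next
  fix f g :: "'e tree \<times> 'e tree_map \<times> 'e tree"
  assume "f \<in> Arr Omega" and "g \<in> Arr Omega" "Dom Omega g = Cod Omega f"
  then obtain S T U \<phi> \<psi> where f: "f = (S, edge_map S \<phi>, T)" "is_tree S" "is_tree T" "preserves_ops S T \<phi>"
    and g: "g = (T, edge_map T \<psi>, U)" "is_tree U" "preserves_ops T U \<psi>"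
    by (elim Arr_OmegaE) simp
  have "arr_map cap_functor (Comp Omega g f) =
      (capped S, edge_map (capped S) ((\<psi> \<circ> \<phi>)(new_edge S := new_edge U)), capped U)"
    using f g by (simp add: Comp_Omega_edge_map arr_map_cap_functor preserves_ops_comp)
  \<comment> \<open>An old edge is sent by \<open>\<phi>\<close> to an old edge, so the update of
    \<open>\<psi>\<close> at \<open>new_edge T\<close> only acts on the image of
    \<open>new_edge S\<close>.\<close>
  also have "edge_map (capped S) ((\<psi> \<circ> \<phi>)(new_edge S := new_edge U)) =
      edge_map (capped S) (\<psi>(new_edge T := new_edge U) \<circ> \<phi>(new_edge S := new_edge T))"
    using preserves_ops_edge[OF f(2,4)] new_edge_notin[OF f(3)] by (intro edge_map_cong) fastforce
  also have "(capped S, \<dots>, capped U) = Comp Omega (arr_map cap_functor g) (arr_map cap_functor f)"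
    using f g by (simp add: Comp_Omega_edge_map arr_map_cap_functor is_tree_capped preserves_ops_capped_map)
  finally show "arr_map cap_functor (Comp Omega g f) =
      Comp Omega (arr_map cap_functor g) (arr_map cap_functor f)" .
qed

lemma natural_id_cap:
  "natural_transformation Omega (Omega :: ('e::infinite tree, _) category) (id_functor Omega) cap_functor
    (\<lambda>T. (T, edge_map T id, capped T))"
  unfolding natural_transformation_def
proof (intro conjI ballI)
  fix T :: "'e tree" assume "T \<in> Obj Omega"
  then show "(T, edge_map T id, capped T) \<in> Arr Omega"
    "Dom Omega (T, edge_map T id, capped T) = obj_map (id_functor Omega) T"
    "Cod Omega (T, edge_map T id, capped T) = obj_map cap_functor T"
    by (simp_all add: Arr_Omega_edge_map is_tree_capped preserves_ops_capped id_functor_def cap_functor_def)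
next
  fix f :: "'e tree \<times> 'e tree_map \<times> 'e tree" assume "f \<in> Arr Omega"
  then obtain S T \<phi> where f: "f = (S, edge_map S \<phi>, T)" "is_tree S" "is_tree T" "preserves_ops S T \<phi>"
    by (rule Arr_OmegaE)
  have "edge_map S (\<phi>(new_edge S := new_edge T)) = edge_map S \<phi>"
    using new_edge_notin[OF f(2)] by (intro edge_map_cong) auto
  then have "Comp Omega (Cod Omega f, edge_map (Cod Omega f) id, capped (Cod Omega f)) f =
      Comp Omega (arr_map cap_functor f) (Dom Omega f, edge_map (Dom Omega f) id, capped (Dom Omega f))"
    using f by (simp add: Comp_Omega_edge_map arr_map_cap_functor preserves_ops_capped del: fun_upd_apply)
  then show "Comp Omega (Cod Omega f, edge_map (Cod Omega f) id, capped (Cod Omega f)) (arr_map (id_functor Omega) f) =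
      Comp Omega (arr_map cap_functor f) (Dom Omega f, edge_map (Dom Omega f) id, capped (Dom Omega f))"
    using \<open>f \<in> Arr Omega\<close> by (simp add: id_functor_def)
qed

section \<open>The one-edge tree and the constant functor\<close>

definition eta :: "'e tree" where
  "eta = \<lparr>edges = {undefined}, vertices = {}\<rparr>"

lemma is_tree_eta: "is_tree eta"
  by (auto simp: is_tree_def eta_def is_root_def)

text \<open>The identity is the only operation of \<open>eta\<close>, so arrows from
  \<open>eta\<close> amount to edges of \<open>T\<close>. Distinctness of inputs excludes
  repetitions of its edge.\<close>

lemma preserves_ops_eta:
  assumes T: "is_tree T" and "\<phi> undefined \<in> edges T"
  shows "preserves_ops eta T \<phi>"
  unfolding preserves_ops_def
proof clarify
  fix es e assume p: "(es, e) \<in> Ops (tree_operad (eta :: 'a tree))"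
  then obtain S where S: "is_subtree S (eta :: 'a tree)" "leaves S = set es" "distinct es"
    by (auto simp: Ops_tree_operad)
  have "edges S \<noteq> {}" "edges S \<subseteq> {undefined}" "vertices S = {}"
    using S(1) by (auto simp: is_subtree_def eta_def is_tree_def)
  then have "edges S = {undefined}" "leaves S = edges S"
    by (auto simp: leaves_def)
  then have "set es = {undefined}"
    using S(2) by simp
  moreover have "length es = card (set es)"
    using S(3) by (simp add: distinct_card)
  ultimately have "es = [undefined]"
    by (cases es; cases "tl es") (auto simp: subset_singleton_iff)
  moreover have "e = undefined"
    using op_profile(2)[OF p] by (simp add: eta_def)
  ultimately show "(map \<phi> es, \<phi> e) \<in> Ops (tree_operad T)"
    using edge_op[OF T assms(2)] by simp
qed

lemma natural_eta_cap:
  "natural_transformation Omega (Omega :: ('e::infinite tree, _) category) (const_functor Omega Omega eta)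
    cap_functor (\<lambda>T. (eta, edge_map eta (\<lambda>_. new_edge T), capped T))"
  unfolding natural_transformation_def
proof (intro conjI ballI)
  fix T :: "'e tree" assume "T \<in> Obj Omega"
  then show "(eta, edge_map eta (\<lambda>_. new_edge T), capped T) \<in> Arr Omega"
    "Dom Omega (eta, edge_map eta (\<lambda>_. new_edge T), capped T) = obj_map (const_functor Omega Omega eta) T"
    "Cod Omega (eta, edge_map eta (\<lambda>_. new_edge T), capped T) = obj_map cap_functor T"
    by (simp_all add: Arr_Omega_edge_map is_tree_capped is_tree_eta preserves_ops_eta const_functor_def cap_functor_def)
next
  fix f :: "'e tree \<times> 'e tree_map \<times> 'e tree" assume "f \<in> Arr Omega"
  then obtain S T \<phi> where f: "f = (S, edge_map S \<phi>, T)" "is_tree S" "is_tree T" "preserves_ops S T \<phi>"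
    by (rule Arr_OmegaE)
  have "preserves_ops eta (capped S) (\<lambda>_. new_edge S)"
    using f by (simp add: preserves_ops_eta is_tree_capped)
  then show "Comp Omega (eta, edge_map eta (\<lambda>_. new_edge (Cod Omega f)), capped (Cod Omega f))
        (arr_map (const_functor Omega Omega eta) f) =
      Comp Omega (arr_map cap_functor f) (eta, edge_map eta (\<lambda>_. new_edge (Dom Omega f)), capped (Dom Omega f))"
    using f Arr_Omega_edge_map[OF f(2-4)]
    by (simp add: Comp_Omega_edge_map arr_map_cap_functor const_functor_def preserves_ops_id is_tree_eta comp_def)
qed

theorem theorem4p10:
  shows "aspherical (Omega :: ('e::infinite tree, 'e tree \<times> 'e tree_map \<times> 'e tree) category)"
proof (rule aspherical_if_natural_transformations)
  show "eta \<in> Obj Omega" by (simp add: is_tree_eta)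
qed (rule is_category_Omega is_functor_cap_functor natural_id_cap natural_eta_cap)+

end
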